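(* Let $(X_t)_{t\ge 0}$ be a pure jump subordinator with Lévy measure $\nu$, Laplace exponent $\varphi(u)=\int_0^\infty(1-e^{-ux})\,\nu(dx)$ and $G_t(x)=\mathbb{P}(X_t\le x)$. Suppose that at least one of the following conditions holds. (S1) $-t\log X_t\Rightarrow Z$ as $t\downarrow 0$, for some positive random variable $Z$ not concentrated at one point. (S2) $t\varphi(u^{1/t})\to-\log(1-F(u))$ as $t\downarrow0$ for all continuity points $u>0$ of $F$, where $F$ is the distribution function of $e^Z$ for some positive random variable $Z$ not concentrated at one point. (S3)/(S4) $-t\log X_t\Rightarrow E_\gamma$ as $t\downarrow 0$ for some finite $\gamma>0$. (S5) $\varphi(s)/\log s\to\gamma$ as $s\to\infty$ for some finite $\gamma>0$. (S6) $\log G_1(x)/\log x\to\gamma$ as $x\downarrow0$ for some finite $\gamma>0$. (S7) $\nu(x,\infty)/\log x\to-\gamma$ as $x\downarrow 0$ for some finite $\gamma>0$. Let $\gamma\in(0,\infty)$ be the constant for which $-t\log X_t\Rightarrow E_\gamma$ as $t\downarrow0$. Let $z\in(0,\infty)$, let $(\widehat\eta_s)_{s>0}$ be the extremal process with parameter $\gamma$, and set $\eta_0=z$ and $\eta_s=z\wedge\widehat\eta_s$ for $s>0$. Then, as $t\downarrow 0$, $$\bigl(z\wedge(-t\log X_{ts})\bigr)_{s\ge 0}\Rightarrow(\eta_s)_{s\ge 0}$$ weakly in $\mathcal{D}[0,\infty)$ equipped with Skorohod's $J_1$ topology.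
   Context: A pure jump subordinator is a nondecreasing càdlàg Lévy process with $X_0=0$ and $\mathbb{E}(e^{-uX_t})=e^{-t\varphi(u)}$ for $u\ge0$, where $\varphi(u)=\int_0^\infty(1-e^{-ux})\,\nu(dx)$ (no drift) and $\nu$ is a measure with $\nu(-\infty,0]=0$, $\nu(1,\infty)<\infty$ and $\int_{(0,1]}u\,\nu(du)<\infty$. $\Rightarrow$ denotes convergence in distribution, $\wedge$ denotes minimum, and $E_\gamma$ is an exponential random variable with mean $1/\gamma$. The convention $-\log 0=+\infty$ is used, so that $z\wedge(-t\log X_0)=z$. Known fact (from earlier literature): conditions (S1)–(S3) are equivalent, and for each fixed finite $\gamma>0$ conditions (S4)–(S7) with that $\gamma$ are equivalent. So under any of the conditions there is a unique $\gamma\in(0,\infty)$ with $-t\log X_t\Rightarrow E_\gamma$, and it is the $\gamma$ appearing in (S3)–(S7). Under these conditions $X_t>0$ almost surely for each $t>0$. The extremal process with parameter $\gamma$ is the (unique in law) process $(\widehat\eta_s)_{s>0}$ with nonincreasing, piecewise constant càdlàg paths such that for all $0=s_0<s_1<\dots<s_n$, $(\widehat\eta_{s_1},\dots,\widehat\eta_{s_n})$ has the same distribution as $\left(\frac1\gamma\bigwedge_{i=1}^k\frac{Z_i}{s_i-s_{i-1}}\right)_{1\le k\le n}$, where $Z_1,Z_2,\dots$ are i.i.d. exponential random variables with mean $1$. It satisfies $\lim_{s\downarrow0}\widehat\eta_s=\infty$ and $\lim_{s\to\infty}\widehat\eta_s=0$ almost surely. $\mathcal{D}[0,\infty)$ is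 the space of càdlàg functions from $[0,\infty)$ to $\mathbb{R}$. *)

theory Defs
  imports "HOL-Probability.Probability"
begin

section \<open>Convergence in distribution in a topological space\<close>

definition borel_of :: "'a topology \<Rightarrow> 'a measure" where
  "borel_of T = sigma (topspace T) {U. openin T U}"

text \<open>
  The random element \<open>Y\<close> need only be defined almost surely: a process
  whose paths lie in the path space outside a null set has a law on the path space.
\<close>

definition has_law :: "'w measure \<Rightarrow> 'a topology \<Rightarrow> ('w \<Rightarrow> 'a) \<Rightarrow> 'a measure \<Rightarrow> bool" where
  "has_law M T Y \<mu> \<longleftrightarrow>
     (\<exists>Y' \<in> M \<rightarrow>\<^sub>M borel_of T. (AE \<omega> in M. Y \<omega> = Y' \<omega>) \<and> \<mu> = distr M (borel_of T) Y')"

definition weakly_converges ::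
  "'a topology \<Rightarrow> 'i filter \<Rightarrow> ('i \<Rightarrow> 'a measure) \<Rightarrow> 'a measure \<Rightarrow> bool" where
  "weakly_converges T F \<mu> \<nu> \<longleftrightarrow>
     (\<forall>f. continuous_map T euclideanreal f \<and> bounded (f ` topspace T) \<longrightarrow>
        ((\<lambda>i. integral\<^sup>L (\<mu> i) f) \<longlongrightarrow> integral\<^sup>L \<nu> f) F)"

definition converges_in_distribution ::
  "'a topology \<Rightarrow> 'i filter \<Rightarrow> 'w measure \<Rightarrow> ('i \<Rightarrow> 'w \<Rightarrow> 'a) \<Rightarrow> 'v measure \<Rightarrow> ('v \<Rightarrow> 'a) \<Rightarrow> bool"
where
  "converges_in_distribution T F M X N Y \<longleftrightarrow>
     (\<exists>\<mu> \<nu>. (\<forall>\<^sub>F i in F. has_law M T (X i) (\<mu> i)) \<and> has_law N T Y \<nu> \<and> weakly_converges T F \<mu> \<nu>)"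

lemma borel_of_euclidean: "borel_of euclidean = borel"
  by (simp add: borel_of_def borel_def)

lemma has_law_measurable:
  "Y \<in> M \<rightarrow>\<^sub>M borel_of T \<Longrightarrow> has_law M T Y (distr M (borel_of T) Y)"
  by (auto simp: has_law_def)

lemma has_law_unique:
  assumes "has_law M T Y \<mu>" "has_law M T Y \<nu>"
  shows "\<mu> = \<nu>"
proof -
  obtain Y1 Y2 where Y: "Y1 \<in> M \<rightarrow>\<^sub>M borel_of T" "AE \<omega> in M. Y \<omega> = Y1 \<omega>" "\<mu> = distr M (borel_of T) Y1"
    "Y2 \<in> M \<rightarrow>\<^sub>M borel_of T" "AE \<omega> in M. Y \<omega> = Y2 \<omega>" "\<nu> = distr M (borel_of T) Y2"
    using assms unfolding has_law_def by blast
  have "AE \<omega> in M. Y1 \<omega> = Y2 \<omega>"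
    using Y(2,5) by eventually_elim simp
  then show ?thesis
    unfolding Y(3,6) by (intro distr_cong_AE Y(1,4)) simp_all
qed

section \<open>The space \<open>D[0,\<infinity>)\<close> with the Skorohod \<open>J\<^sub>1\<close> topology\<close>

definition cadlag_on :: "real set \<Rightarrow> (real \<Rightarrow> real) \<Rightarrow> bool" where
  "cadlag_on I x \<longleftrightarrow>
     (\<forall>t\<in>I. continuous (at t within I \<inter> {t..}) x \<and> (\<exists>l. (x \<longlongrightarrow> l) (at t within I \<inter> {..<t})))"

definition skorohod_space :: "(real \<Rightarrow> real) set" where
  "skorohod_space = {x \<in> extensional {0..}. cadlag_on {0..} x}"

definition time_change :: "(real \<Rightarrow> real) \<Rightarrow> bool" where
  "time_change l \<longleftrightarrow> continuous_on {0..} l \<and> strict_mono_on {0..} l \<and> l ` {0..} = {0..}"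

definition j1_nhd :: "real \<Rightarrow> (real \<Rightarrow> real) \<Rightarrow> (real \<Rightarrow> real) set" where
  "j1_nhd e x = {y \<in> skorohod_space. \<exists>l. time_change l \<and>
     (\<forall>s\<ge>0. \<bar>l s - s\<bar> \<le> e) \<and> (\<forall>s\<in>{0..1/e}. \<bar>y (l s) - x s\<bar> \<le> e)}"

text \<open>
  The sets \<open>j1_nhd e x\<close>, \<open>e > 0\<close>, form a neighbourhood base of \<open>x\<close>; the lemma
  \<open>limitin_j1_topology\<close> below recovers the usual description of convergent sequences.
\<close>

definition j1_topology :: "(real \<Rightarrow> real) topology" where
  "j1_topology = topology (\<lambda>U. U \<subseteq> skorohod_space \<and> (\<forall>x\<in>U. \<exists>e>0. j1_nhd e x \<subseteq> U))"

lemma j1_nhd_mono: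
  assumes "0 < d" "d \<le> e"
  shows "j1_nhd d x \<subseteq> j1_nhd e x"
proof
  fix y assume "y \<in> j1_nhd d x"
  then obtain l where y: "y \<in> skorohod_space" "time_change l" "\<forall>s\<ge>0. \<bar>l s - s\<bar> \<le> d"
    "\<forall>s\<in>{0..1/d}. \<bar>y (l s) - x s\<bar> \<le> d"
    by (auto simp: j1_nhd_def)
  have "1/e \<le> 1/d"
    using assms by (simp add: frac_le)
  then have "\<forall>s\<ge>0. \<bar>l s - s\<bar> \<le> e" "\<forall>s\<in>{0..1/e}. \<bar>y (l s) - x s\<bar> \<le> e"
    using y assms by force+
  with y show "y \<in> j1_nhd e x"
    by (auto simp: j1_nhd_def)
qed

lemma time_change_id: "time_change (\<lambda>s. s)"
  by (auto simp: time_change_def strict_mono_on_def)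

lemma time_change_nonneg: "time_change l \<Longrightarrow> 0 \<le> s \<Longrightarrow> 0 \<le> l s"
  by (auto simp: time_change_def)

lemma time_change_comp:
  assumes "time_change l" "time_change m"
  shows "time_change (\<lambda>s. m (l s))"
proof -
  have "(\<lambda>s. m (l s)) ` {0..} = m ` (l ` {0..})"
    by auto
  then show ?thesis
    using assms time_change_nonneg[OF assms(1)]
    by (auto simp: time_change_def strict_mono_on_def intro!: continuous_on_compose2[of "{0..}" m])
qed

lemma mem_j1_nhd_self: "x \<in> skorohod_space \<Longrightarrow> 0 < e \<Longrightarrow> x \<in> j1_nhd e x"
  unfolding j1_nhd_def using time_change_id by force

lemma j1_nhd_triangle:
  assumes y: "y \<in> j1_nhd d x" and w: "w \<in> j1_nhd e y"
    and "0 < d" "0 < e" and e: "1/d + d \<le> 1/e"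
  shows "w \<in> j1_nhd (d + e) x"
proof -
  obtain l where l: "time_change l" "\<And>s. s \<ge> 0 \<Longrightarrow> \<bar>l s - s\<bar> \<le> d"
    "\<And>s. s \<in> {0..1/d} \<Longrightarrow> \<bar>y (l s) - x s\<bar> \<le> d"
    using y by (auto simp: j1_nhd_def)
  obtain m where m: "time_change m" "\<And>s. s \<ge> 0 \<Longrightarrow> \<bar>m s - s\<bar> \<le> e"
    "\<And>s. s \<in> {0..1/e} \<Longrightarrow> \<bar>w (m s) - y s\<bar> \<le> e" and "w \<in> skorohod_space"
    using w by (auto simp: j1_nhd_def)
  have "\<bar>m (l s) - s\<bar> \<le> d + e" if "s \<ge> 0" for s
    using l(2)[OF that] m(2)[OF time_change_nonneg[OF l(1) that]] by linarith
  moreover have "\<bar>w (m (l s)) - x s\<bar> \<le> d + e" if "s \<in> {0..1/(d+e)}" for s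
  proof -
    have "1/(d+e) \<le> 1/d"
      using assms by (simp add: frac_le)
    with that have s: "s \<in> {0..1/d}"
      by auto
    then have "l s \<in> {0..1/e}"
      using l(2)[of s] time_change_nonneg[OF l(1), of s] e by auto
    from m(3)[OF this] l(3)[OF s] show ?thesis
      by linarith
  qed
  ultimately show ?thesis
    using time_change_comp[OF l(1) m(1)] \<open>w \<in> skorohod_space\<close> by (auto simp: j1_nhd_def)
qed

lemma openin_j1_topology:
  "openin j1_topology U \<longleftrightarrow> U \<subseteq> skorohod_space \<and> (\<forall>x\<in>U. \<exists>e>0. j1_nhd e x \<subseteq> U)"
proof -
  have "istopology (\<lambda>U. U \<subseteq> skorohod_space \<and> (\<forall>x\<in>U. \<exists>e>0. j1_nhd e x \<subseteq> U))"
    unfolding istopology_def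
  proof (intro conjI allI impI, goal_cases)
    case (2 S T)
    show ?case
    proof
      fix x assume "x \<in> S \<inter> T"
      then obtain d e where "d > 0" "j1_nhd d x \<subseteq> S" "e > 0" "j1_nhd e x \<subseteq> T"
        using 2 by blast
      then show "\<exists>e>0. j1_nhd e x \<subseteq> S \<inter> T"
        using j1_nhd_mono[of "min d e" d x] j1_nhd_mono[of "min d e" e x]
        by (intro exI[of _ "min d e"]) auto
    qed
  next
    case (4 K)
    then show ?case
      by (meson Union_iff Union_upper subset_trans)
  qed auto
  then show ?thesis
    unfolding j1_topology_def by (subst topology_inverse') auto
qed

lemma topspace_j1_topology [simp]: "topspace j1_topology = skorohod_space"
proof
  show "topspace j1_topology \<subseteq> skorohod_space"
    using openin_j1_topology openin_topspace by blast
  have "openin j1_topology skorohod_space"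
    unfolding openin_j1_topology j1_nhd_def using zero_less_one by blast
  then show "skorohod_space \<subseteq> topspace j1_topology"
    by (rule openin_subset)
qed

lemma j1_nhd_contains_open:
  assumes "x \<in> skorohod_space" "0 < e"
  shows "\<exists>U. openin j1_topology U \<and> x \<in> U \<and> U \<subseteq> j1_nhd e x"
proof (intro exI conjI)
  let ?U = "\<Union>d\<in>{0<..<e}. j1_nhd d x"
  show "openin j1_topology ?U"
    unfolding openin_j1_topology
  proof (intro conjI ballI)
    show "?U \<subseteq> skorohod_space"
      by (auto simp: j1_nhd_def)
    fix y assume "y \<in> ?U"
    then obtain d where d: "0 < d" "d < e" "y \<in> j1_nhd d x"
      by auto
    define r where "r = min ((e - d) / 2) (1 / (1/d + d))"
    have r: "0 < r" "r \<le> 1 / (1/d + d)" "d + r < e"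
    proof -
      show "0 < r"
        using d by (simp add: r_def add_pos_pos)
      show "r \<le> 1 / (1/d + d)"
        by (simp add: r_def)
      have "r \<le> (e - d) / 2"
        unfolding r_def by (rule min.cobounded1)
      also have "\<dots> < e - d"
        using d(1,2) by simp
      finally show "d + r < e"
        by simp
    qed
    have "0 < 1/d + d"
      using d by (simp add: add_pos_pos)
    with r have "(1/d + d) * r \<le> 1"
      by (metis mult.commute pos_le_divide_eq)
    then have "1/d + d \<le> 1/r"
      using r(1) pos_le_divide_eq by blast
    then have "j1_nhd r y \<subseteq> j1_nhd (d + r) x"
      using j1_nhd_triangle[OF d(3) _ d(1) r(1)] by blast
    also have "\<dots> \<subseteq> ?U"
      using r d(1) by (intro UN_upper) simp
    finally show "\<exists>e>0. j1_nhd e y \<subseteq> ?U"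
      using r(1) by blast
  qed
  show "x \<in> ?U"
    using assms by (intro UN_I[of "e/2"] mem_j1_nhd_self) simp_all
  show "?U \<subseteq> j1_nhd e x"
    by (intro UN_least j1_nhd_mono) simp_all
qed

lemma limitin_j1_topology_nhd:
  "limitin j1_topology f x F \<longleftrightarrow>
     x \<in> skorohod_space \<and> (\<forall>e>0. \<forall>\<^sub>F i in F. f i \<in> j1_nhd e x)"
proof (intro iffI conjI allI impI)
  assume L: "limitin j1_topology f x F"
  then show x: "x \<in> skorohod_space"
    using limitin_topspace by fastforce
  fix e :: real assume "e > 0"
  then obtain U where "openin j1_topology U" "x \<in> U" "U \<subseteq> j1_nhd e x"
    using j1_nhd_contains_open[OF x] by blast
  then have "\<forall>\<^sub>F i in F. f i \<in> U"
    using L by (auto simp: limitin_def)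
  then show "\<forall>\<^sub>F i in F. f i \<in> j1_nhd e x"
    by eventually_elim (use \<open>U \<subseteq> _\<close> in auto)
next
  assume R: "x \<in> skorohod_space \<and> (\<forall>e>0. \<forall>\<^sub>F i in F. f i \<in> j1_nhd e x)"
  show "limitin j1_topology f x F"
    unfolding limitin_def
  proof (intro conjI allI impI)
    fix U assume "openin j1_topology U \<and> x \<in> U"
    then obtain e where e: "e > 0" "j1_nhd e x \<subseteq> U"
      by (auto simp: openin_j1_topology)
    with R have "\<forall>\<^sub>F i in F. f i \<in> j1_nhd e x"
      by blast
    then show "\<forall>\<^sub>F i in F. f i \<in> U"
      by eventually_elim (use e in auto)
  qed (use R in simp)
qed

lemma limitin_j1_topology:
  fixes f :: "nat \<Rightarrow> real \<Rightarrow> real"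
  assumes f: "\<And>n. f n \<in> skorohod_space" and x: "x \<in> skorohod_space"
  shows "limitin j1_topology f x sequentially \<longleftrightarrow>
    (\<exists>l. (\<forall>n. time_change (l n)) \<and>
       (\<forall>e>0. \<forall>\<^sub>F n in sequentially. \<forall>s\<ge>0. \<bar>l n s - s\<bar> \<le> e) \<and>
       (\<forall>a. \<forall>e>0. \<forall>\<^sub>F n in sequentially. \<forall>s\<in>{0..a}. \<bar>f n (l n s) - x s\<bar> \<le> e))"
    (is "_ \<longleftrightarrow> (\<exists>l. ?R l)")
proof
  assume "limitin j1_topology f x sequentially"
  then have L: "\<forall>\<^sub>F n in sequentially. f n \<in> j1_nhd e x" if "e > 0" for e
    using that by (simp add: limitin_j1_topology_nhd)
  define P where "P n k \<longleftrightarrow> k \<le> n \<and> f n \<in> j1_nhd (1 / real (Suc k)) x" for n k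
  define K where "K n = Max {k. P n k}" for n
  have fin: "finite {k. P n k}" for n
    by (rule finite_subset[of _ "{..n}"]) (auto simp: P_def)
  have PK: "P n (K n) \<and> k \<le> K n" if "P n k" for n k
    using Max_in[OF fin[of n]] Max_ge[OF fin[of n], of k] that by (auto simp: K_def)
  define Q where "Q n l \<longleftrightarrow> time_change l \<and> ((\<exists>k. P n k) \<longrightarrow>
     (\<forall>s\<ge>0. \<bar>l s - s\<bar> \<le> 1 / real (Suc (K n))) \<and>
     (\<forall>s\<in>{0..real (Suc (K n))}. \<bar>f n (l s) - x s\<bar> \<le> 1 / real (Suc (K n))))" for n l
  have "\<exists>l. Q n l" for n
  proof (cases "\<exists>k. P n k")
    case True
    then have "f n \<in> j1_nhd (1 / real (Suc (K n))) x"
      using PK by (auto simp: P_def)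
    then show ?thesis
      by (auto simp: j1_nhd_def Q_def)
  qed (use time_change_id in \<open>auto simp: Q_def\<close>)
  then obtain l where Q: "\<And>n. Q n (l n)"
    by metis
  have ev: "\<forall>\<^sub>F n in sequentially. (\<exists>j. P n j) \<and> k \<le> K n" for k
  proof -
    have "\<forall>\<^sub>F n in sequentially. f n \<in> j1_nhd (1 / real (Suc k)) x"
      by (rule L) simp
    then show ?thesis
      using eventually_ge_at_top[of k]
    proof eventually_elim
      case (elim n)
      then have "P n k"
        by (simp only: P_def)
      with PK show ?case
        by blast
    qed
  qed
  have small: "\<exists>k. 1 / real (Suc k) \<le> e \<and> a \<le> real (Suc k)" if "e > 0" for e a
  proof -
    obtain k where "max (1/e) a \<le> real k"
      using real_arch_simple by blast
    then show ?thesis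
      using that by (intro exI[of _ k]) (auto simp: field_simps)
  qed
  have "?R l"
  proof (intro conjI allI impI)
    show "time_change (l n)" for n
      using Q by (auto simp: Q_def)
    fix e :: real assume "e > 0"
    then obtain k where k: "1 / real (Suc k) \<le> e"
      using small by blast
    show "\<forall>\<^sub>F n in sequentially. \<forall>s\<ge>0. \<bar>l n s - s\<bar> \<le> e"
      using ev[of k]
    proof eventually_elim
      case (elim n)
      then have "1 / real (Suc (K n)) \<le> e"
        using k by (intro order_trans[OF _ k]) (auto simp: frac_le)
      then show ?case
        using Q[of n] elim unfolding Q_def by force
    qed
  next
    fix a e :: real assume "e > 0"
    then obtain k where k: "1 / real (Suc k) \<le> e" "a \<le> real (Suc k)"
      using small by blast
    show "\<forall>\<^sub>F n in sequentially. \<forall>s\<in>{0..a}. \<bar>f n (l n s) - x s\<bar> \<le> e"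
      using ev[of k]
    proof eventually_elim
      case (elim n)
      then have "1 / real (Suc (K n)) \<le> e" "a \<le> real (Suc (K n))"
        using k by (auto intro!: order_trans[OF _ k(1)] simp: frac_le)
      then show ?case
        using Q[of n] elim unfolding Q_def by force
    qed
  qed
  then show "\<exists>l. ?R l"
    by blast
next
  assume "\<exists>l. ?R l"
  then obtain l where l: "\<And>n. time_change (l n)"
      "\<And>e. e > 0 \<Longrightarrow> \<forall>\<^sub>F n in sequentially. \<forall>s\<ge>0. \<bar>l n s - s\<bar> \<le> e"
      "\<And>a e. e > 0 \<Longrightarrow> \<forall>\<^sub>F n in sequentially. \<forall>s\<in>{0..a}. \<bar>f n (l n s) - x s\<bar> \<le> e"
    by blast
  show "limitin j1_topology f x sequentially"
    unfolding limitin_j1_topology_nhd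
  proof (intro conjI allI impI x)
    fix e :: real assume "e > 0"
    from l(2)[OF this] l(3)[OF this, of "1/e"]
    show "\<forall>\<^sub>F n in sequentially. f n \<in> j1_nhd e x"
      by eventually_elim (use l(1) f in \<open>auto simp: j1_nhd_def\<close>)
  qed
qed

section \<open>Pure jump subordinators\<close>

definition subordinator_levy_measure :: "real measure \<Rightarrow> bool" where
  "subordinator_levy_measure \<nu> \<longleftrightarrow>
     sets \<nu> = sets borel \<and> emeasure \<nu> {..0} = 0 \<and> emeasure \<nu> {1<..} < \<infinity> \<and>
     (\<integral>\<^sup>+u\<in>{0<..1}. ennreal u \<partial>\<nu>) < \<infinity>"

definition laplace_exponent :: "real measure \<Rightarrow> real \<Rightarrow> real" where
  "laplace_exponent \<nu> u = (LINT x:{0<..}|\<nu>. 1 - exp (- u * x))"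

definition levy_process :: "'w measure \<Rightarrow> (real \<Rightarrow> 'w \<Rightarrow> real) \<Rightarrow> bool" where
  "levy_process M X \<longleftrightarrow>
     prob_space M \<and>
     (\<forall>t\<ge>0. X t \<in> borel_measurable M) \<and>
     (AE \<omega> in M. X 0 \<omega> = 0) \<and>
     (AE \<omega> in M. cadlag_on {0..} (\<lambda>t. X t \<omega>)) \<and>
     (\<forall>n t. 0 \<le> t 0 \<and> (\<forall>i<n. t i < t (Suc i)) \<longrightarrow>
        prob_space.indep_vars M (\<lambda>_. borel) (\<lambda>i \<omega>. X (t (Suc i)) \<omega> - X (t i) \<omega>) {..<n::nat}) \<and>
     (\<forall>s\<ge>0. \<forall>t\<ge>0. distr M borel (\<lambda>\<omega>. X (s + t) \<omega> - X s \<omega>) = distr M borel (X t))"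

definition pure_jump_subordinator ::
  "'w measure \<Rightarrow> (real \<Rightarrow> 'w \<Rightarrow> real) \<Rightarrow> real measure \<Rightarrow> bool" where
  "pure_jump_subordinator M X \<nu> \<longleftrightarrow>
     levy_process M X \<and>
     (AE \<omega> in M. mono_on {0..} (\<lambda>t. X t \<omega>)) \<and>
     subordinator_levy_measure \<nu> \<and>
     (\<forall>t\<ge>0. \<forall>u\<ge>0. (LINT \<omega>|M. exp (- u * X t \<omega>)) = exp (- t * laplace_exponent \<nu> u))"

section \<open>Conditions on the small-time behaviour\<close>

text \<open>
  Only used for \<open>x \<ge> 0\<close>. The extended value matters: \<open>X\<^sub>t = 0\<close> has positive
  probability when \<open>\<nu>\<close> is finite, and \<open>1 - F u\<close> in \<open>cond_S2\<close> may vanish, whereas \<open>ln 0 = 0\<close> in HOL.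
\<close>

definition neg_log :: "real \<Rightarrow> ereal" where
  "neg_log x = (if x = 0 then \<infinity> else ereal (- ln x))"

definition exponential_law :: "real \<Rightarrow> real measure" where
  "exponential_law \<gamma> = density lborel (\<lambda>x. ennreal (exponential_density \<gamma> x))"

text \<open>
  The law of a positive random variable that is not concentrated at one point. The random
  variable itself is taken to be the identity on the probability space \<open>\<mu>\<close>.
\<close>

definition positive_nondegenerate_law :: "real measure \<Rightarrow> bool" where
  "positive_nondegenerate_law \<mu> \<longleftrightarrow>
     real_distribution \<mu> \<and> (AE x in \<mu>. 0 < x) \<and> (\<forall>c. \<not> (AE x in \<mu>. x = c))"

definition scaled_neg_log_converges ::
  "'w measure \<Rightarrow> (real \<Rightarrow> 'w \<Rightarrow> real) \<Rightarrow> real measure \<Rightarrow> bool" where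
  "scaled_neg_log_converges M X \<mu> \<longleftrightarrow>
     converges_in_distribution euclidean (at_right 0) M (\<lambda>t \<omega>. ereal t * neg_log (X t \<omega>)) \<mu> ereal"

definition cond_S1 :: "'w measure \<Rightarrow> (real \<Rightarrow> 'w \<Rightarrow> real) \<Rightarrow> bool" where
  "cond_S1 M X \<longleftrightarrow> (\<exists>\<mu>. positive_nondegenerate_law \<mu> \<and> scaled_neg_log_converges M X \<mu>)"

definition cond_S2 :: "real measure \<Rightarrow> bool" where
  "cond_S2 \<nu> \<longleftrightarrow> (\<exists>\<mu>. positive_nondegenerate_law \<mu> \<and>
     (let F = cdf (distr \<mu> borel exp) in
        \<forall>u>0. isCont F u \<longrightarrow>
          ((\<lambda>t. ereal (t * laplace_exponent \<nu> (u powr (1 / t)))) \<longlongrightarrow> neg_log (1 - F u)) (at_right 0)))"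

definition cond_S3_S4 :: "'w measure \<Rightarrow> (real \<Rightarrow> 'w \<Rightarrow> real) \<Rightarrow> real \<Rightarrow> bool" where
  "cond_S3_S4 M X \<gamma> \<longleftrightarrow> scaled_neg_log_converges M X (exponential_law \<gamma>)"

definition cond_S5 :: "real measure \<Rightarrow> real \<Rightarrow> bool" where
  "cond_S5 \<nu> \<gamma> \<longleftrightarrow> ((\<lambda>s. laplace_exponent \<nu> s / ln s) \<longlongrightarrow> \<gamma>) at_top"

definition cond_S6 :: "'w measure \<Rightarrow> (real \<Rightarrow> 'w \<Rightarrow> real) \<Rightarrow> real \<Rightarrow> bool" where
  "cond_S6 M X \<gamma> \<longleftrightarrow> ((\<lambda>x. ln (cdf (distr M borel (X 1)) x) / ln x) \<longlongrightarrow> \<gamma>) (at_right 0)"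

definition cond_S7 :: "real measure \<Rightarrow> real \<Rightarrow> bool" where
  "cond_S7 \<nu> \<gamma> \<longleftrightarrow> ((\<lambda>x. measure \<nu> {x<..} / ln x) \<longlongrightarrow> - \<gamma>) (at_right 0)"

section \<open>The extremal process\<close>

text \<open>
  On each compact subinterval of \<open>(0,\<infinity>)\<close> the function has only finitely many jump times,
  the jumps happening at the left end points of the intervals of constancy.
\<close>

definition piecewise_constant :: "(real \<Rightarrow> real) \<Rightarrow> bool" where
  "piecewise_constant x \<longleftrightarrow>
     (\<forall>a b. 0 < a \<and> a < b \<longrightarrow>
        (\<exists>J. finite J \<and> (\<forall>s\<in>{a..b}. \<forall>t\<in>{a..b}. s \<le> t \<and> {s<..t} \<inter> J = {} \<longrightarrow> x s = x t)))"

definition extremal_process :: "real \<Rightarrow> 'v measure \<Rightarrow> (real \<Rightarrow> 'v \<Rightarrow> real) \<Rightarrow> bool" where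
  "extremal_process \<gamma> N \<eta> \<longleftrightarrow>
     prob_space N \<and>
     (\<forall>s>0. \<eta> s \<in> borel_measurable N) \<and>
     (AE \<omega> in N. antimono_on {0<..} (\<lambda>s. \<eta> s \<omega>) \<and> piecewise_constant (\<lambda>s. \<eta> s \<omega>) \<and>
        cadlag_on {0<..} (\<lambda>s. \<eta> s \<omega>)) \<and>
     (\<forall>n s. s 0 = 0 \<and> (\<forall>i<n. s i < s (Suc i)) \<longrightarrow>
        distr N (PiM {1..n::nat} (\<lambda>_. borel)) (\<lambda>\<omega>. \<lambda>k\<in>{1..n}. \<eta> (s k) \<omega>) =
        distr (PiM {1..n} (\<lambda>_. exponential_law 1)) (PiM {1..n} (\<lambda>_. borel))
          (\<lambda>Z. \<lambda>k\<in>{1..n}. 1 / \<gamma> * Min ((\<lambda>i. Z i / (s i - s (i - 1))) ` {1..k})))"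

section \<open>The two path-valued maps\<close>

definition truncated_path :: "real \<Rightarrow> (real \<Rightarrow> 'w \<Rightarrow> real) \<Rightarrow> real \<Rightarrow> 'w \<Rightarrow> real \<Rightarrow> real" where
  "truncated_path z X t \<omega> =
     (\<lambda>s\<in>{0..}. real_of_ereal (min (ereal z) (ereal t * neg_log (X (t * s) \<omega>))))"

definition truncated_extremal_path :: "real \<Rightarrow> (real \<Rightarrow> 'v \<Rightarrow> real) \<Rightarrow> 'v \<Rightarrow> real \<Rightarrow> real" where
  "truncated_extremal_path z \<eta> \<omega> = (\<lambda>s\<in>{0..}. if s = 0 then z else min z (\<eta> s \<omega>))"

end

theory Submission
  imports Defs
begin

text \<open>
  Let \<open>\<phi>\<close> be the Laplace exponent. Markov-type bounds place \<open>E exp (- e\<^sup>v\<^sup>/\<^sup>t X\<^sub>t) = exp (- t \<phi> (e\<^sup>v\<^sup>/\<^sup>t))\<close>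
  between \<open>P (X\<^sub>t \<le> e\<^sup>-\<^sup>w\<^sup>/\<^sup>t)\<close> for \<open>w\<close> slightly above and slightly below \<open>v\<close>, up to errors that vanish
  as \<open>t \<down> 0\<close>. A limit in distribution of \<open>- t log X\<^sub>t\<close> is thus the same as a limit \<open>H v\<close> of
  \<open>exp (- t \<phi> (e\<^sup>v\<^sup>/\<^sup>t)) = q (v / t) ^ v\<close>, where \<open>q r = exp (- \<phi> (e\<^sup>r) / r)\<close>. Hence \<open>q\<close> converges at infinity,
  \<open>H v\<close> is the \<open>v\<close>-th power of a constant, and \<open>\<phi> s / log s\<close> tends to some \<open>\<gamma>\<close>; every one of the
  conditions leads to this.

  For the paths, discretise time with mesh \<open>h\<close>. On the scale \<open>- t log\<close> the sum of the i.i.d. increments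
  of \<open>X\<close> becomes a minimum of variables that are asymptotically exponential, which gives the weak
  convergence of the discretised paths. A monotone path is \<open>J\<^sub>1\<close>-close to its discretisation unless
  some cell contains two separate big drops. For the subordinator a drop needs a jump above
  \<open>e\<^sup>-\<^sup>2\<^sup>z\<^sup>/\<^sup>t\<close>, and by independence at the first passage two of them occur in one cell with probability
  at most the square of \<open>P (X\<^sub>t\<^sub>h > e\<^sup>-\<^sup>2\<^sup>z\<^sup>/\<^sup>t) = O(h)\<close>, which is negligible when summed over the cells.
\<close>

section \<open>Piecewise linear time changes\<close>

text \<open>The \<open>J1\<close> topology comes as a system of neighbourhoods without a metric. Two
  facts stand in for one: membership in \<open>j1_nhd\<close> can be reversed and chained at the
  cost of a smaller radius, because the comparison window \<open>1 / e\<close> must absorb the shift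
  of the time change; and around each point a single radius works for a whole open set.
  Measurability of limits of path-valued maps, and near-constancy of a continuous function around
  most paths, both rest on these.

  The limits in the mesh and in \<open>t\<close> have to be exchanged. For a fixed mesh a coupling
  makes the discretised paths converge pointwise, which takes the place of a tightness criterion;
  only laws matter there, so each mesh may have its own probability space. What remains is a bound,
  for small \<open>t\<close>, on the probability that a path is far from its discretisation. The
  square in the two-jump estimate is decisive: one big jump in a cell has probability of order
  \<open>h\<close>, and over \<open>K\<close> cells this adds up to \<open>K * h\<close>, the length
  of the growing horizon.\<close>

definition pl_change :: "real \<Rightarrow> real \<Rightarrow> real \<Rightarrow> real \<Rightarrow> real" where
  "pl_change p u v s = min s p + (v / u) * max 0 (min (s - p) u) + max 0 (s - p - u)"

lemma pl_change_cases:
  assumes "0 < u" "0 < v"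
  shows "s \<le> p \<Longrightarrow> pl_change p u v s = s"
    and "p \<le> s \<Longrightarrow> s \<le> p + u \<Longrightarrow> pl_change p u v s = p + (s - p) * (v / u)"
    and "p + u \<le> s \<Longrightarrow> pl_change p u v s = s + v - u"
  using assms by (auto simp: pl_change_def min_def max_def field_simps)

text \<open>An inverse of the same shape gives surjectivity onto \<open>{0..}\<close> and upgrades
  the evident weak monotonicity to a strict one.\<close>

lemma pl_change_inverse:
  assumes "0 < u" "0 < v"
  shows "pl_change p v u (pl_change p u v s) = s"
proof -
  consider "s \<le> p" | "p \<le> s" "s \<le> p + u" | "p + u \<le> s" by linarith
  then show ?thesis
  proof cases
    case 1 then show ?thesis using assms by (simp add: pl_change_cases)
  next
    case 2
    have e: "pl_change p u v s = p + (s - p) * (v / u)" using pl_change_cases(2)[OF assms] 2 by simp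
    have "(s - p) * v \<le> u * v"
      using 2 assms by (intro mult_right_mono) simp_all
    then have "(s - p) * (v / u) \<le> v"
      using assms by (simp add: divide_le_eq mult.commute)
    moreover have "0 \<le> (s - p) * (v / u)" using 2 assms by simp
    ultimately have "pl_change p v u (p + (s - p) * (v / u)) = p + (p + (s - p) * (v / u) - p) * (u / v)"
      by (intro pl_change_cases(2)) (use assms in simp_all)
    also have "\<dots> = s" using assms by simp
    finally show ?thesis by (simp only: e)
  next
    case 3
    have e: "pl_change p u v s = s + v - u" using pl_change_cases(3)[OF assms] 3 by simp
    have "pl_change p v u (s + v - u) = (s + v - u) + u - v"
      by (intro pl_change_cases(3)) (use assms 3 in simp_all)
    then show ?thesis by (simp add: e)
  qed
qed

lemma time_change_pl_change:
  assumes "0 \<le> p" "0 < u" "0 < v"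
  shows "time_change (pl_change p u v)"
proof -
  have mono: "pl_change p u v s \<le> pl_change p u v t" if "0 < u" "0 < v" "s \<le> t" for s t u v
    unfolding pl_change_def using that
    by (intro add_mono mult_left_mono max.mono min.mono) auto
  have nn: "0 \<le> pl_change p u v s" if "0 < u" "0 < v" "0 \<le> s" for s u v
    using mono[of u v 0 s] that assms(1) pl_change_cases(1)[of u v 0 p] by simp
  have "strict_mono_on {0..} (pl_change p u v)"
  proof (rule strict_mono_onI)
    fix s t :: real assume "s < t"
    then have "pl_change p u v s \<noteq> pl_change p u v t"
      using pl_change_inverse[OF assms(2,3), of p] by (metis less_irrefl)
    with mono[of u v s t] \<open>s < t\<close> assms show "pl_change p u v s < pl_change p u v t" by simp
  qed
  moreover have "pl_change p u v ` {0..} = {0..}"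
  proof (intro equalityI subsetI)
    fix s :: real assume "s \<in> {0..}"
    then show "s \<in> pl_change p u v ` {0..}"
      using pl_change_inverse[OF assms(3,2), of p s] nn[of v u s] assms
      by (intro image_eqI[of _ _ "pl_change p v u s"]) auto
  qed (use nn assms in auto)
  moreover have "continuous_on {0..} (pl_change p u v)"
    unfolding pl_change_def[abs_def] by (intro continuous_intros)
  ultimately show ?thesis by (simp add: time_change_def)
qed

lemma time_change_less: "time_change l \<Longrightarrow> 0 \<le> s \<Longrightarrow> s < t \<Longrightarrow> l s < l t"
  by (auto simp: time_change_def strict_mono_on_def)

lemma time_change_le: "time_change l \<Longrightarrow> 0 \<le> s \<Longrightarrow> s \<le> t \<Longrightarrow> l s \<le> l t"
  using time_change_less[of l s t] by (cases "s = t") auto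

text \<open>Induction over the knots: each step composes with one \<open>pl_change\<close> that
  starts at \<open>b K\<close> and so leaves the earlier knots alone. The last conjunct, that the
  map is a translation beyond the last knot, is what makes the next stretch linear.\<close>

lemma time_change_through_knots:
  fixes a b :: "nat \<Rightarrow> real"
  assumes "a 0 = 0" "b 0 = 0" "\<And>i. i < K \<Longrightarrow> a i < a (Suc i)" "\<And>i. i < K \<Longrightarrow> b i < b (Suc i)"
    and "\<And>i. i \<le> K \<Longrightarrow> \<bar>b i - a i\<bar> \<le> h"
  shows "\<exists>l. time_change l \<and> (\<forall>i\<le>K. l (a i) = b i) \<and> (\<forall>s\<ge>0. \<bar>l s - s\<bar> \<le> h) \<and>
    (\<forall>s\<ge>a K. l s = s + b K - a K)"
  using assms
proof (induction K)
  case 0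
  then show ?case using time_change_id by (intro exI[of _ "\<lambda>s. s"]) auto
next
  case (Suc K)
  have le: "c i \<le> c j" if "\<And>i. i < K \<Longrightarrow> c i < c (Suc i)" "i \<le> j" "j \<le> K" for c :: "nat \<Rightarrow> real" and i j
    using that(2,3)
  proof (induction j rule: dec_induct)
    case (step n)
    then show ?case using that(1)[of n] by simp
  qed simp
  have lea: "a i \<le> a j" if "i \<le> j" "j \<le> K" for i j by (rule le) (use that Suc.prems in auto)
  have leb: "b i \<le> b j" if "i \<le> j" "j \<le> K" for i j by (rule le) (use that Suc.prems in auto)
  obtain l where l: "time_change l" "\<And>i. i \<le> K \<Longrightarrow> l (a i) = b i" "\<And>s. s \<ge> 0 \<Longrightarrow> \<bar>l s - s\<bar> \<le> h"
    "\<And>s. s \<ge> a K \<Longrightarrow> l s = s + b K - a K"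
    using Suc.IH Suc.prems by force
  define u v where uv: "u = a (Suc K) - a K" "v = b (Suc K) - b K"
  have uv0: "0 < u" "0 < v" using Suc.prems by (auto simp: uv)
  have a0: "0 \<le> a K" "0 \<le> b K" using lea[of 0 K] leb[of 0 K] Suc.prems(1,2) by auto
  let ?l = "\<lambda>s. pl_change (b K) u v (l s)"
  have tc: "time_change ?l"
    by (rule time_change_comp[OF l(1) time_change_pl_change]) (use a0 uv0 in auto)
  have low: "?l s = l s" if "0 \<le> s" "s \<le> a K" for s
    using time_change_le[OF l(1) that] l(2)[of K] uv0 by (simp add: pl_change_cases)
  have mid: "?l s = b K + (s - a K) * (v / u)" if "a K \<le> s" "s \<le> a (Suc K)" for s
    using that l(4)[of s] uv0 pl_change_cases(2)[OF uv0, of "b K" "l s"] by (simp add: uv)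
  have high: "?l s = s + b (Suc K) - a (Suc K)" if "a (Suc K) \<le> s" for s
    using that l(4)[of s] uv0 pl_change_cases(3)[OF uv0, of "b K" "l s"] by (simp add: uv)
  have "?l (a i) = b i" if "i \<le> Suc K" for i
  proof (cases "i = Suc K")
    case False
    then have "i \<le> K" using that by simp
    then show ?thesis using low[of "a i"] lea[of 0 i] lea[of i K] l(2) Suc.prems(1) by simp
  qed (use high in simp)
  moreover have "\<bar>?l s - s\<bar> \<le> h" if "s \<ge> 0" for s
  proof -
    consider "s \<le> a K" | "a K \<le> s" "s \<le> a (Suc K)" | "a (Suc K) \<le> s" by linarith
    then show ?thesis
    proof cases
      case 1 then show ?thesis using low l(3) that by simp
    next
      case 2
      \<comment> \<open>Between two knots the displacement is a convex combination, with weight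
        \<open>r\<close>, of the displacements at these knots.\<close>
      define r where "r = (s - a K) / u"
      have r: "0 \<le> r" "r \<le> 1" using 2 uv0 by (auto simp: r_def uv field_simps)
      have s: "s = a K + r * u" using uv0 by (simp add: r_def)
      have "?l s - s = (1 - r) * (b K - a K) + r * (b (Suc K) - a (Suc K))"
        unfolding mid[OF 2] using uv0 by (simp add: s) (simp add: uv algebra_simps)
      also have "\<bar>\<dots>\<bar> \<le> (1 - r) * \<bar>b K - a K\<bar> + r * \<bar>b (Suc K) - a (Suc K)\<bar>"
        using r by (intro order_trans[OF abs_triangle_ineq]) (simp add: abs_mult)
      also have "\<dots> \<le> (1 - r) * h + r * h"
        using r Suc.prems(5) by (intro add_mono mult_left_mono) auto
      finally show ?thesis by (simp add: algebra_simps)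
    next
      case 3 then show ?thesis using high Suc.prems(5)[of "Suc K"] by simp
    qed
  qed
  ultimately show ?case using tc high by blast
qed

lemma time_change_inverse:
  assumes l: "time_change l"
  shows "\<exists>m. time_change m \<and> (\<forall>s\<ge>0. l (m s) = s)"
proof -
  have inj: "inj_on l {0..}"
    using l by (auto simp: time_change_def intro: strict_mono_on_imp_inj_on)
  have im: "l ` {0..} = {0..}" using l by (simp add: time_change_def)
  \<comment> \<open>The identity on negative arguments makes \<open>m\<close> a strictly increasing
    surjection of the whole line, and such a map is continuous.\<close>
  define m where "m s = (if 0 \<le> s then inv_into {0..} l s else s)" for s
  have lm: "l (m s) = s" "0 \<le> m s" if "0 \<le> s" for s
    using that im f_inv_into_f[of s l "{0..}"] inv_into_into[of s l "{0..}"] by (auto simp: m_def)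
  have ml: "m (l s) = s" if "0 \<le> s" for s
    using that inv_into_f_f[OF inj, of s] time_change_nonneg[OF l that] by (simp add: m_def)
  have less: "m s < m t" if "s < t" for s t
  proof (cases "0 \<le> s")
    case True
    then show ?thesis
      using lm[of s] lm[of t] that time_change_le[OF l, of "m t" "m s"] by force
  next
    case False
    then show ?thesis using lm(2)[of t] that by (cases "0 \<le> t") (auto simp: m_def)
  qed
  have surj: "range m = UNIV"
  proof (intro equalityI subsetI)
    fix s :: real
    show "s \<in> range m"
    proof (cases "0 \<le> s")
      case True then show ?thesis using ml by (metis rangeI)
    qed (auto simp: m_def image_iff intro!: exI[of _ s])
  qed simp
  have "continuous_on UNIV m"
    by (rule continuous_onI_mono) (use surj less in \<open>auto simp: le_less\<close>)
  then have "continuous_on {0..} m" by (rule continuous_on_subset) simp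
  moreover have "m ` {0..} = {0..}"
  proof (intro equalityI subsetI)
    fix s :: real assume "s \<in> {0..}"
    then show "s \<in> m ` {0..}"
      using ml[of s] time_change_nonneg[OF l, of s] by (intro image_eqI[of _ m "l s"]) simp_all
  qed (use lm in auto)
  ultimately have "time_change m"
    using less by (auto simp: time_change_def strict_mono_on_def)
  then show ?thesis using lm by blast
qed

section \<open>Discretisation of monotone paths\<close>

text \<open>Capping the index at \<open>K\<close> freezes the path from time \<open>K * h\<close>
  on, so that it is determined by finitely many values.\<close>

definition grid_path :: "real \<Rightarrow> nat \<Rightarrow> (nat \<Rightarrow> real) \<Rightarrow> real \<Rightarrow> real" where
  "grid_path h K v = (\<lambda>s\<in>{0..}. v (min K (nat \<lfloor>s / h\<rfloor>)))"

lemma grid_path_eq: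
  assumes "0 < h" "k \<le> K" "0 \<le> s" "real k * h \<le> s" "k < K \<Longrightarrow> s < real (Suc k) * h"
  shows "grid_path h K v s = v k"
proof -
  have f: "\<lfloor>real k\<rfloor> \<le> \<lfloor>s / h\<rfloor>" using assms by (intro floor_mono) (simp add: field_simps)
  then have ge: "int k \<le> \<lfloor>s / h\<rfloor>" by simp
  show ?thesis
  proof (cases "k < K")
    case True
    then have "s / h < real_of_int (int k + 1)" using assms by (simp add: field_simps)
    then have "\<lfloor>s / h\<rfloor> = int k" using ge by linarith
    then show ?thesis using assms by (simp add: grid_path_def)
  next
    case False
    then have "min K (nat \<lfloor>s / h\<rfloor>) = k" using ge assms(2) by (simp add: min_def le_nat_iff) 
    then show ?thesis using assms by (simp add: grid_path_def)
  qed
qed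

lemma skorohod_grid_path:
  assumes "0 < h"
  shows "grid_path h K v \<in> skorohod_space"
proof -
  have "continuous (at t within {0..} \<inter> {t..}) (grid_path h K v)" if "0 \<le> t" for t
  proof -
    define n where "n = \<lfloor>t / h\<rfloor>"
    have n: "real_of_int n * h \<le> t" "t < (real_of_int n + 1) * h"
      using assms by (auto simp: n_def floor_divide_lower floor_divide_upper)
    have "\<forall>\<^sub>F s in at t within {0..} \<inter> {t..}. s < (real_of_int n + 1) * h"
      using n(2) by (intro order_tendstoD(2)[OF tendsto_ident_at])
    moreover have "\<forall>\<^sub>F s in at t within {0..} \<inter> {t..}. s \<in> {0..} \<inter> {t..}"
      by (simp add: eventually_at_filter)
    ultimately have "\<forall>\<^sub>F s in at t within {0..} \<inter> {t..}. grid_path h K v s = grid_path h K v t"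
    proof eventually_elim
      case (elim s)
      have "t / h \<le> s / h" using elim assms by (simp add: divide_right_mono)
      then have "n \<le> \<lfloor>s / h\<rfloor>" unfolding n_def by (rule floor_mono)
      moreover have "s / h < real_of_int n + 1" using elim assms by (simp add: divide_less_eq)
      ultimately have "\<lfloor>s / h\<rfloor> = n" by linarith
      then show ?case using elim that by (simp add: grid_path_def n_def)
    qed
    then show ?thesis unfolding continuous_within by (rule tendsto_eventually)
  qed
  moreover have "\<exists>l. (grid_path h K v \<longlongrightarrow> l) (at t within {0..} \<inter> {..<t})" if "0 \<le> t" for t
  proof -
    \<comment> \<open>For a left limit the relevant cell starts strictly before \<open>t\<close>,
      hence the ceiling minus one; at \<open>t = 0\<close> the filter is trivial.\<close>
    define n where "n = \<lceil>t / h\<rceil> - 1"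
    have n: "real_of_int n * h < t" "t \<le> (real_of_int n + 1) * h"
      using assms ceiling_correct[of "t / h"] by (simp_all add: n_def pos_less_divide_eq flip: pos_divide_le_eq)
    have "\<forall>\<^sub>F s in at t within {0..} \<inter> {..<t}. real_of_int n * h < s"
      using n(1) by (intro order_tendstoD(1)[OF tendsto_ident_at])
    moreover have "\<forall>\<^sub>F s in at t within {0..} \<inter> {..<t}. s \<in> {0..} \<inter> {..<t}"
      by (simp add: eventually_at_filter)
    ultimately have "\<forall>\<^sub>F s in at t within {0..} \<inter> {..<t}. grid_path h K v s = v (min K (nat n))"
    proof eventually_elim
      case (elim s)
      have "s < (real_of_int n + 1) * h" using elim n by simp
      then have "s / h < real_of_int n + 1" "real_of_int n < s / h" using elim assms by (auto simp: divide_less_eq less_divide_eq)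
      then have "\<lfloor>s / h\<rfloor> = n" by linarith
      then show ?case using elim by (simp add: grid_path_def)
    qed
    then show ?thesis by (blast intro: tendsto_eventually)
  qed
  ultimately show ?thesis unfolding skorohod_space_def cadlag_on_def by (simp add: grid_path_def)
qed

section \<open>Big drops inside a cell and closeness of a monotone path to its
  discretisation\<close>

lemma cadlag_on_right_limit:
  assumes "cadlag_on {0..} y" "0 \<le> t"
  shows "(y \<longlongrightarrow> y t) (at_right t)"
proof (rule tendsto_within_subset)
  show "(y \<longlongrightarrow> y t) (at t within {0..} \<inter> {t..})"
    using assms unfolding cadlag_on_def continuous_within by simp
qed (use assms(2) in auto)

text \<open>The split point is the infimum of the times at which more than \<open>e\<close> has been
  lost, or \<open>b\<close> if there is none. Right-continuity puts this infimum itself on the late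
  side and keeps it away from \<open>a\<close>.\<close>

lemma single_drop_split:
  fixes y :: "real \<Rightarrow> real"
  assumes "a < b" "0 < e" and anti: "antimono_on {a..b} y"
    and right: "\<And>t. a \<le> t \<Longrightarrow> t < b \<Longrightarrow> (y \<longlongrightarrow> y t) (at_right t)"
    and drop: "\<And>s. s \<in> {a..b} \<Longrightarrow> y a - y s \<le> e \<or> y s - y b \<le> e"
  shows "\<exists>\<tau>. a < \<tau> \<and> \<tau> \<le> b \<and> (\<forall>s\<in>{a..<\<tau>}. y a - y s \<le> e) \<and> (\<forall>s\<in>{\<tau>..b}. y s - y b \<le> e)"
proof -
  define S where "S = {s\<in>{a..b}. y a - y s > e}"
  have dec: "y t \<le> y s" if "a \<le> s" "s \<le> t" "t \<le> b" for s t
    using monotone_onD[OF anti, of s t] that by auto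
  have ev: "\<forall>\<^sub>F s in at_right t. t < s \<and> s < b" if "t < b" for t
    using eventually_at_right_real[OF that] by eventually_elim auto
  show ?thesis
  proof (cases "S = {}")
    case True
    then have "\<forall>s\<in>{a..<b}. y a - y s \<le> e" by (auto simp: S_def not_less)
    then show ?thesis using assms(1,2) by (intro exI[of _ b]) auto
  next
    case False
    define \<tau> where "\<tau> = Inf S"
    have bdd: "bdd_below S" by (rule bdd_belowI[of _ a]) (auto simp: S_def)
    have t: "a \<le> \<tau>" "\<tau> \<le> b"
      using False cInf_lower[OF _ bdd] unfolding \<tau>_def
      by (auto intro!: cInf_greatest simp: S_def) (force simp: S_def)
    have after: "\<exists>s'\<in>S. s' < s" if "\<tau> < s" for s
      using that False bdd by (simp add: \<tau>_def cInf_less_iff)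
    have S2: "y s - y b \<le> e" if "\<tau> < s" "s \<le> b" for s
    proof -
      obtain s' where s': "s' \<in> S" "s' < s" using after[OF \<open>\<tau> < s\<close>] by blast
      then have "y s \<le> y s'" using dec[of s' s] that by (auto simp: S_def)
      moreover have "y s' - y b \<le> e" using drop[of s'] s' by (auto simp: S_def)
      ultimately show ?thesis by simp
    qed
    have S1: "y a - y s > e" if "\<tau> < s" "s \<le> b" for s
    proof -
      obtain s' where s': "s' \<in> S" "s' < s" using after[OF \<open>\<tau> < s\<close>] by blast
      then have "y s \<le> y s'" using dec[of s' s] that by (auto simp: S_def)
      then show ?thesis using s' by (auto simp: S_def)
    qed
    have "y \<tau> - y b \<le> e"
    proof (cases "\<tau> = b")
      case False
      then have "\<tau> < b" using t by simp
      have "\<forall>\<^sub>F s in at_right \<tau>. y s - y b \<le> e"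
        using ev[OF \<open>\<tau> < b\<close>] by eventually_elim (use S2 in auto)
      from tendsto_upperbound[OF tendsto_diff[OF right[OF t(1) \<open>\<tau> < b\<close>] tendsto_const] this] show ?thesis
        by simp
    qed (use assms in simp)
    moreover have "a \<noteq> \<tau>"
    proof
      assume a: "a = \<tau>"
      have "\<forall>\<^sub>F s in at_right a. e \<le> y a - y s"
        using ev[OF \<open>a < b\<close>] by eventually_elim (use S1 a in force)
      from tendsto_lowerbound[OF tendsto_diff[OF tendsto_const right[OF order_refl \<open>a < b\<close>]] this]
      show False using \<open>0 < e\<close> by simp
    qed
    moreover have "y a - y s \<le> e" if "s \<in> {a..<\<tau>}" for s
    proof -
      have "s \<notin> S" using cInf_lower[OF _ bdd, of s] that by (auto simp: \<tau>_def)
      then show ?thesis using that t by (auto simp: S_def)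
    qed
    moreover have "y s - y b \<le> e" if "s \<in> {\<tau>..b}" for s
      using S2[of s] \<open>y \<tau> - y b \<le> e\<close> that by (cases "s = \<tau>") auto
    ultimately show ?thesis using t by (intro exI[of _ \<tau>]) auto
  qed
qed

text \<open>The time change moves the one big drop of each cell to the right end of the cell, where
  the grid path jumps. This displaces no point by more than \<open>h\<close>, and between
  consecutive drop times \<open>y\<close> stays within \<open>d\<close> of its value at the grid
  point between them.\<close>

lemma grid_path_in_j1_nhd:
  fixes y :: "real \<Rightarrow> real"
  assumes "0 < h" "0 < d" "d \<le> e" "h \<le> e" "1 / e \<le> real K * h" "K \<le> L"
    and cadlag: "cadlag_on {0..} y" and anti: "antimono_on {0..} y"
    and drop: "\<And>k s. k < K \<Longrightarrow> s \<in> {real k * h..real (Suc k) * h} \<Longrightarrow>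
      y (real k * h) - y s \<le> d \<or> y s - y (real (Suc k) * h) \<le> d"
  shows "grid_path h L (\<lambda>k. y (real k * h)) \<in> j1_nhd e y"
proof -
  have dec: "y t \<le> y s" if "0 \<le> s" "s \<le> t" for s t
    using monotone_onD[OF anti, of s t] that by auto
  have "\<exists>\<tau>. real k * h < \<tau> \<and> \<tau> \<le> real (Suc k) * h \<and> (\<forall>s\<in>{real k * h..<\<tau>}. y (real k * h) - y s \<le> d) \<and>
      (\<forall>s\<in>{\<tau>..real (Suc k) * h}. y s - y (real (Suc k) * h) \<le> d)" if "k < K" for k
  proof (rule single_drop_split)
    have "0 \<le> real k * h" using \<open>0 < h\<close> by simp
    then show "antimono_on {real k * h..real (Suc k) * h} y"
      by (intro monotone_on_subset[OF anti]) auto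
    show "(y \<longlongrightarrow> y t) (at_right t)" if "real k * h \<le> t" for t
      using that \<open>0 \<le> real k * h\<close> by (intro cadlag_on_right_limit[OF cadlag]) simp
  qed (use assms that in \<open>auto simp: algebra_simps\<close>)
  then obtain \<tau> where \<tau>: "\<And>k. k < K \<Longrightarrow> real k * h < \<tau> k" "\<And>k. k < K \<Longrightarrow> \<tau> k \<le> real (Suc k) * h"
    "\<And>k s. k < K \<Longrightarrow> s \<in> {real k * h..<\<tau> k} \<Longrightarrow> y (real k * h) - y s \<le> d"
    "\<And>k s. k < K \<Longrightarrow> s \<in> {\<tau> k..real (Suc k) * h} \<Longrightarrow> y s - y (real (Suc k) * h) \<le> d"
    by metis
  \<comment> \<open>Shifted by one: \<open>a (Suc k)\<close> is the drop time in cell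
    \<open>k\<close>, to be sent to the right end \<open>real (Suc k) * h\<close> of that
    cell.\<close>
  define a where "a i = (case i of 0 \<Rightarrow> 0 | Suc j \<Rightarrow> \<tau> j)" for i
  have a_less: "a i < a (Suc i)" if "i < K" for i
    using that \<tau>(1)[of i] \<tau>(2)[of "i - 1"] by (cases i) (auto simp: a_def)
  have a_bound: "a i \<le> real i * h \<and> real i * h - h \<le> a i" if "i \<le> K" for i
    using that \<tau>(1)[of "i - 1"] \<tau>(2)[of "i - 1"] \<open>0 < h\<close> by (cases i) (auto simp: a_def algebra_simps less_imp_le)
  have "\<exists>l. time_change l \<and> (\<forall>i\<le>K. l (a i) = real i * h) \<and> (\<forall>s\<ge>0. \<bar>l s - s\<bar> \<le> h) \<and>
      (\<forall>s\<ge>a K. l s = s + real K * h - a K)"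
    by (rule time_change_through_knots[where b = "\<lambda>i. real i * h"]) (use a_less a_bound \<open>0 < h\<close> in \<open>force simp: a_def\<close>)+
  then obtain l where l: "time_change l" "\<And>i. i \<le> K \<Longrightarrow> l (a i) = real i * h" "\<And>s. s \<ge> 0 \<Longrightarrow> \<bar>l s - s\<bar> \<le> h"
    "\<And>s. s \<ge> a K \<Longrightarrow> l s = s + real K * h - a K"
    by blast
  have "\<bar>grid_path h L (\<lambda>k. y (real k * h)) (l s) - y s\<bar> \<le> d" if s: "0 \<le> s" "s \<le> real K * h" for s
  proof -
    define k where "k = (GREATEST k. k \<le> K \<and> a k \<le> s)"
    have k: "k \<le> K \<and> a k \<le> s" unfolding k_def
      by (rule GreatestI_nat[of _ 0 K]) (use s in \<open>auto simp: a_def\<close>)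
    have k': "s < a (Suc k)" if "k < K"
    proof (rule ccontr)
      assume "\<not> s < a (Suc k)"
      then have "Suc k \<le> k" unfolding k_def
        by (intro Greatest_le_nat[of _ _ K]) (use that in \<open>auto simp: k_def\<close>)
      then show False by simp
    qed
    have ak: "0 \<le> a k"
    proof (cases k)
      case (Suc j)
      then have "real j * h < a k" "0 \<le> real j * h" using \<tau>(1)[of j] k \<open>0 < h\<close> by (auto simp: a_def)
      then show ?thesis by linarith
    qed (simp add: a_def)
    have kh: "0 \<le> real k * h" using \<open>0 < h\<close> by simp
    have "grid_path h L (\<lambda>k. y (real k * h)) (l s) = y (real k * h)"
    proof (rule grid_path_eq)
      show "real k * h \<le> l s" using time_change_le[OF l(1) ak] k l(2)[of k] by auto
      show "l s < real (Suc k) * h"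
      proof (cases "k < K")
        case True
        then show ?thesis
          using time_change_less[OF l(1) \<open>0 \<le> s\<close> k'[OF True]] l(2)[of "Suc k"] by simp
      next
        case False
        then have "k = K" using k by simp
        \<comment> \<open>Beyond \<open>a K\<close> the time change is a translation, and
          \<open>s \<le> real K * h\<close> lies less than \<open>h\<close> beyond
          \<open>a K\<close>, so \<open>l s\<close> stays inside cell \<open>K\<close>.\<close>
        have "real K * h - h < a K"
        proof (cases K)
          case (Suc j)
          then show ?thesis using \<tau>(1)[of j] by (simp add: a_def algebra_simps)
        qed (use \<open>0 < h\<close> in \<open>simp add: a_def\<close>)
        then show ?thesis using l(4)[of s] k s \<open>k = K\<close> by (simp add: algebra_simps)
      qed
    qed (use k l(1) s time_change_nonneg \<open>0 < h\<close> \<open>K \<le> L\<close> in auto)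
    moreover have "\<bar>y (real k * h) - y s\<bar> \<le> d"
    proof (cases "s < real k * h")
      case True
      then obtain j where j: "k = Suc j" by (cases k) (use s in auto)
      then have "y s - y (real k * h) \<le> d" using \<tau>(4)[of j s] k True by (auto simp: a_def)
      then show ?thesis using dec[of s "real k * h"] s True by simp
    next
      case False
      have "y (real k * h) - y s \<le> d"
      proof (cases "k < K")
        case True then show ?thesis using \<tau>(3)[of k s] k' False by (auto simp: a_def)
      next
        case False
        then have "k = K" "s = real k * h" using k s \<open>\<not> s < real k * h\<close> by auto
        then show ?thesis using \<open>0 < d\<close> by simp
      qed
      then show ?thesis using dec[of "real k * h" s] kh False by simp
    qed
    ultimately show ?thesis by simp
  qed
  then have "\<forall>s\<in>{0..1 / e}. \<bar>grid_path h L (\<lambda>k. y (real k * h)) (l s) - y s\<bar> \<le> e"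
    using assms(3,5) by (meson atLeastAtMost_iff order_trans)
  moreover have "\<forall>s\<ge>0. \<bar>l s - s\<bar> \<le> e" using l(3) \<open>h \<le> e\<close> by (meson order_trans)
  ultimately show ?thesis
    unfolding j1_nhd_def using l(1) skorohod_grid_path[OF \<open>0 < h\<close>] by blast
qed

text \<open>One-sided limits give every time \<open>t\<close> a ball on each side of whose centre
  \<open>y\<close> oscillates by at most \<open>e\<close>; \<open>\<delta>\<close> is a Lebesgue
  number of this cover of \<open>{0..T}\<close>. Of three points \<open>a \<le> s \<le> b\<close> in
  one ball, \<open>s\<close> is on the same side of the centre as \<open>a\<close> or as
  \<open>b\<close>.\<close>

lemma cadlag_on_no_double_drop:
  fixes y :: "real \<Rightarrow> real"
  assumes y: "cadlag_on {0..} y" and "0 < e"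
  shows "\<exists>\<delta>>0. \<forall>a s b. 0 \<le> a \<longrightarrow> a \<le> s \<longrightarrow> s \<le> b \<longrightarrow> b \<le> T \<longrightarrow> b - a < \<delta> \<longrightarrow>
    \<bar>y a - y s\<bar> \<le> e \<or> \<bar>y s - y b\<bar> \<le> e"
proof -
  define Q where "Q t d \<longleftrightarrow> d > 0 \<and> (\<forall>u v. 0 \<le> u \<longrightarrow> 0 \<le> v \<longrightarrow> u \<in> ball t d \<longrightarrow> v \<in> ball t d \<longrightarrow>
    (u < t \<longleftrightarrow> v < t) \<longrightarrow> \<bar>y u - y v\<bar> \<le> e)" for t d
  have "\<exists>d. Q t d" if "0 \<le> t" for t
  proof -
    have "(y \<longlongrightarrow> y t) (at t within {0..} \<inter> {t..})"
      using y that by (auto simp: cadlag_on_def continuous_within)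
    then have "\<forall>\<^sub>F u in at t within {0..} \<inter> {t..}. dist (y u) (y t) < e / 2"
      using \<open>0 < e\<close> by (intro tendstoD) auto
    then obtain d1 where d1: "d1 > 0" "\<And>u. u \<in> {0..} \<inter> {t..} \<Longrightarrow> u \<noteq> t \<Longrightarrow> dist u t < d1 \<Longrightarrow> dist (y u) (y t) < e / 2"
      unfolding eventually_at by blast
    have "\<exists>L. (y \<longlongrightarrow> L) (at t within {0..} \<inter> {..<t})"
      using y that unfolding cadlag_on_def by simp
    then obtain L where "(y \<longlongrightarrow> L) (at t within {0..} \<inter> {..<t})" ..
    then have "\<forall>\<^sub>F u in at t within {0..} \<inter> {..<t}. dist (y u) L < e / 2"
      using \<open>0 < e\<close> by (intro tendstoD) auto
    then obtain d2 where d2: "d2 > 0" "\<And>u. u \<in> {0..} \<inter> {..<t} \<Longrightarrow> u \<noteq> t \<Longrightarrow> dist u t < d2 \<Longrightarrow> dist (y u) L < e / 2"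
      unfolding eventually_at by blast
    have A: "\<bar>y u - y t\<bar> < e / 2" if "t \<le> u" "dist u t < d1" for u
      using d1(2)[of u] that \<open>0 \<le> t\<close> \<open>0 < e\<close> by (cases "u = t") (auto simp: dist_real_def)
    have B: "\<bar>y u - L\<bar> < e / 2" if "0 \<le> u" "u < t" "dist u t < d2" for u
      using d2(2)[of u] that by (auto simp: dist_real_def)
    have uv: "\<bar>y u - y v\<bar> \<le> e"
      if "0 \<le> u" "0 \<le> v" "u \<in> ball t (min d1 d2)" "v \<in> ball t (min d1 d2)" "u < t \<longleftrightarrow> v < t" for u v
    proof (cases "u < t")
      case True
      have "\<bar>y u - L\<bar> < e / 2" "\<bar>y v - L\<bar> < e / 2"
        by (rule B; use True that in \<open>simp add: dist_commute\<close>)+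
      then show ?thesis by linarith
    next
      case False
      have "\<bar>y u - y t\<bar> < e / 2" "\<bar>y v - y t\<bar> < e / 2"
        by (rule A; use False that in \<open>simp add: dist_commute\<close>)+
      then show ?thesis by linarith
    qed
    have "Q t (min d1 d2)" unfolding Q_def
    proof (intro conjI allI impI)
      show "0 < min d1 d2" using d1(1) d2(1) by simp
    qed (rule uv; assumption)
    then show ?thesis ..
  qed
  then have "\<forall>t\<in>{0..}. \<exists>d. Q t d" by simp
  from bchoice[OF this] obtain d where "\<forall>t\<in>{0..}. Q t (d t)" ..
  then have Q: "Q t (d t)" if "0 \<le> t" for t using that by simp
  have d: "d t > 0" if "0 \<le> t" for t using Q[OF that] by (simp add: Q_def)
  have d': "\<bar>y u - y v\<bar> \<le> e"
    if "0 \<le> t" "0 \<le> u" "0 \<le> v" "u \<in> ball t (d t)" "v \<in> ball t (d t)" "u < t \<longleftrightarrow> v < t" for t u v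
    using Q[OF that(1)] that(2-) unfolding Q_def by blast
  have cover: "{0..T} \<subseteq> \<Union> ((\<lambda>t. ball t (d t)) ` {0..T})"
  proof
    fix t assume "t \<in> {0..T}"
    then show "t \<in> \<Union> ((\<lambda>t. ball t (d t)) ` {0..T})" using d[of t] by (intro UN_I[of t]) simp_all
  qed
  have "\<exists>\<delta>>0. \<forall>x\<in>{0..T}. \<exists>t\<in>{0..T}. ball x \<delta> \<subseteq> ball t (d t)"
  proof (rule Heine_Borel_lemma[OF compact_Icc cover])
    fix \<delta> :: real
    assume "0 < \<delta>" "\<And>x. x \<in> {0..T} \<Longrightarrow> \<exists>G\<in>(\<lambda>t. ball t (d t)) ` {0..T}. ball x \<delta> \<subseteq> G"
    then show ?thesis by (intro exI[of _ \<delta>]) (simp add: bex_simps)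
  qed auto
  then obtain \<delta> where \<delta>: "\<delta> > 0" "\<And>x. x \<in> {0..T} \<Longrightarrow> \<exists>t\<in>{0..T}. ball x \<delta> \<subseteq> ball t (d t)"
    by auto
  have dd: "\<bar>y a - y s\<bar> \<le> e \<or> \<bar>y s - y b\<bar> \<le> e"
    if "0 \<le> a" "a \<le> s" "s \<le> b" "b \<le> T" "b - a < \<delta>" for a s b
  proof -
    have "a \<in> {0..T}" using that by simp
    from \<delta>(2)[OF this] obtain t where t: "t \<in> {0..T}" "ball a \<delta> \<subseteq> ball t (d t)" by blast
    have "a \<in> ball a \<delta>" "s \<in> ball a \<delta>" "b \<in> ball a \<delta>" using that \<delta>(1) by (auto simp: dist_real_def)
    then have "a \<in> ball t (d t)" "s \<in> ball t (d t)" "b \<in> ball t (d t)" using subsetD[OF t(2)] by blast+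
    note in_ball = this
    show ?thesis
    proof (cases "s < t")
      case True
      then have "\<bar>y a - y s\<bar> \<le> e" using in_ball t(1) that by (intro d'[where t = t]) simp_all
      then show ?thesis ..
    next
      case False
      then have "\<bar>y s - y b\<bar> \<le> e" using in_ball t(1) that by (intro d'[where t = t]) simp_all
      then show ?thesis ..
    qed
  qed
  show ?thesis
  proof (intro exI[of _ \<delta>] conjI allI impI)
    show "0 < \<delta>" by (rule \<delta>(1))
  qed (rule dd; assumption)
qed

text \<open>The horizon \<open>cells m * mesh m\<close> tends to infinity while \<open>cells m * (mesh m)\<^sup>2\<close> tends to \<open>0\<close>.\<close>

definition mesh :: "nat \<Rightarrow> real" where "mesh m = 1 / real (Suc m) ^ 2"

definition cells :: "nat \<Rightarrow> nat" where "cells m = Suc m ^ 3"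

lemma mesh_pos [simp]: "0 < mesh m"
  by (simp add: mesh_def)

lemma real_cells: "real (cells m) = real (Suc m) ^ 3"
  by (simp only: cells_def of_nat_power)

lemma cells_mesh: "real (cells m) * mesh m = real (Suc m)"
  unfolding real_cells mesh_def by (simp add: power3_eq_cube power2_eq_square del: of_nat_Suc)

lemma cells_mesh_sq: "real (cells m) * (mesh m)\<^sup>2 = 1 / real (Suc m)"
  unfolding real_cells mesh_def by (simp add: power3_eq_cube power2_eq_square del: of_nat_Suc)

lemma mesh_tendsto_0: "mesh \<longlonglongrightarrow> 0"
proof -
  have eq: "mesh = (\<lambda>m. inverse (real (Suc m)) ^ 2)"
    by (simp add: fun_eq_iff mesh_def power2_eq_square inverse_eq_divide del: of_nat_Suc)
  show ?thesis
    unfolding eq using tendsto_power[OF LIMSEQ_inverse_real_of_nat, of 2] by (simp only: zero_power2)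
qed

lemma grid_paths_converge:
  assumes y: "cadlag_on {0..} y" "antimono_on {0..} y" and "y \<in> skorohod_space"
  shows "limitin j1_topology (\<lambda>m. grid_path (mesh m) (cells m) (\<lambda>k. y (real k * mesh m))) y sequentially"
  unfolding limitin_j1_topology_nhd
proof (intro conjI allI impI)
  fix e :: real assume "e > 0"
  obtain \<delta> where \<delta>: "\<delta> > 0" "\<And>a s b. 0 \<le> a \<Longrightarrow> a \<le> s \<Longrightarrow> s \<le> b \<Longrightarrow> b \<le> 1 / e + 1 \<Longrightarrow> b - a < \<delta> \<Longrightarrow>
    \<bar>y a - y s\<bar> \<le> e \<or> \<bar>y s - y b\<bar> \<le> e"
    using cadlag_on_no_double_drop[OF y(1) \<open>e > 0\<close>, of "1 / e + 1"] by metis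
  have "\<forall>\<^sub>F m in sequentially. mesh m < min \<delta> (min e 1)"
    using \<delta>(1) \<open>e > 0\<close> by (intro order_tendstoD(2)[OF mesh_tendsto_0]) auto
  moreover have "\<forall>\<^sub>F m in sequentially. 1 / e + 1 \<le> real m"
    by (rule eventually_sequentiallyI[of "nat \<lceil>1 / e + 1\<rceil>"]) linarith
  ultimately show "\<forall>\<^sub>F m in sequentially. grid_path (mesh m) (cells m) (\<lambda>k. y (real k * mesh m)) \<in> j1_nhd e y"
  proof eventually_elim
    case (elim m)
    define h where "h = mesh m"
    have h: "0 < h" "h < \<delta>" "h < e" "h < 1" using elim by (auto simp: h_def)
    \<comment> \<open>The fewest cells that cover \<open>{0..1 / e}\<close>; they end before
      \<open>1 / e + 1\<close>, the horizon for which \<open>\<delta>\<close> was chosen.\<close>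
    define K where "K = nat \<lceil>1 / e / h\<rceil>"
    have "0 \<le> 1 / e / h" using h \<open>e > 0\<close> by simp
    then have "1 / e / h \<le> real K" "real K < 1 / e / h + 1" unfolding K_def by linarith+
    then have K: "1 / e \<le> real K * h" "real K * h < 1 / e + h"
      using h by (simp_all add: pos_divide_le_eq field_simps)
    have "real K * h \<le> real (cells m) * h"
      using K(2) h elim(2) cells_mesh[of m] by (simp add: h_def)
    then have "K \<le> cells m" using h by simp
    have "grid_path h (cells m) (\<lambda>k. y (real k * h)) \<in> j1_nhd e y"
    proof (rule grid_path_in_j1_nhd[where d = e and K = K])
      fix k s assume k: "k < K" "s \<in> {real k * h..real (Suc k) * h}"
      have "real (Suc k) * h \<le> real K * h" using k(1) h by (intro mult_right_mono) auto
      then have "\<bar>y (real k * h) - y s\<bar> \<le> e \<or> \<bar>y s - y (real (Suc k) * h)\<bar> \<le> e"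
        using k h K(2) by (intro \<delta>(2)) (auto simp: algebra_simps)
      then show "y (real k * h) - y s \<le> e \<or> y s - y (real (Suc k) * h) \<le> e" by linarith
    qed (use y h K \<open>e > 0\<close> \<open>K \<le> cells m\<close> in auto)
    then show ?case by (simp add: h_def)
  qed
qed fact

lemma cadlag_on_compose_scaled:
  fixes f :: "real \<Rightarrow> real" and g :: "real \<Rightarrow> real"
  assumes f: "cadlag_on {0..} f" and g: "\<And>x. isCont g x" and "0 < t"
  shows "(\<lambda>s\<in>{0..}. g (f (t * s))) \<in> skorohod_space"
proof -
  \<comment> \<open>\<open>S\<close> stands for the half-line on either side, so that
    right-continuity and left limits come from one argument.\<close>
  have lim: "((\<lambda>s\<in>{0..}. g (f (t * s))) \<longlongrightarrow> g l) (at s within {0..} \<inter> S s)"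
    if l: "(f \<longlongrightarrow> l) (at (t * s) within {0..} \<inter> S (t * s))" and S: "\<And>x s. x \<in> S s \<Longrightarrow> t * x \<in> S (t * s)" for l s S
  proof -
    have ev: "\<forall>\<^sub>F x in at s within {0..} \<inter> S s. x \<in> {0..} \<inter> S s \<and> x \<noteq> s"
      by (simp add: eventually_at_filter)
    have "filterlim (\<lambda>x. t * x) (at (t * s) within {0..} \<inter> S (t * s)) (at s within {0..} \<inter> S s)"
      unfolding filterlim_at
    proof
      show "\<forall>\<^sub>F x in at s within {0..} \<inter> S s. t * x \<in> {0..} \<inter> S (t * s) \<and> t * x \<noteq> t * s"
        using ev by eventually_elim (use S \<open>0 < t\<close> in auto)
    qed (intro tendsto_intros)
    from isCont_tendsto_compose[OF g filterlim_compose[OF l this]]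
    have "((\<lambda>x. g (f (t * x))) \<longlongrightarrow> g l) (at s within {0..} \<inter> S s)" .
    moreover have "\<forall>\<^sub>F x in at s within {0..} \<inter> S s. g (f (t * x)) = (\<lambda>s\<in>{0..}. g (f (t * s))) x"
      using ev by eventually_elim simp
    ultimately show ?thesis by (rule Lim_transform_eventually)
  qed
  have "continuous (at s within {0..} \<inter> {s..}) (\<lambda>s\<in>{0..}. g (f (t * s)))" if "0 \<le> s" for s
  proof -
    have "(f \<longlongrightarrow> f (t * s)) (at (t * s) within {0..} \<inter> {t * s..})"
      using f that \<open>0 < t\<close> unfolding cadlag_on_def continuous_within by simp
    from lim[where S = atLeast, OF this] show ?thesis
      using that \<open>0 < t\<close> by (simp add: continuous_within)
  qed
  moreover have "\<exists>l. ((\<lambda>s\<in>{0..}. g (f (t * s))) \<longlongrightarrow> l) (at s within {0..} \<inter> {..<s})" if "0 \<le> s" for s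
  proof -
    have "\<exists>l. (f \<longlongrightarrow> l) (at (t * s) within {0..} \<inter> {..<t * s})"
      using f that \<open>0 < t\<close> unfolding cadlag_on_def by simp
    then obtain l where "(f \<longlongrightarrow> l) (at (t * s) within {0..} \<inter> {..<t * s})" ..
    from lim[where S = lessThan, OF this] \<open>0 < t\<close> show ?thesis by auto
  qed
  ultimately show ?thesis unfolding skorohod_space_def cadlag_on_def by simp
qed

section \<open>Measurability of random paths\<close>

text \<open>The inverse time change reverses the roles of the two paths. It may carry
  \<open>s \<le> 1 / e\<close> as far as \<open>1 / e + d\<close>, which must still lie in the
  window \<open>1 / d\<close> on which the paths are compared.\<close>

lemma j1_nhd_sym:
  assumes y: "y \<in> j1_nhd d x" and "x \<in> skorohod_space" "0 < d" "d \<le> e" "1 / e + d \<le> 1 / d"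
  shows "x \<in> j1_nhd e y"
proof -
  obtain l where l: "time_change l" "\<And>s. s \<ge> 0 \<Longrightarrow> \<bar>l s - s\<bar> \<le> d"
    "\<And>s. s \<in> {0..1/d} \<Longrightarrow> \<bar>y (l s) - x s\<bar> \<le> d"
    using y unfolding j1_nhd_def by blast
  obtain m where m: "time_change m" "\<And>s. s \<ge> 0 \<Longrightarrow> l (m s) = s"
    using time_change_inverse[OF l(1)] by blast
  have "\<bar>m s - s\<bar> \<le> d" if "s \<ge> 0" for s
    using l(2)[OF time_change_nonneg[OF m(1) that]] m(2)[OF that] by (simp add: abs_minus_commute)
  note close = this
  have "\<bar>x (m s) - y s\<bar> \<le> e" if "s \<in> {0..1 / e}" for s
  proof -
    have "m s \<in> {0..1 / d}"
      using close[of s] that assms(5) time_change_nonneg[OF m(1), of s] by auto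
    from l(3)[OF this] show ?thesis
      using m(2)[of s] that \<open>d \<le> e\<close> by (simp add: abs_minus_commute)
  qed
  moreover have "\<forall>s\<ge>0. \<bar>m s - s\<bar> \<le> e" using close \<open>d \<le> e\<close> by (meson order_trans)
  ultimately show ?thesis using m(1) assms(2) unfolding j1_nhd_def by blast
qed

text \<open>The substitute for the triangle inequality: one radius \<open>d\<close> serves all
  points of an open set around \<open>x\<close>.\<close>

lemma j1_nhd_uniform:
  assumes "x \<in> skorohod_space" "0 < e"
  shows "\<exists>d>0. \<exists>W. openin j1_topology W \<and> x \<in> W \<and>
    (\<forall>x'\<in>W. x' \<in> j1_nhd e x \<and> (\<forall>d'. 0 < d' \<longrightarrow> d' \<le> d \<longrightarrow> j1_nhd d' x' \<subseteq> j1_nhd e x))"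
proof -
  define d1 where "d1 = e / 2"
  have d1: "0 < d1" "d1 < e" using assms by (auto simp: d1_def)
  obtain W where W: "openin j1_topology W" "x \<in> W" "W \<subseteq> j1_nhd d1 x"
    using j1_nhd_contains_open[OF assms(1) d1(1)] by blast
  \<comment> \<open>Small enough that every \<open>d' \<le> d\<close> meets the window condition
    \<open>1 / d1 + d1 \<le> 1 / d'\<close> of \<open>j1_nhd_triangle\<close>.\<close>
  define d where "d = min d1 (1 / (1 / d1 + d1))"
  have pos: "0 < 1 / d1 + d1" using d1 by (simp add: add_pos_pos)
  have "0 < d" using pos d1 by (simp add: d_def)
  moreover have "x' \<in> j1_nhd e x \<and> (\<forall>d'. 0 < d' \<longrightarrow> d' \<le> d \<longrightarrow> j1_nhd d' x' \<subseteq> j1_nhd e x)" if "x' \<in> W" for x'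
  proof (intro conjI allI impI)
    show "x' \<in> j1_nhd e x" using j1_nhd_mono[of d1 e x] d1 W that by auto
    fix d' assume d': "0 < d'" "d' \<le> d"
    then have "d' \<le> 1 / (1 / d1 + d1)" "d' \<le> d1" by (simp_all add: d_def)
    then have "1 / d1 + d1 \<le> 1 / d'" using d' pos by (simp add: pos_le_divide_eq mult.commute)
    then have "j1_nhd d' x' \<subseteq> j1_nhd (d1 + d') x"
      using j1_nhd_triangle[of x' d1 x _ d'] W(3) that d1(1) d'(1) by blast
    also have "\<dots> \<subseteq> j1_nhd e x"
      using \<open>d' \<le> d1\<close> d' d1 by (intro j1_nhd_mono) (auto simp: d1_def)
    finally show "j1_nhd d' x' \<subseteq> j1_nhd e x" .
  qed
  ultimately show ?thesis using W by blast
qed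

section \<open>Borel measurability of path-valued maps\<close>

lemma space_borel_of [simp]: "space (borel_of T) = topspace T"
  unfolding borel_of_def by (rule space_measure_of) (use openin_subset in blast)

lemma sets_borel_of_openin: "openin T U \<Longrightarrow> U \<in> sets (borel_of T)"
  unfolding borel_of_def by (subst sets_measure_of) (use openin_subset in auto)

lemma measurable_borel_ofI:
  assumes "\<And>\<omega>. \<omega> \<in> space M \<Longrightarrow> g \<omega> \<in> topspace T"
    and "\<And>U. openin T U \<Longrightarrow> g -` U \<inter> space M \<in> sets M"
  shows "g \<in> M \<rightarrow>\<^sub>M borel_of T"
  unfolding borel_of_def
proof (rule measurable_measure_of)
  show "{U. openin T U} \<subseteq> Pow (topspace T)" by (auto dest: openin_subset)
  show "g \<in> space M \<rightarrow> topspace T" by (rule Pi_I) (rule assms(1))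
  show "g -` U \<inter> space M \<in> sets M" if "U \<in> {U. openin T U}" for U
    using assms(2)[of U] that by simp
qed

lemma continuous_map_borel_measurable:
  assumes "continuous_map T euclideanreal f"
  shows "f \<in> borel_measurable (borel_of T)"
proof (rule borel_measurableI)
  fix S :: "real set" assume "open S"
  then have "openin T {x \<in> topspace T. f x \<in> S}"
    using openin_continuous_map_preimage[OF assms, of S] by simp
  from sets_borel_of_openin[OF this] show "f -` S \<inter> space (borel_of T) \<in> sets (borel_of T)"
    by (simp add: vimage_def Int_def conj_commute)
qed

text \<open>An open \<open>U\<close> is exhausted by the open sets \<open>V n\<close> of points that
  keep a margin \<open>1 / real (Suc n)\<close> inside \<open>U\<close>. The limit lies in
  \<open>U\<close> exactly when the approximants eventually lie in one \<open>V n\<close>: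
  \<open>j1_nhd_uniform\<close> supplies the margin in one direction, \<open>j1_nhd_sym\<close>
  returns from an approximant to the limit in the other.\<close>

lemma measurable_limit_j1:
  assumes g: "\<And>j. g j \<in> M \<rightarrow>\<^sub>M borel_of j1_topology"
    and lim: "\<And>\<omega>. \<omega> \<in> space M \<Longrightarrow> limitin j1_topology (\<lambda>j. g j \<omega>) (g' \<omega>) sequentially"
  shows "g' \<in> M \<rightarrow>\<^sub>M borel_of j1_topology"
proof (rule measurable_borel_ofI)
  show "g' \<omega> \<in> topspace j1_topology" if "\<omega> \<in> space M" for \<omega>
    by (rule limitin_topspace[OF lim[OF that]])
  fix U assume U: "openin j1_topology U"
  define V where "V n = \<Union>{W. openin j1_topology W \<and> (\<forall>x\<in>W. j1_nhd (1 / real (Suc n)) x \<subseteq> U)}" for n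
  have V: "openin j1_topology (V n)" for n unfolding V_def by blast
  have in_D: "g j \<omega> \<in> skorohod_space" if "\<omega> \<in> space M" for j \<omega>
    using measurable_space[OF g that] by simp
  have "g' \<omega> \<in> U \<longleftrightarrow> (\<exists>n J. \<forall>j\<ge>J. g j \<omega> \<in> V n)" if \<omega>: "\<omega> \<in> space M" for \<omega>
  proof
    assume "g' \<omega> \<in> U"
    then obtain e where e: "e > 0" "j1_nhd e (g' \<omega>) \<subseteq> U" "g' \<omega> \<in> skorohod_space"
      using U unfolding openin_j1_topology by blast
    obtain d W where d: "d > 0" "openin j1_topology W" "g' \<omega> \<in> W"
      "\<And>x' d'. x' \<in> W \<Longrightarrow> 0 < d' \<Longrightarrow> d' \<le> d \<Longrightarrow> j1_nhd d' x' \<subseteq> j1_nhd e (g' \<omega>)"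
      using j1_nhd_uniform[OF e(3,1)] by metis
    obtain n where n: "1 / real (Suc n) < d" using nat_approx_posE[OF d(1)] by blast
    have "W \<subseteq> V n"
      unfolding V_def using d(2) d(4)[of _ "1 / real (Suc n)"] n e(2) by (intro Union_upper) fastforce
    then have "\<forall>\<^sub>F j in sequentially. g j \<omega> \<in> V n"
      using lim[OF \<omega>] V[of n] d(3) unfolding limitin_def by blast
    then show "\<exists>n J. \<forall>j\<ge>J. g j \<omega> \<in> V n" by (auto simp: eventually_sequentially)
  next
    assume "\<exists>n J. \<forall>j\<ge>J. g j \<omega> \<in> V n"
    then obtain n J where J: "\<And>j. j \<ge> J \<Longrightarrow> g j \<omega> \<in> V n" by blast
    define e where "e = 1 / real (Suc n)"
    define d where "d = min e (1 / (1 / e + e))"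
    have e0: "0 < e" by (simp add: e_def)
    have pos: "0 < 1 / e + e" using e0 by (simp add: add_pos_pos)
    have d: "0 < d" "d \<le> e" using pos e0 by (auto simp: d_def)
    have "d \<le> 1 / (1 / e + e)" by (simp add: d_def)
    then have "1 / e + e \<le> 1 / d" using d pos by (simp add: pos_le_divide_eq mult.commute)
    then have d': "1 / e + d \<le> 1 / d" using d by simp
    have "\<forall>\<^sub>F j in sequentially. g j \<omega> \<in> j1_nhd d (g' \<omega>)" and D: "g' \<omega> \<in> skorohod_space"
      using lim[OF \<omega>] d(1) by (auto simp: limitin_j1_topology_nhd)
    then obtain j where j: "j \<ge> J" "g j \<omega> \<in> j1_nhd d (g' \<omega>)"
      unfolding eventually_sequentially by (meson nat_le_linear)
    have "g' \<omega> \<in> j1_nhd e (g j \<omega>)" by (rule j1_nhd_sym[OF j(2) D d d'])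
    moreover have "j1_nhd e (g j \<omega>) \<subseteq> U" using J[OF j(1)] unfolding V_def e_def by blast
    ultimately show "g' \<omega> \<in> U" by blast
  qed
  note iff = this
  have "g' -` U \<inter> space M = {\<omega> \<in> space M. \<exists>n J. \<forall>j\<in>{J..}. g j \<omega> \<in> V n}"
  proof (intro set_eqI)
    fix \<omega>
    show "\<omega> \<in> g' -` U \<inter> space M \<longleftrightarrow> \<omega> \<in> {\<omega> \<in> space M. \<exists>n J. \<forall>j\<in>{J..}. g j \<omega> \<in> V n}"
      using iff[of \<omega>] by (cases "\<omega> \<in> space M") (simp_all add: Ball_def)
  qed
  also have "\<dots> \<in> sets M"
  proof (intro sets.sets_Collect_countable_Ex sets.sets_Collect_countable_Ball countable_subset[OF subset_UNIV countableI_type])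
    fix n j
    show "{\<omega> \<in> space M. g j \<omega> \<in> V n} \<in> sets M"
      using measurable_sets[OF g sets_borel_of_openin[OF V], of j n] by (simp add: vimage_def Int_def conj_commute)
  qed
  finally show "g' -` U \<inter> space M \<in> sets M" .
qed

lemma limitin_grid_path:
  assumes "0 < h" and lim: "\<And>k. k \<le> K \<Longrightarrow> (\<lambda>j. v j k) \<longlonglongrightarrow> v' k"
  shows "limitin j1_topology (\<lambda>j. grid_path h K (v j)) (grid_path h K v') sequentially"
  unfolding limitin_j1_topology_nhd
proof (intro conjI allI impI)
  show "grid_path h K v' \<in> skorohod_space" by (rule skorohod_grid_path[OF assms(1)])
  fix e :: real assume "e > 0"
  have "\<forall>\<^sub>F j in sequentially. \<forall>k\<in>{..K}. dist (v j k) (v' k) < e"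
    by (intro eventually_ball_finite ballI tendstoD[OF lim] \<open>e > 0\<close>) auto
  then show "\<forall>\<^sub>F j in sequentially. grid_path h K (v j) \<in> j1_nhd e (grid_path h K v')"
  proof eventually_elim
    case (elim j)
    have "\<forall>s\<in>{0..1/e}. \<bar>grid_path h K (v j) s - grid_path h K v' s\<bar> \<le> e"
      using elim by (auto simp: grid_path_def dist_real_def intro: less_imp_le)
    then show ?case
      unfolding j1_nhd_def using skorohod_grid_path[OF assms(1)] time_change_id \<open>e > 0\<close>
      by (auto intro!: exI[of _ "\<lambda>s. s"])
  qed
qed

text \<open>Rounding the values to multiples of \<open>1 / real (Suc j)\<close> leaves countably
  many possible paths, coded by integer lists, so measurability has to be checked on single lists
  only, whatever the Borel sets of paths look like. Then \<open>j\<close> tends to infinity.\<close>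

lemma measurable_grid_path:
  assumes "0 < h" and v: "\<And>k. k \<le> K \<Longrightarrow> v k \<in> borel_measurable M"
  shows "(\<lambda>\<omega>. grid_path h K (\<lambda>k. v k \<omega>)) \<in> M \<rightarrow>\<^sub>M borel_of j1_topology"
proof (rule measurable_limit_j1)
  define r where "r j x = of_int \<lfloor>real (Suc j) * x\<rfloor> / real (Suc j)" for j x
  have r: "(\<lambda>j. r j x) \<longlonglongrightarrow> x" for x
  proof (rule LIMSEQ_I)
    fix e :: real assume "0 < e"
    then obtain J where J: "1 / real (Suc J) < e" using nat_approx_posE by blast
    have "norm (r j x - x) < e" if "j \<ge> J" for j
    proof -
      have "r j x - x = - (frac (real (Suc j) * x) / real (Suc j))"
        by (simp add: r_def frac_def field_simps del: of_nat_Suc)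
      then have "norm (r j x - x) \<le> 1 / real (Suc j)"
        using frac_ge_0[of "real (Suc j) * x"] frac_lt_1[of "real (Suc j) * x"]
        by (simp add: divide_right_mono del: of_nat_Suc)
      also have "\<dots> \<le> 1 / real (Suc J)" using that by (simp add: frac_le)
      finally show ?thesis using J by simp
    qed
    then show "\<exists>J. \<forall>j\<ge>J. norm (r j x - x) < e" by blast
  qed
  show "limitin j1_topology (\<lambda>j. grid_path h K (\<lambda>k. r j (v k \<omega>))) (grid_path h K (\<lambda>k. v k \<omega>)) sequentially" for \<omega>
    by (rule limitin_grid_path[OF assms(1) r])
  fix j
  define N where "N \<omega> = map (\<lambda>k. \<lfloor>real (Suc j) * v k \<omega>\<rfloor>) [0..<Suc K]" for \<omega>
  define G where "G xs = grid_path h K (\<lambda>k. of_int (xs ! k) / real (Suc j))" for xs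
  have "N \<in> M \<rightarrow>\<^sub>M count_space UNIV"
  proof (rule measurableI)
    have "N -` {xs} \<inter> space M \<in> sets M" for xs
    proof (cases "length xs = Suc K")
      case True
      have "N \<omega> = xs \<longleftrightarrow> (\<forall>k\<in>{..K}. \<lfloor>real (Suc j) * v k \<omega>\<rfloor> = xs ! k)" for \<omega>
        unfolding N_def list_eq_iff_nth_eq using True
        by (simp add: Ball_def less_Suc_eq_le del: upt_Suc of_nat_Suc)
      then have "N -` {xs} \<inter> space M = {\<omega> \<in> space M. \<forall>k\<in>{..K}. \<lfloor>real (Suc j) * v k \<omega>\<rfloor> = xs ! k}"
        by blast
      also have "\<dots> \<in> sets M"
      proof (rule sets.sets_Collect_finite_All')
        fix k assume "k \<in> {..K}"
        then have [measurable]: "v k \<in> borel_measurable M" using v by simp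
        show "{\<omega> \<in> space M. \<lfloor>real (Suc j) * v k \<omega>\<rfloor> = xs ! k} \<in> sets M" by measurable
      qed auto
      finally show ?thesis .
    next
      case False
      then have "N -` {xs} \<inter> space M = {}" by (auto simp: N_def simp del: upt_Suc)
      then show ?thesis by simp
    qed
    note singleton = this
    fix A
    have "N -` A \<inter> space M = (\<Union>xs\<in>A. N -` {xs} \<inter> space M)" by blast
    also have "\<dots> \<in> sets M" by (intro sets.countable_UN'' singleton) simp
    finally show "N -` A \<inter> space M \<in> sets M" .
  qed simp
  moreover have "G \<in> count_space UNIV \<rightarrow>\<^sub>M borel_of j1_topology"
    using skorohod_grid_path[OF assms(1)] by (simp add: G_def)
  ultimately have "(\<lambda>\<omega>. G (N \<omega>)) \<in> M \<rightarrow>\<^sub>M borel_of j1_topology" by (rule measurable_compose)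
  moreover have "G (N \<omega>) = grid_path h K (\<lambda>k. r j (v k \<omega>))" for \<omega>
    unfolding G_def grid_path_def N_def r_def
    by (intro restrict_ext) (simp add: nth_map less_Suc_eq_le del: upt_Suc of_nat_Suc)
  ultimately show "(\<lambda>\<omega>. grid_path h K (\<lambda>k. r j (v k \<omega>))) \<in> M \<rightarrow>\<^sub>M borel_of j1_topology" by simp
qed

section \<open>Weak convergence by approximation\<close>

text \<open>
  A continuous function on the path space need not be uniformly continuous; these increasing open
  sets, which exhaust the space, are a substitute for that.
\<close>

definition stable_set :: "((real \<Rightarrow> real) \<Rightarrow> real) \<Rightarrow> real \<Rightarrow> nat \<Rightarrow> (real \<Rightarrow> real) set" where
  "stable_set f e n = \<Union>{W. openin j1_topology W \<and> (\<forall>x\<in>W. \<forall>y\<in>j1_nhd (1 / real (Suc n)) x. \<bar>f y - f x\<bar> \<le> e)}"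

lemma openin_stable_set: "openin j1_topology (stable_set f e n)"
  unfolding stable_set_def by blast

lemma stable_setD: "x \<in> stable_set f e n \<Longrightarrow> y \<in> j1_nhd (1 / real (Suc n)) x \<Longrightarrow> \<bar>f y - f x\<bar> \<le> e"
  unfolding stable_set_def by blast

lemma stable_set_mono: "m \<le> n \<Longrightarrow> stable_set f e m \<subseteq> stable_set f e n"
  unfolding stable_set_def using j1_nhd_mono[of "1 / real (Suc n)" "1 / real (Suc m)"]
  by (intro Union_mono) (fastforce simp: frac_le)

text \<open>Continuity at \<open>x\<close> confines \<open>f\<close> to within \<open>e / 2\<close>
  of \<open>f x\<close> on some \<open>j1_nhd r x\<close>, and \<open>j1_nhd_uniform\<close> keeps
  both the points near \<open>x\<close> and their own small neighbourhoods inside it.\<close>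

lemma stable_set_exhausts:
  assumes f: "continuous_map j1_topology euclideanreal f" and "0 < e"
  shows "(\<Union>n. stable_set f e n) = skorohod_space"
proof (intro equalityI subsetI)
  fix x assume "x \<in> (\<Union>n. stable_set f e n)"
  then show "x \<in> skorohod_space"
    using openin_subset[OF openin_stable_set] by auto
next
  fix x assume x: "x \<in> skorohod_space"
  have "openin j1_topology {y \<in> topspace j1_topology. f y \<in> ball (f x) (e / 2)}"
    using openin_continuous_map_preimage[OF f, of "ball (f x) (e / 2)"] by simp
  then obtain r where r: "r > 0" "j1_nhd r x \<subseteq> {y \<in> skorohod_space. f y \<in> ball (f x) (e / 2)}"
    using x \<open>0 < e\<close> unfolding openin_j1_topology by force
  obtain d W where d: "d > 0" "openin j1_topology W" "x \<in> W" "\<And>x'. x' \<in> W \<Longrightarrow> x' \<in> j1_nhd r x"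
    "\<And>x' d'. x' \<in> W \<Longrightarrow> 0 < d' \<Longrightarrow> d' \<le> d \<Longrightarrow> j1_nhd d' x' \<subseteq> j1_nhd r x"
    using j1_nhd_uniform[OF x r(1)] by metis
  obtain n where n: "1 / real (Suc n) < d" using nat_approx_posE[OF d(1)] by blast
  have close: "\<bar>f y - f x\<bar> < e / 2" if "y \<in> j1_nhd r x" for y
    using r(2) that by (auto simp: dist_real_def abs_minus_commute)
  have "\<bar>f y - f x'\<bar> \<le> e" if x': "x' \<in> W" and y: "y \<in> j1_nhd (1 / real (Suc n)) x'" for x' y
  proof -
    have "y \<in> j1_nhd r x" using d(5)[OF x', of "1 / real (Suc n)"] n y by auto
    then show ?thesis using close[of y] close[OF d(4)[OF x']] by linarith
  qed
  then have "x \<in> stable_set f e n" using d(2,3) unfolding stable_set_def by blast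
  then show "x \<in> (\<Union>n. stable_set f e n)" by blast
qed

lemma continuous_map_limitin_real:
  assumes "continuous_map T euclideanreal f" "limitin T g l F"
  shows "((\<lambda>i. f (g i)) \<longlongrightarrow> f l) F"
  using continuous_map_limit[OF assms] by (simp add: comp_def)

text \<open>The second claim carries the probability of missing a stable set from the limit to the
  approximants: as \<open>S\<close> is open, \<open>G n\<close> is eventually in \<open>S\<close>
  wherever \<open>G'\<close> is.\<close>

lemma weak_limit_pointwise:
  fixes f :: "(real \<Rightarrow> real) \<Rightarrow> real"
  assumes "prob_space Q"
    and f: "continuous_map j1_topology euclideanreal f" and B: "\<And>x. x \<in> skorohod_space \<Longrightarrow> \<bar>f x\<bar> \<le> B"
    and G: "\<And>n. G n \<in> Q \<rightarrow>\<^sub>M borel_of j1_topology" and G': "G' \<in> Q \<rightarrow>\<^sub>M borel_of j1_topology"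
    and lim: "\<And>\<omega>. \<omega> \<in> space Q \<Longrightarrow> limitin j1_topology (\<lambda>n. G n \<omega>) (G' \<omega>) sequentially"
  shows "(\<lambda>n. LINT \<omega>|Q. f (G n \<omega>)) \<longlonglongrightarrow> (LINT \<omega>|Q. f (G' \<omega>))"
    and "openin j1_topology S \<Longrightarrow> 0 < e \<Longrightarrow> \<forall>\<^sub>F n in sequentially.
      measure Q {\<omega> \<in> space Q. G n \<omega> \<notin> S} \<le> measure Q {\<omega> \<in> space Q. G' \<omega> \<notin> S} + e"
proof -
  interpret prob_space Q by fact
  have mf: "(\<lambda>\<omega>. f (g \<omega>)) \<in> borel_measurable Q" if "g \<in> Q \<rightarrow>\<^sub>M borel_of j1_topology" for g
    by (rule measurable_compose[OF that continuous_map_borel_measurable[OF f]])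
  show "(\<lambda>n. LINT \<omega>|Q. f (G n \<omega>)) \<longlonglongrightarrow> (LINT \<omega>|Q. f (G' \<omega>))"
  proof (rule integral_dominated_convergence[where w = "\<lambda>_. B"])
    show "AE \<omega> in Q. (\<lambda>n. f (G n \<omega>)) \<longlonglongrightarrow> f (G' \<omega>)"
      by (intro AE_I2 continuous_map_limitin_real[OF f lim])
    show "AE \<omega> in Q. norm (f (G n \<omega>)) \<le> B" for n
    proof (rule AE_I2)
      fix \<omega> assume "\<omega> \<in> space Q"
      from measurable_space[OF G this, of n] show "norm (f (G n \<omega>)) \<le> B" using B by simp
    qed
  qed (simp_all add: mf G G')
  assume S: "openin j1_topology S" and "0 < e"
  have ms: "{\<omega> \<in> space Q. g \<omega> \<in> S} \<in> sets Q" if "g \<in> Q \<rightarrow>\<^sub>M borel_of j1_topology" for g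
    using measurable_sets[OF that sets_borel_of_openin[OF S]] by (simp add: vimage_def Int_def conj_commute)
  have ms': "{\<omega> \<in> space Q. g \<omega> \<notin> S} \<in> sets Q" if "g \<in> Q \<rightarrow>\<^sub>M borel_of j1_topology" for g
  proof -
    have "{\<omega> \<in> space Q. g \<omega> \<notin> S} = space Q - {\<omega> \<in> space Q. g \<omega> \<in> S}" by blast
    then show ?thesis using ms[OF that] by simp
  qed
  define E where "E n = {\<omega> \<in> space Q. G' \<omega> \<in> S} \<inter> {\<omega> \<in> space Q. G n \<omega> \<notin> S}" for n
  have E: "E n \<in> sets Q" for n unfolding E_def using ms[OF G'] ms'[OF G] by blast
  have "(\<lambda>n. LINT \<omega>|Q. indicator (E n) \<omega>) \<longlonglongrightarrow> (LINT \<omega>|Q. (0::real))"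
  proof (rule integral_dominated_convergence[where w = "\<lambda>_. 1"])
    show "AE \<omega> in Q. (\<lambda>n. indicator (E n) \<omega>) \<longlonglongrightarrow> (0::real)"
    proof (rule AE_I2, rule tendsto_eventually)
      fix \<omega> assume \<omega>: "\<omega> \<in> space Q"
      show "\<forall>\<^sub>F n in sequentially. indicator (E n) \<omega> = (0::real)"
      proof (cases "G' \<omega> \<in> S")
        case True
        then have "\<forall>\<^sub>F n in sequentially. G n \<omega> \<in> S"
          using lim[OF \<omega>] S by (simp add: limitin_def)
        then show ?thesis by eventually_elim (simp add: E_def)
      qed (simp add: E_def)
    qed
  qed (use E in \<open>auto simp: indicator_def\<close>)
  then have "(\<lambda>n. measure Q (E n)) \<longlonglongrightarrow> 0" using E by simp
  then have "\<forall>\<^sub>F n in sequentially. measure Q (E n) < e" using \<open>0 < e\<close> by (rule order_tendstoD(2))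
  then show "\<forall>\<^sub>F n in sequentially.
      measure Q {\<omega> \<in> space Q. G n \<omega> \<notin> S} \<le> measure Q {\<omega> \<in> space Q. G' \<omega> \<notin> S} + e"
  proof eventually_elim
    case (elim n)
    have "measure Q {\<omega> \<in> space Q. G n \<omega> \<notin> S} \<le> measure Q ({\<omega> \<in> space Q. G' \<omega> \<notin> S} \<union> E n)"
      using E[of n] ms'[OF G'] by (intro finite_measure_mono) (auto simp: E_def)
    also have "\<dots> \<le> measure Q {\<omega> \<in> space Q. G' \<omega> \<notin> S} + measure Q (E n)"
      by (intro measure_Un_le E ms' G')
    finally show ?case using elim by simp
  qed
qed

text \<open>The chain leads from \<open>Y n\<close> to \<open>A m n\<close>, equal in law to
  \<open>G n\<close>, then to \<open>G'\<close>, equal in law to \<open>A' m\<close>, and finally to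
  \<open>\<eta>\<close>. The index \<open>k\<close> of the stable set is fixed first, from the law
  of \<open>\<eta>\<close>, then \<open>m\<close>, then \<open>n\<close>; the bound on the
  probability of missing the stable set travels the same chain backwards to \<open>A m n\<close>,
  where \<open>f\<close> is compared with its value at \<open>Y n\<close>.\<close>

lemma weak_limit_by_approximation:
  fixes P :: "'w measure" and N :: "'v measure" and f :: "(real \<Rightarrow> real) \<Rightarrow> real"
  assumes P: "prob_space P" and N: "prob_space N"
    and f: "continuous_map j1_topology euclideanreal f" and B: "\<And>x. x \<in> skorohod_space \<Longrightarrow> \<bar>f x\<bar> \<le> B"
    and Y: "\<And>n. Y n \<in> P \<rightarrow>\<^sub>M borel_of j1_topology"
    and A: "\<And>m n. A m n \<in> P \<rightarrow>\<^sub>M borel_of j1_topology"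
    and \<eta>: "\<eta> \<in> N \<rightarrow>\<^sub>M borel_of j1_topology"
    and A': "\<And>m. A' m \<in> N \<rightarrow>\<^sub>M borel_of j1_topology"
    and lim: "\<And>\<omega>. \<omega> \<in> space N \<Longrightarrow> limitin j1_topology (\<lambda>m. A' m \<omega>) (\<eta> \<omega>) sequentially"
    and coupling: "\<And>m. \<exists>(Q :: 'c measure) G G'. prob_space Q \<and> (\<forall>n. G n \<in> Q \<rightarrow>\<^sub>M borel_of j1_topology) \<and>
      G' \<in> Q \<rightarrow>\<^sub>M borel_of j1_topology \<and>
      (\<forall>n. distr Q (borel_of j1_topology) (G n) = distr P (borel_of j1_topology) (A m n)) \<and>
      distr Q (borel_of j1_topology) G' = distr N (borel_of j1_topology) (A' m) \<and>
      (\<forall>\<omega>\<in>space Q. limitin j1_topology (\<lambda>n. G n \<omega>) (G' \<omega>) sequentially)"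
    and close: "\<And>d e. 0 < d \<Longrightarrow> 0 < e \<Longrightarrow> \<forall>\<^sub>F m in sequentially. \<forall>\<^sub>F n in sequentially.
      \<exists>Z\<in>sets P. measure P Z \<le> e \<and> (\<forall>\<omega>\<in>space P - Z. Y n \<omega> \<in> j1_nhd d (A m n \<omega>))"
  shows "(\<lambda>n. LINT \<omega>|P. f (Y n \<omega>)) \<longlonglongrightarrow> (LINT \<omega>|N. f (\<eta> \<omega>))"
proof (rule LIMSEQ_I)
  fix r :: real assume "0 < r"
  interpret P: prob_space P by fact
  interpret N: prob_space N by fact
  have "grid_path 1 0 (\<lambda>_. 0) \<in> skorohod_space" by (rule skorohod_grid_path) simp
  from B[OF this] have "0 \<le> B" by linarith
  \<comment> \<open>Three errors of size \<open>e\<close>, and an oscillation of at most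
    \<open>2 * B\<close> on an exceptional set of probability at most \<open>4 * e\<close>: one
    \<open>e\<close> for missing the stable set in the limit, one for each of the two passages to a
    limit, one for \<open>Z\<close>.\<close>
  define e where "e = r / (2 * (3 + 8 * B))"
  have "c * (r / (2 * c)) = r / 2" if "c \<noteq> 0" for c :: real using that by simp
  from this[of "3 + 8 * B"] have "(3 + 8 * B) * e = r / 2" using \<open>0 \<le> B\<close> by (simp only: e_def)
  then have e: "0 < e" "(3 + 8 * B) * e < r"
    using \<open>0 < r\<close> \<open>0 \<le> B\<close> by (simp_all add: e_def)
  note cmf = continuous_map_borel_measurable[OF f]
  define S where "S = stable_set f e"
  have S: "openin j1_topology (S k)" for k by (simp add: S_def openin_stable_set)
  have sets: "{\<omega> \<in> space M. g \<omega> \<in> S k} \<in> sets M" if "g \<in> M \<rightarrow>\<^sub>M borel_of j1_topology" for g k and M :: "'z measure"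
    using measurable_sets[OF that sets_borel_of_openin[OF S]] by (simp add: vimage_def Int_def conj_commute)
  have compl: "{\<omega> \<in> space M. g \<omega> \<notin> S k} = space M - {\<omega> \<in> space M. g \<omega> \<in> S k}" for g k and M :: "'z measure" by blast
  have "(\<lambda>k. measure N {\<omega> \<in> space N. \<eta> \<omega> \<in> S k}) \<longlonglongrightarrow> measure N (\<Union>k. {\<omega> \<in> space N. \<eta> \<omega> \<in> S k})"
  proof (rule N.finite_Lim_measure_incseq)
    show "incseq (\<lambda>k. {\<omega> \<in> space N. \<eta> \<omega> \<in> S k})"
      unfolding incseq_def S_def using stable_set_mono by blast
  qed (use sets[OF \<eta>] in blast)
  also have "(\<Union>k. {\<omega> \<in> space N. \<eta> \<omega> \<in> S k}) = space N"
    using measurable_space[OF \<eta>] stable_set_exhausts[OF f e(1)] unfolding S_def by auto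
  finally have "(\<lambda>k. measure N {\<omega> \<in> space N. \<eta> \<omega> \<in> S k}) \<longlonglongrightarrow> 1" by (simp add: N.prob_space)
  then have "\<forall>\<^sub>F k in sequentially. 1 - e < measure N {\<omega> \<in> space N. \<eta> \<omega> \<in> S k}"
    using e by (intro order_tendstoD(1)) auto
  then obtain k where k: "1 - e < measure N {\<omega> \<in> space N. \<eta> \<omega> \<in> S k}"
    using eventually_happens by fastforce
  have \<eta>S: "measure N {\<omega> \<in> space N. \<eta> \<omega> \<notin> S k} \<le> e"
    unfolding compl using k by (subst N.prob_compl[OF sets[OF \<eta>]]) simp
  have limN1: "(\<lambda>m. LINT \<omega>|N. f (A' m \<omega>)) \<longlonglongrightarrow> (LINT \<omega>|N. f (\<eta> \<omega>))"
    by (rule weak_limit_pointwise(1)[OF N f B A' \<eta> lim])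
  have limN2: "\<forall>\<^sub>F m in sequentially.
      measure N {\<omega> \<in> space N. A' m \<omega> \<notin> S k} \<le> measure N {\<omega> \<in> space N. \<eta> \<omega> \<notin> S k} + e"
    by (rule weak_limit_pointwise(2)[OF N f B A' \<eta> lim S e(1)])
  have "\<forall>\<^sub>F m in sequentially. \<bar>(LINT \<omega>|N. f (A' m \<omega>)) - (LINT \<omega>|N. f (\<eta> \<omega>))\<bar> < e"
    using tendstoD[OF limN1 e(1)] by (simp add: dist_real_def)
  moreover note limN2
  moreover have "\<forall>\<^sub>F m in sequentially. \<forall>\<^sub>F n in sequentially.
      \<exists>Z\<in>sets P. measure P Z \<le> e \<and> (\<forall>\<omega>\<in>space P - Z. Y n \<omega> \<in> j1_nhd (1 / real (Suc k)) (A m n \<omega>))"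
    by (rule close) (use e in simp_all)
  ultimately have "\<forall>\<^sub>F m in sequentially. \<bar>(LINT \<omega>|N. f (A' m \<omega>)) - (LINT \<omega>|N. f (\<eta> \<omega>))\<bar> < e \<and>
    measure N {\<omega> \<in> space N. A' m \<omega> \<notin> S k} \<le> measure N {\<omega> \<in> space N. \<eta> \<omega> \<notin> S k} + e \<and>
    (\<forall>\<^sub>F n in sequentially. \<exists>Z\<in>sets P. measure P Z \<le> e \<and> (\<forall>\<omega>\<in>space P - Z. Y n \<omega> \<in> j1_nhd (1 / real (Suc k)) (A m n \<omega>)))"
    by eventually_elim blast
  then obtain m where m: "\<bar>(LINT \<omega>|N. f (A' m \<omega>)) - (LINT \<omega>|N. f (\<eta> \<omega>))\<bar> < e"
    "measure N {\<omega> \<in> space N. A' m \<omega> \<notin> S k} \<le> measure N {\<omega> \<in> space N. \<eta> \<omega> \<notin> S k} + e"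
    "\<forall>\<^sub>F n in sequentially. \<exists>Z\<in>sets P. measure P Z \<le> e \<and> (\<forall>\<omega>\<in>space P - Z. Y n \<omega> \<in> j1_nhd (1 / real (Suc k)) (A m n \<omega>))"
    using eventually_happens[of _ "sequentially :: nat filter"] by auto
  obtain Q :: "'c measure" and G G' where c: "prob_space Q \<and> (\<forall>n. G n \<in> Q \<rightarrow>\<^sub>M borel_of j1_topology) \<and>
      G' \<in> Q \<rightarrow>\<^sub>M borel_of j1_topology \<and>
      (\<forall>n. distr Q (borel_of j1_topology) (G n) = distr P (borel_of j1_topology) (A m n)) \<and>
      distr Q (borel_of j1_topology) G' = distr N (borel_of j1_topology) (A' m) \<and>
      (\<forall>\<omega>\<in>space Q. limitin j1_topology (\<lambda>n. G n \<omega>) (G' \<omega>) sequentially)"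
    using coupling[of m] by (elim exE)
  then have Q: "prob_space Q" and G: "\<And>n. G n \<in> Q \<rightarrow>\<^sub>M borel_of j1_topology"
    and G': "G' \<in> Q \<rightarrow>\<^sub>M borel_of j1_topology"
    and dG: "\<And>n. distr Q (borel_of j1_topology) (G n) = distr P (borel_of j1_topology) (A m n)"
    and dG': "distr Q (borel_of j1_topology) G' = distr N (borel_of j1_topology) (A' m)"
    and limG: "\<And>\<omega>. \<omega> \<in> space Q \<Longrightarrow> limitin j1_topology (\<lambda>n. G n \<omega>) (G' \<omega>) sequentially"
    by simp_all
  have limQ1: "(\<lambda>n. LINT \<omega>|Q. f (G n \<omega>)) \<longlonglongrightarrow> (LINT \<omega>|Q. f (G' \<omega>))"
    by (rule weak_limit_pointwise(1)[OF Q f B G G' limG])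
  have limQ2: "\<forall>\<^sub>F n in sequentially.
      measure Q {\<omega> \<in> space Q. G n \<omega> \<notin> S k} \<le> measure Q {\<omega> \<in> space Q. G' \<omega> \<notin> S k} + e"
    by (rule weak_limit_pointwise(2)[OF Q f B G G' limG S e(1)])
  have Gint: "(LINT \<omega>|Q. f (G n \<omega>)) = (LINT \<omega>|P. f (A m n \<omega>))" for n
    using integral_distr[OF G[of n] cmf] integral_distr[OF A[of m n] cmf] dG[of n] by simp
  have G'int: "(LINT \<omega>|Q. f (G' \<omega>)) = (LINT \<omega>|N. f (A' m \<omega>))"
    using integral_distr[OF G' cmf] integral_distr[OF A'[of m] cmf] dG' by simp
  have vimS: "g -` (skorohod_space - S k) \<inter> space M = {\<omega> \<in> space M. g \<omega> \<notin> S k}"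
    if "g \<in> M \<rightarrow>\<^sub>M borel_of j1_topology" for g and M :: "'z measure"
    using measurable_space[OF that] by auto
  have Sk: "skorohod_space - S k \<in> sets (borel_of j1_topology)"
    using sets.compl_sets[OF sets_borel_of_openin[OF S[of k]]] by simp
  have GS: "measure Q {\<omega> \<in> space Q. G n \<omega> \<notin> S k} = measure P {\<omega> \<in> space P. A m n \<omega> \<notin> S k}" for n
    using measure_distr[OF G[of n] Sk] measure_distr[OF A[of m n] Sk] dG[of n] vimS[OF G[of n]] vimS[OF A[of m n]] by simp
  have G'S: "measure Q {\<omega> \<in> space Q. G' \<omega> \<notin> S k} = measure N {\<omega> \<in> space N. A' m \<omega> \<notin> S k}"
    using measure_distr[OF G' Sk] measure_distr[OF A'[of m] Sk] dG' vimS[OF G'] vimS[OF A'[of m]] by simp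
  have "\<forall>\<^sub>F n in sequentially. \<bar>(LINT \<omega>|P. f (A m n \<omega>)) - (LINT \<omega>|N. f (A' m \<omega>))\<bar> < e"
    using tendstoD[OF limQ1 e(1)] by (simp add: dist_real_def Gint G'int)
  moreover have "\<forall>\<^sub>F n in sequentially. measure P {\<omega> \<in> space P. A m n \<omega> \<notin> S k} \<le> 3 * e"
    using limQ2 unfolding GS G'S by eventually_elim (use m(2) \<eta>S in linarith)
  ultimately have "\<forall>\<^sub>F n in sequentially. norm ((LINT \<omega>|P. f (Y n \<omega>)) - (LINT \<omega>|N. f (\<eta> \<omega>))) < r"
    using m(3)
  proof eventually_elim
    case (elim n)
    obtain Z where Z: "Z \<in> sets P" "measure P Z \<le> e" "\<And>\<omega>. \<omega> \<in> space P - Z \<Longrightarrow> Y n \<omega> \<in> j1_nhd (1 / real (Suc k)) (A m n \<omega>)"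
      using elim(3) by blast
    define W where "W = {\<omega> \<in> space P. A m n \<omega> \<notin> S k} \<union> Z"
    have W1: "{\<omega> \<in> space P. A m n \<omega> \<notin> S k} \<in> sets P" unfolding compl using sets[OF A] by simp
    then have W: "W \<in> sets P" unfolding W_def using Z(1) by blast
    have mW: "measure P W \<le> 4 * e"
      unfolding W_def using measure_Un_le[OF W1 Z(1)] elim(2) Z(2) by linarith
    have in_D: "Y n \<omega> \<in> skorohod_space" "A m n \<omega> \<in> skorohod_space" if "\<omega> \<in> space P" for \<omega>
      using measurable_space[OF Y that] measurable_space[OF A that] by simp_all
    have int: "integrable P (\<lambda>\<omega>. f (g \<omega>))" if "g \<in> P \<rightarrow>\<^sub>M borel_of j1_topology" for g
    proof (rule P.integrable_const_bound[where B = B])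
      show "AE \<omega> in P. norm (f (g \<omega>)) \<le> B" using measurable_space[OF that] B by (intro AE_I2) simp
    qed (rule measurable_compose[OF that cmf])
    have pw: "\<bar>f (Y n \<omega>) - f (A m n \<omega>)\<bar> \<le> e + 2 * B * indicator W \<omega>" if \<omega>: "\<omega> \<in> space P" for \<omega>
    proof (cases "\<omega> \<in> W")
      case True
      then show ?thesis using B[OF in_D(1)[OF \<omega>]] B[OF in_D(2)[OF \<omega>]] e by simp
    next
      case False
      then have "A m n \<omega> \<in> stable_set f e k" "Y n \<omega> \<in> j1_nhd (1 / real (Suc k)) (A m n \<omega>)"
        using Z(3)[of \<omega>] \<omega> by (auto simp: W_def S_def)
      from stable_setD[OF this] show ?thesis using False by simp
    qed
    have intW: "integrable P (\<lambda>\<omega>. e + 2 * B * indicator W \<omega>)"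
      using W by (intro Bochner_Integration.integrable_add integrable_mult_right) (auto simp: less_top[symmetric])
    have "\<bar>(LINT \<omega>|P. f (Y n \<omega>)) - (LINT \<omega>|P. f (A m n \<omega>))\<bar> = \<bar>LINT \<omega>|P. f (Y n \<omega>) - f (A m n \<omega>)\<bar>"
      using int[OF Y] int[OF A] by simp
    also have "\<dots> \<le> (LINT \<omega>|P. \<bar>f (Y n \<omega>) - f (A m n \<omega>)\<bar>)"
      by (rule integral_abs_bound)
    also have "\<dots> \<le> (LINT \<omega>|P. e + 2 * B * indicator W \<omega>)"
      using pw int[OF Y] int[OF A] intW by (intro integral_mono) auto
    also have "\<dots> = e + 2 * B * measure P W"
      using W by (subst Bochner_Integration.integral_add) (auto simp: less_top[symmetric] P.prob_space)
    also have "\<dots> \<le> e + 2 * B * (4 * e)" using mW \<open>0 \<le> B\<close> by (intro add_left_mono mult_left_mono) auto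
    finally show ?case using elim(1) m(1) e(2) by (simp add: algebra_simps)
  qed
  then show "\<exists>n0. \<forall>n\<ge>n0. norm ((LINT \<omega>|P. f (Y n \<omega>)) - (LINT \<omega>|N. f (\<eta> \<omega>))) < r"
    by (simp add: eventually_sequentially)
qed

section \<open>The conditions on the small-time behaviour\<close>

locale subordinator = prob_space P
  for P :: "'w measure" and X :: "real \<Rightarrow> 'w \<Rightarrow> real" and \<nu> :: "real measure" +
  assumes X: "pure_jump_subordinator P X \<nu>"
begin

abbreviation \<phi> :: "real \<Rightarrow> real" where "\<phi> \<equiv> laplace_exponent \<nu>"

definition G :: "real \<Rightarrow> real \<Rightarrow> real" where "G t x = prob {\<omega> \<in> space P. X t \<omega> \<le> x}"

lemma levy: "levy_process P X"
  using X by (simp add: pure_jump_subordinator_def)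

lemma measurable_X [measurable]: "0 \<le> t \<Longrightarrow> X t \<in> borel_measurable P"
  using levy by (simp add: levy_process_def)

lemma X_nonneg: "0 \<le> t \<Longrightarrow> AE \<omega> in P. 0 \<le> X t \<omega>"
proof -
  assume "0 \<le> t"
  have "AE \<omega> in P. X 0 \<omega> = 0" "AE \<omega> in P. mono_on {0..} (\<lambda>t. X t \<omega>)"
    using X levy by (simp_all add: pure_jump_subordinator_def levy_process_def)
  then show ?thesis
  proof eventually_elim
    case (elim \<omega>)
    then show ?case using \<open>0 \<le> t\<close> monotone_onD[OF elim(2), of 0 t] by simp
  qed
qed

lemma laplace: "0 \<le> t \<Longrightarrow> 0 \<le> u \<Longrightarrow> (LINT \<omega>|P. exp (- u * X t \<omega>)) = exp (- t * \<phi> u)"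
  using X by (simp add: pure_jump_subordinator_def)

lemma G_bounds: "0 \<le> G t x" "G t x \<le> 1"
  by (auto simp: G_def)

lemma integrable_exp: "0 \<le> t \<Longrightarrow> 0 \<le> u \<Longrightarrow> integrable P (\<lambda>\<omega>. exp (- u * X t \<omega>))"
proof (rule integrable_const_bound[where B = 1])
  assume t: "0 \<le> t" and u: "0 \<le> u"
  show "AE \<omega> in P. norm (exp (- u * X t \<omega>)) \<le> 1"
    using X_nonneg[OF t] by eventually_elim (use u in simp)
  show "(\<lambda>\<omega>. exp (- u * X t \<omega>)) \<in> borel_measurable P" using t by measurable
qed

section \<open>Distribution function against Laplace transform\<close>

lemma laplace_le_G:
  assumes "0 \<le> t" "0 \<le> u"
  shows "exp (- t * \<phi> u) \<le> G t x + exp (- u * x)"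
proof -
  have [measurable]: "{\<omega> \<in> space P. X t \<omega> \<le> x} \<in> events" using assms by measurable
  have "exp (- t * \<phi> u) = (LINT \<omega>|P. exp (- u * X t \<omega>))" using laplace[OF assms] by simp
  also have "\<dots> \<le> (LINT \<omega>|P. indicator {\<omega> \<in> space P. X t \<omega> \<le> x} \<omega> + exp (- u * x))"
  proof (rule integral_mono_AE[OF integrable_exp[OF assms]])
    show "integrable P (\<lambda>\<omega>. indicator {\<omega> \<in> space P. X t \<omega> \<le> x} \<omega> + exp (- u * x))"
      by (intro Bochner_Integration.integrable_add) (auto simp: less_top[symmetric])
    show "AE \<omega> in P. exp (- u * X t \<omega>) \<le> indicator {\<omega> \<in> space P. X t \<omega> \<le> x} \<omega> + exp (- u * x)"
      using X_nonneg[OF assms(1)] AE_space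
    proof eventually_elim
      case (elim \<omega>)
      then have "exp (- u * X t \<omega>) \<le> 1" using assms(2) by simp
      moreover have "exp (- u * X t \<omega>) \<le> exp (- u * x)" if "x < X t \<omega>"
        using that assms(2) by (simp add: mult_left_mono)
      ultimately show ?case
        using elim by (auto simp: indicator_def add_increasing2)
    qed
  qed
  also have "\<dots> = G t x + exp (- u * x)"
    by (subst Bochner_Integration.integral_add) (auto simp: G_def less_top[symmetric] prob_space)
  finally show ?thesis .
qed

lemma G_le_laplace:
  assumes "0 \<le> t" "0 \<le> u"
  shows "exp (- u * x) * G t x \<le> exp (- t * \<phi> u)"
proof -
  have [measurable]: "{\<omega> \<in> space P. X t \<omega> \<le> x} \<in> events" using assms by measurable
  have "exp (- u * x) * G t x = (LINT \<omega>|P. exp (- u * x) * indicator {\<omega> \<in> space P. X t \<omega> \<le> x} \<omega>)"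
    by (simp add: G_def)
  also have "\<dots> \<le> (LINT \<omega>|P. exp (- u * X t \<omega>))"
  proof (rule integral_mono[OF _ integrable_exp[OF assms]])
    show "integrable P (\<lambda>\<omega>. exp (- u * x) * indicator {\<omega> \<in> space P. X t \<omega> \<le> x} \<omega>)"
      by (intro integrable_mult_right) (auto simp: less_top[symmetric])
    show "exp (- u * x) * indicator {\<omega> \<in> space P. X t \<omega> \<le> x} \<omega> \<le> exp (- u * X t \<omega>)" for \<omega>
      using assms(2) by (auto simp: indicator_def mult_left_mono)
  qed
  also have "\<dots> = exp (- t * \<phi> u)" by (rule laplace[OF assms])
  finally show ?thesis .
qed

text \<open>The product of the two arguments is \<open>exp (d / t)\<close>, which explodes as
  \<open>t\<close> tends to 0; in the companion bound it is \<open>exp (- d / t)\<close>, which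
  vanishes. Hence any slack \<open>d > 0\<close> makes the error disappear in the limit.\<close>

lemma laplace_le_G_scaled:
  assumes "0 < t"
  shows "exp (- t * \<phi> (exp (v / t))) \<le> G t (exp (- (v - d) / t)) + exp (- exp (d / t))"
proof -
  have "exp (v / t) * exp (- (v - d) / t) = exp (d / t)"
    by (simp add: exp_add[symmetric] add_divide_distrib[symmetric])
  then show ?thesis using laplace_le_G[of t "exp (v / t)" "exp (- (v - d) / t)"] assms by simp
qed

lemma G_le_laplace_scaled:
  assumes "0 < t"
  shows "exp (- exp (- d / t)) * G t (exp (- (v + d) / t)) \<le> exp (- t * \<phi> (exp (v / t)))"
proof -
  have "exp (v / t) * exp (- (v + d) / t) = exp (- d / t)"
    by (simp add: exp_add[symmetric] add_divide_distrib[symmetric] diff_divide_distrib[symmetric])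
  then show ?thesis using G_le_laplace[of t "exp (v / t)" "exp (- (v + d) / t)"] assms by simp
qed

end

lemma exp_small_time_limits:
  fixes d :: real
  assumes "0 < d"
  shows "((\<lambda>t. exp (- exp (d / t))) \<longlongrightarrow> 0) (at_right 0)"
    and "((\<lambda>t. exp (- exp (- d / t))) \<longlongrightarrow> 1) (at_right 0)"
    and "((\<lambda>t. exp (exp (- d / t))) \<longlongrightarrow> 1) (at_right 0)"
  using assms by real_asymp+

lemma at_right_ex:
  fixes f :: "real \<Rightarrow> real"
  assumes "(f \<longlongrightarrow> L) (at_right 0)" "0 < c"
  shows "a < L \<Longrightarrow> \<exists>d>0. d < c \<and> a < f d" and "L < a \<Longrightarrow> \<exists>d>0. d < c \<and> f d < a"
proof -
  have c: "\<forall>\<^sub>F d in at_right 0. 0 < d \<and> d < c"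
    using eventually_at_right_real[OF assms(2)] by eventually_elim auto
  show "\<exists>d>0. d < c \<and> a < f d" if "a < L"
    using eventually_happens[OF eventually_conj[OF c order_tendstoD(1)[OF assms(1) that]]] by auto
  show "\<exists>d>0. d < c \<and> f d < a" if "L < a"
    using eventually_happens[OF eventually_conj[OF c order_tendstoD(2)[OF assms(1) that]]] by auto
qed

context subordinator
begin

section \<open>From the growth of \<open>\<phi>\<close> to small-time limits and back\<close>

lemma S5_imp_laplace_limit:
  assumes S5: "cond_S5 \<nu> \<gamma>" and "0 < v"
  shows "((\<lambda>t. exp (- t * \<phi> (exp (v / t)))) \<longlongrightarrow> exp (- \<gamma> * v)) (at_right 0)"
proof -
  have "filterlim (\<lambda>t. exp (v / t)) at_top (at_right 0)"
    using \<open>0 < v\<close> by real_asymp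
  from filterlim_compose[OF S5[unfolded cond_S5_def] this]
  have "((\<lambda>t. \<phi> (exp (v / t)) / (v / t)) \<longlongrightarrow> \<gamma>) (at_right 0)" by simp
  then have "((\<lambda>t. exp (- (\<phi> (exp (v / t)) / (v / t)) * v)) \<longlongrightarrow> exp (- \<gamma> * v)) (at_right 0)"
    by (intro tendsto_intros)
  moreover have "\<forall>\<^sub>F t in at_right 0. exp (- (\<phi> (exp (v / t)) / (v / t)) * v) = exp (- t * \<phi> (exp (v / t)))"
    using eventually_at_right_less[of "0::real"] by eventually_elim (use \<open>0 < v\<close> in simp)
  ultimately show ?thesis by (rule Lim_transform_eventually)
qed

text \<open>A sandwich between the Laplace limits at \<open>v + d\<close> and \<open>v - d\<close>;
  continuity of \<open>exp (- \<gamma> * v)\<close> in \<open>v\<close> then removes the slack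
  \<open>d\<close>.\<close>

lemma S5_imp_tail:
  assumes S5: "cond_S5 \<nu> \<gamma>" and "0 < v"
  shows "((\<lambda>t. G t (exp (- v / t))) \<longlongrightarrow> exp (- \<gamma> * v)) (at_right 0)"
proof (rule order_tendstoI)
  have pos: "\<forall>\<^sub>F t in at_right 0. (0::real) < t" by (rule eventually_at_right_less)
  have shift: "((\<lambda>d. exp (- \<gamma> * (v + d))) \<longlongrightarrow> exp (- \<gamma> * (v + 0))) (at_right 0)"
    "((\<lambda>d. exp (- \<gamma> * (v - d))) \<longlongrightarrow> exp (- \<gamma> * (v - 0))) (at_right 0)"
    by (intro tendsto_intros)+
  fix a
  {
    assume "a < exp (- \<gamma> * v)"
    then obtain d where d: "0 < d" "a < exp (- \<gamma> * (v + d))"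
      using at_right_ex(1)[OF shift(1) zero_less_one, of a] by auto
    have "((\<lambda>t. exp (- t * \<phi> (exp ((v + d) / t))) - exp (- exp (d / t))) \<longlongrightarrow> exp (- \<gamma> * (v + d)) - 0) (at_right 0)"
      using d \<open>0 < v\<close> by (intro tendsto_diff S5_imp_laplace_limit[OF S5] exp_small_time_limits) auto
    then have "\<forall>\<^sub>F t in at_right 0. a < exp (- t * \<phi> (exp ((v + d) / t))) - exp (- exp (d / t))"
      using d by (intro order_tendstoD(1)) auto
    then show "\<forall>\<^sub>F t in at_right 0. a < G t (exp (- v / t))"
      using pos
    proof eventually_elim
      case (elim t)
      then show ?case using laplace_le_G_scaled[of t "v + d" d] by simp
    qed
  next
    assume "exp (- \<gamma> * v) < a"
    then obtain d where d: "0 < d" "d < v" "exp (- \<gamma> * (v - d)) < a"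
      using at_right_ex(2)[OF shift(2) \<open>0 < v\<close>, of a] by auto
    have "((\<lambda>t. exp (- t * \<phi> (exp ((v - d) / t))) * exp (exp (- d / t))) \<longlongrightarrow> exp (- \<gamma> * (v - d)) * 1) (at_right 0)"
      using d by (intro tendsto_mult S5_imp_laplace_limit[OF S5] exp_small_time_limits) auto
    then have "\<forall>\<^sub>F t in at_right 0. exp (- t * \<phi> (exp ((v - d) / t))) * exp (exp (- d / t)) < a"
      using d by (intro order_tendstoD(2)) auto
    then show "\<forall>\<^sub>F t in at_right 0. G t (exp (- v / t)) < a"
      using pos
    proof eventually_elim
      case (elim t)
      have "exp (exp (- d / t)) * (exp (- exp (- d / t)) * G t (exp (- v / t))) \<le> exp (exp (- d / t)) * exp (- t * \<phi> (exp ((v - d) / t)))"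
        using G_le_laplace_scaled[of t d "v - d"] elim by (intro mult_left_mono) simp_all
      then show ?case using elim by (simp add: mult.assoc[symmetric] exp_add[symmetric] mult.commute)
    qed
  }
qed

text \<open>
  Only points \<open>v\<close> without mass are usable, and there are enough of them; \<open>q = 0\<close> and \<open>q = 1\<close> would put
  the mass of \<open>\<mu>\<close> at \<open>0\<close> and at infinity.
\<close>

lemma laplace_limit_imp_S5:
  assumes "real_distribution \<mu>" and pos: "AE x in \<mu>. 0 < x"
    and lim: "\<And>v. 0 < v \<Longrightarrow> measure \<mu> {v} = 0 \<Longrightarrow>
      ((\<lambda>t. exp (- t * \<phi> (exp (v / t)))) \<longlongrightarrow> measure \<mu> {v<..}) (at_right 0)"
  shows "\<exists>\<gamma>>0. cond_S5 \<nu> \<gamma> \<and> (\<forall>v>0. measure \<mu> {v} = 0 \<longrightarrow> measure \<mu> {v<..} = exp (- \<gamma> * v))"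
proof -
  interpret \<mu>: real_distribution \<mu> by fact
  \<comment> \<open>Atoms are countable, so every open interval contains a usable point.\<close>
  have ex: "\<exists>v. a < v \<and> v < b \<and> measure \<mu> {v} = 0" if "a < b" for a b :: real
  proof (rule ccontr)
    assume "\<not> ?thesis"
    then have "{a<..<b} \<subseteq> {v. measure \<mu> {v} > 0}" by (auto simp: less_le)
    then have "countable {a<..<b}" using \<mu>.countable_atoms countable_subset by blast
    then show False using uncountable_open_interval[of a b] that by simp
  qed
  define H where "H v = measure \<mu> {v<..}" for v
  \<comment> \<open>Substituting \<open>t = v / r\<close> and taking the \<open>v\<close>-th root
    leaves an expression free of \<open>v\<close>, so its limit is the same for all usable
    \<open>v\<close>.\<close>
  have q: "((\<lambda>r. exp (- (\<phi> (exp r) / r))) \<longlongrightarrow> H v powr (1 / v)) at_top" if v: "0 < v" "measure \<mu> {v} = 0" for v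
  proof -
    have "filterlim (\<lambda>r. v / r) (at_right 0) at_top" using v(1) by real_asymp
    from filterlim_compose[OF lim[OF v] this]
    have "((\<lambda>r. exp (- (v / r) * \<phi> (exp (v / (v / r))))) \<longlongrightarrow> H v) at_top" by (simp add: H_def)
    then have "((\<lambda>r. exp (- (v / r) * \<phi> (exp (v / (v / r)))) powr (1 / v)) \<longlongrightarrow> H v powr (1 / v)) at_top"
      by (rule tendsto_powr2) (use v in \<open>auto intro!: always_eventually\<close>)
    moreover have "\<forall>\<^sub>F r in at_top. exp (- (v / r) * \<phi> (exp (v / (v / r)))) powr (1 / v) = exp (- (\<phi> (exp r) / r))"
      using eventually_gt_at_top[of "0::real"] by eventually_elim (use v in \<open>simp add: exp_powr_real\<close>)
    ultimately show ?thesis by (rule Lim_transform_eventually)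
  qed
  obtain v0 where v0: "0 < v0" "measure \<mu> {v0} = 0" using ex[of 0 1] by auto
  define p where "p = H v0 powr (1 / v0)"
  have H: "H v = p powr v" if v: "0 < v" "measure \<mu> {v} = 0" for v
  proof -
    have "H v powr (1 / v) = p"
      unfolding p_def by (rule tendsto_unique[OF _ q[OF v] q[OF v0]]) simp
    then show ?thesis using v by (auto simp: powr_powr H_def)
  qed
  have H01: "0 \<le> H v" "H v \<le> 1" for v by (auto simp: H_def)
  have p01: "0 \<le> p" "p \<le> 1" using H01[of v0] v0 by (auto simp: p_def powr_le1)
  \<comment> \<open>Usable points tending to 0, and below also to infinity, on which the degenerate
    values of \<open>p\<close> are refuted.\<close>
  have "\<forall>n. \<exists>v. 0 < v \<and> v < 1 / real (Suc n) \<and> measure \<mu> {v} = 0" using ex by simp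
  then obtain w where w: "\<And>n. 0 < w n" "\<And>n. w n < 1 / real (Suc n)" "\<And>n. measure \<mu> {w n} = 0" by metis
  have "\<forall>n. \<exists>v. real (Suc n) < v \<and> v < real (Suc n) + 1 \<and> measure \<mu> {v} = 0" using ex by simp
  then obtain u where u: "\<And>n. real (Suc n) < u n" "\<And>n. measure \<mu> {u n} = 0" by metis
  have u0: "0 < u n" for n using u(1)[of n] by linarith
  have "p \<noteq> 0"
  proof
    assume "p = 0"
    then have "measure \<mu> {w n<..} = 0" for n using H[OF w(1,3)] by (simp add: H_def)
    then have "AE x in \<mu>. x \<notin> {w n<..}" for n by (subst \<mu>.prob_eq_0[symmetric]) auto
    then have "AE x in \<mu>. \<forall>n. x \<notin> {w n<..}" by (subst AE_all_countable) simp
    with pos have "AE x in \<mu>. False"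
    proof eventually_elim
      case (elim x)
      obtain n where "1 / real (Suc n) < x" using nat_approx_posE[OF elim(1)] by blast
      then show False using elim(2) w(2)[of n] by (auto simp: not_less dest!: spec[of _ n])
    qed
    then show False by simp
  qed
  have "p \<noteq> 1"
  proof
    assume "p = 1"
    then have "measure \<mu> {u n<..} = 1" for n using H[OF u0 u(2)] u0 by (simp add: H_def)
    then have "AE x in \<mu>. x \<in> {u n<..}" for n using \<mu>.prob_eq_1[of "{u n<..}"] by simp
    then have "AE x in \<mu>. \<forall>n. x \<in> {u n<..}" by (subst AE_all_countable) simp
    then have "AE x in \<mu>. False"
    proof eventually_elim
      case (elim x)
      obtain n where "x < real n" using reals_Archimedean2 by blast
      then show False using elim[rule_format, of n] u(1)[of n] by simp
    qed
    then show False by simp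
  qed
  define \<gamma> where "\<gamma> = - ln p"
  have p: "0 < p" "p < 1" using p01 \<open>p \<noteq> 0\<close> \<open>p \<noteq> 1\<close> by auto
  then have "0 < \<gamma>" by (simp add: \<gamma>_def)
  have "((\<lambda>r. - ln (exp (- (\<phi> (exp r) / r)))) \<longlongrightarrow> \<gamma>) at_top"
    unfolding \<gamma>_def using q[OF v0] p by (intro tendsto_intros) (auto simp: p_def)
  then have "((\<lambda>r. \<phi> (exp r) / r) \<longlongrightarrow> \<gamma>) at_top" by simp
  from filterlim_compose[OF this ln_at_top] have "((\<lambda>s. \<phi> (exp (ln s)) / ln s) \<longlongrightarrow> \<gamma>) at_top" .
  moreover have "\<forall>\<^sub>F s in at_top. \<phi> (exp (ln s)) / ln s = \<phi> s / ln s"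
    using eventually_gt_at_top[of "0::real"] by eventually_elim simp
  ultimately have "cond_S5 \<nu> \<gamma>" unfolding cond_S5_def by (rule Lim_transform_eventually)
  moreover have "measure \<mu> {v<..} = exp (- \<gamma> * v)" if "0 < v" "measure \<mu> {v} = 0" for v
    using H[OF that] p by (simp add: H_def powr_def \<gamma>_def mult.commute)
  ultimately show ?thesis using \<open>0 < \<gamma>\<close> by blast
qed

end

section \<open>\<open>cond_S5\<close> as a consequence of \<open>cond_S2\<close>,
  \<open>cond_S1\<close>, \<open>cond_S3_S4\<close> and \<open>cond_S6\<close>\<close>

lemma measure_greaterThan_cdf:
  assumes "real_distribution \<mu>"
  shows "measure \<mu> {v<..} = 1 - cdf \<mu> v"
proof -
  interpret real_distribution \<mu> by fact
  have "measure \<mu> (space \<mu> - {..v}) = 1 - measure \<mu> {..v}" by (rule prob_compl) simp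
  moreover have "space \<mu> - {..v} = {v<..}" by auto
  ultimately show ?thesis by (simp add: cdf_def2)
qed

context subordinator
begin

lemma S2_imp_S5:
  assumes "cond_S2 \<nu>"
  shows "\<exists>\<gamma>>0. cond_S5 \<nu> \<gamma>"
proof -
  obtain \<mu> where \<mu>: "real_distribution \<mu>" "AE x in \<mu>. 0 < x" and
    lim: "\<And>u. 0 < u \<Longrightarrow> isCont (cdf (distr \<mu> borel exp)) u \<Longrightarrow>
      ((\<lambda>t. ereal (t * \<phi> (u powr (1 / t)))) \<longlongrightarrow> neg_log (1 - cdf (distr \<mu> borel exp) u)) (at_right 0)"
    using assms unfolding cond_S2_def positive_nondegenerate_law_def Let_def by blast
  interpret \<mu>: real_distribution \<mu> by fact
  interpret E: real_distribution "distr \<mu> borel exp" by (rule \<mu>.real_distribution_distr) simp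
  have "((\<lambda>t. exp (- t * \<phi> (exp (v / t)))) \<longlongrightarrow> measure \<mu> {v<..}) (at_right 0)"
    if v: "0 < v" "measure \<mu> {v} = 0" for v
  proof -
    have "exp -` {exp v} = {v}" "exp -` {..exp v} = {..v}" for v :: real by auto
    then have 1: "measure (distr \<mu> borel exp) {exp v} = measure \<mu> {v}" and
      2: "cdf (distr \<mu> borel exp) (exp v) = cdf \<mu> v"
      by (simp_all add: measure_distr cdf_def2)
    have cont: "isCont (cdf (distr \<mu> borel exp)) (exp v)"
      using E.isCont_cdf[of "exp v"] 1 v(2) by simp
    have lim': "((\<lambda>t. ereal (t * \<phi> (exp (v / t)))) \<longlongrightarrow> neg_log (measure \<mu> {v<..})) (at_right 0)"
      using lim[OF _ cont] by (simp add: 2 measure_greaterThan_cdf[OF \<mu>(1)] exp_powr_real)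
    \<comment> \<open>After exponentiation the value infinity of \<open>neg_log\<close> becomes the
      limit 0, so both cases yield the same formula.\<close>
    show ?thesis
    proof (cases "measure \<mu> {v<..} = 0")
      case True
      then have "filterlim (\<lambda>t. t * \<phi> (exp (v / t))) at_top (at_right 0)"
        using lim' by (simp add: neg_log_def tendsto_PInfty_eq_at_top)
      then have "filterlim (\<lambda>t. - (t * \<phi> (exp (v / t)))) at_bot (at_right 0)"
        by (simp add: filterlim_uminus_at_top)
      from filterlim_compose[OF exp_at_bot this] show ?thesis using True by simp
    next
      case False
      then have "((\<lambda>t. t * \<phi> (exp (v / t))) \<longlongrightarrow> - ln (measure \<mu> {v<..})) (at_right 0)"
        using lim' by (simp add: neg_log_def)
      then have "((\<lambda>t. exp (- (t * \<phi> (exp (v / t))))) \<longlongrightarrow> exp (- (- ln (measure \<mu> {v<..})))) (at_right 0)"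
        by (intro tendsto_intros)
      then show ?thesis using False by (simp add: less_le)
    qed
  qed
  then show ?thesis using laplace_limit_imp_S5[OF \<mu>] by blast
qed

end

text \<open>A bounded continuous test function on the extended reals;
  \<open>(clip v (v + d) x - v) / d\<close> is the ramp that rises from 0 at \<open>v\<close> to 1
  at \<open>v + d\<close>.\<close>

definition clip :: "real \<Rightarrow> real \<Rightarrow> ereal \<Rightarrow> real" where
  "clip a b x = real_of_ereal (max (ereal a) (min (ereal b) x))"

lemma continuous_clip:
  assumes "a \<le> b"
  shows "continuous_on UNIV (clip a b)"
proof -
  have "max (ereal a) (min (ereal b) x) \<in> UNIV - {\<infinity>, -\<infinity>}" for x
    by (cases x) (auto simp: max_def min_def)
  then have "continuous_on UNIV (\<lambda>x. real_of_ereal (max (ereal a) (min (ereal b) x)))"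
    by (intro continuous_on_compose2[OF continuous_on_real] continuous_intros) auto
  then show ?thesis by (simp add: clip_def[abs_def])
qed

lemma clip_ereal: "a \<le> b \<Longrightarrow> clip a b (ereal x) = max a (min b x)"
  by (auto simp: clip_def max_def min_def)

lemma clip_bounds: "a \<le> b \<Longrightarrow> a \<le> clip a b x" "a \<le> b \<Longrightarrow> clip a b x \<le> b"
  by (cases x; force simp: clip_def max_def min_def)+

lemma integral_has_law:
  fixes f :: "'a \<Rightarrow> real"
  assumes "has_law M T Y \<mu>" "f \<in> borel_measurable (borel_of T)" "Y \<in> M \<rightarrow>\<^sub>M borel_of T"
  shows "integral\<^sup>L \<mu> f = (LINT \<omega>|M. f (Y \<omega>))"
  using has_law_unique[OF assms(1) has_law_measurable[OF assms(3)]] integral_distr[OF assms(3,2)] by simp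

lemma measurable_neg_log [measurable]: "neg_log \<in> borel_measurable borel"
  unfolding neg_log_def[abs_def] by measurable

context subordinator
begin

lemma measurable_scaled_neg_log [measurable]:
  assumes "0 \<le> t"
  shows "(\<lambda>\<omega>. ereal t * neg_log (X t \<omega>)) \<in> borel_measurable P"
  using assms by measurable

lemma scaled_neg_log_converges_clip:
  assumes conv: "scaled_neg_log_converges P X \<mu>" and "sets \<mu> = sets borel" and "a \<le> b"
  shows "((\<lambda>t. LINT \<omega>|P. clip a b (ereal t * neg_log (X t \<omega>))) \<longlongrightarrow> (LINT x|\<mu>. max a (min b x))) (at_right 0)"
proof -
  obtain \<mu>' \<nu>' where law: "\<forall>\<^sub>F t in at_right 0. has_law P euclidean (\<lambda>\<omega>. ereal t * neg_log (X t \<omega>)) (\<mu>' t)"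
    and law': "has_law \<mu> euclidean ereal \<nu>'" and weak: "weakly_converges euclidean (at_right 0) \<mu>' \<nu>'"
    using conv unfolding scaled_neg_log_converges_def converges_in_distribution_def by blast
  have cm: "continuous_map euclidean euclideanreal (clip a b)"
    using continuous_clip[OF \<open>a \<le> b\<close>] by (simp add: continuous_map_iff_continuous2)
  have bd: "bounded (range (clip a b))"
    by (rule bounded_subset[OF bounded_closed_interval[of a b]]) (use clip_bounds[OF \<open>a \<le> b\<close>] in auto)
  have meas: "clip a b \<in> borel_measurable (borel_of euclidean)"
    by (rule continuous_map_borel_measurable[OF cm])
  have "((\<lambda>t. integral\<^sup>L (\<mu>' t) (clip a b)) \<longlongrightarrow> integral\<^sup>L \<nu>' (clip a b)) (at_right 0)"
    using weak cm bd unfolding weakly_converges_def by simp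
  moreover have "integral\<^sup>L \<nu>' (clip a b) = (LINT x|\<mu>. clip a b (ereal x))"
  proof (rule integral_has_law[OF law' meas])
    show "ereal \<in> \<mu> \<rightarrow>\<^sub>M borel_of euclidean"
      unfolding borel_of_euclidean measurable_cong_sets[OF assms(2) refl] by measurable
  qed
  moreover have "\<forall>\<^sub>F t in at_right 0. integral\<^sup>L (\<mu>' t) (clip a b) = (LINT \<omega>|P. clip a b (ereal t * neg_log (X t \<omega>)))"
    using law eventually_at_right_less[of "0::real"]
  proof eventually_elim
    case (elim t)
    show ?case
      by (rule integral_has_law[OF elim(1) meas]) (use elim(2) in \<open>simp add: borel_of_euclidean\<close>)
  qed
  ultimately show ?thesis
    using \<open>a \<le> b\<close> by (simp add: clip_ereal) (rule Lim_transform_eventually)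
qed

text \<open>The ramp lies between the indicators of \<open>v + d \<le> x\<close> and
  \<open>v \<le> x\<close>. At \<open>X t \<omega> = 0\<close> the extended value makes it equal to
  1, in agreement with both events on the side of \<open>G\<close>.\<close>

lemma clip_between_G:
  assumes "0 < t" "0 < d"
  shows "G t (exp (- (v + d) / t)) \<le> ((LINT \<omega>|P. clip v (v + d) (ereal t * neg_log (X t \<omega>))) - v) / d"
    and "((LINT \<omega>|P. clip v (v + d) (ereal t * neg_log (X t \<omega>))) - v) / d \<le> G t (exp (- v / t))"
proof -
  have [measurable]: "X t \<in> borel_measurable P" using measurable_X[of t] assms by simp
  have [measurable]: "{\<omega> \<in> space P. X t \<omega> \<le> x} \<in> events" for x by measurable
  let ?c = "\<lambda>\<omega>. clip v (v + d) (ereal t * neg_log (X t \<omega>))"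
  have clip_meas: "clip v (v + d) \<in> borel_measurable borel"
    using continuous_clip[of v "v + d"] assms by (intro borel_measurable_continuous_onI) simp
  have int: "integrable P ?c"
  proof (rule integrable_const_bound[where B = "\<bar>v\<bar> + \<bar>v + d\<bar>"])
    have "\<bar>?c \<omega>\<bar> \<le> \<bar>v\<bar> + \<bar>v + d\<bar>" for \<omega>
      using clip_bounds[of v "v + d" "ereal t * neg_log (X t \<omega>)"] assms by linarith
    then show "AE \<omega> in P. norm (?c \<omega>) \<le> \<bar>v\<bar> + \<bar>v + d\<bar>" by simp
    show "?c \<in> borel_measurable P"
      by (rule measurable_compose[OF measurable_scaled_neg_log clip_meas]) (use assms in simp)
  qed
  have eq: "((LINT \<omega>|P. ?c \<omega>) - v) / d = (LINT \<omega>|P. (?c \<omega> - v) / d)"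
    using int by (simp add: prob_space)
  have ind: "G t x = (LINT \<omega>|P. indicator {\<omega> \<in> space P. X t \<omega> \<le> x} \<omega>)" for x by (simp add: G_def)
  have int1: "integrable P (\<lambda>\<omega>. indicator {\<omega> \<in> space P. X t \<omega> \<le> x} \<omega> :: real)" for x
    by (auto simp: less_top[symmetric])
  have int2: "integrable P (\<lambda>\<omega>. (?c \<omega> - v) / d)" using int by simp
  have pos: "?c \<omega> = max v (min (v + d) (- t * ln (X t \<omega>)))" "(X t \<omega> \<le> exp (- w / t)) = (w \<le> - t * ln (X t \<omega>))" if "0 < X t \<omega>" for \<omega> w
  proof -
    show "?c \<omega> = max v (min (v + d) (- t * ln (X t \<omega>)))"
      using that assms clip_ereal[of v "v + d" "- t * ln (X t \<omega>)"] by (simp add: neg_log_def)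
    have "(X t \<omega> \<le> exp (- w / t)) = (ln (X t \<omega>) \<le> - w / t)" using that ln_le_cancel_iff[of "X t \<omega>" "exp (- w / t)"] by simp
    also have "\<dots> = (ln (X t \<omega>) * t \<le> - w)" using assms pos_le_divide_eq[of t "ln (X t \<omega>)" "- w"] by simp
    also have "\<dots> = (w \<le> - t * ln (X t \<omega>))" using mult.commute[of t "ln (X t \<omega>)"] by linarith
    finally show "(X t \<omega> \<le> exp (- w / t)) = (w \<le> - t * ln (X t \<omega>))" .
  qed
  have zero: "?c \<omega> = v + d" if "X t \<omega> = 0" for \<omega>
    using that assms by (simp add: neg_log_def clip_def)
  show "G t (exp (- (v + d) / t)) \<le> ((LINT \<omega>|P. ?c \<omega>) - v) / d"
    unfolding eq ind
  proof (rule integral_mono_AE[OF int1 int2])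
    show "AE \<omega> in P. indicator {\<omega> \<in> space P. X t \<omega> \<le> exp (- (v + d) / t)} \<omega> \<le> (?c \<omega> - v) / d"
      using X_nonneg[of t, OF less_imp_le[OF assms(1)]]
    proof eventually_elim
      case (elim \<omega>)
      have "v \<le> ?c \<omega>" using clip_bounds(1)[of v "v + d"] assms by simp
      moreover have "?c \<omega> = v + d" if "X t \<omega> \<le> exp (- (v + d) / t)"
      proof (cases "X t \<omega> = 0")
        case False
        then have "0 < X t \<omega>" using elim by simp
        then show ?thesis using pos(1)[of \<omega>] pos(2)[of \<omega> "v + d"] that assms by simp
      qed (rule zero)
      ultimately show ?case using assms by (auto simp: indicator_def)
    qed
  qed
  show "((LINT \<omega>|P. ?c \<omega>) - v) / d \<le> G t (exp (- v / t))"
    unfolding eq ind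
  proof (rule integral_mono_AE[OF int2 int1])
    show "AE \<omega> in P. (?c \<omega> - v) / d \<le> indicator {\<omega> \<in> space P. X t \<omega> \<le> exp (- v / t)} \<omega>"
      using X_nonneg[of t, OF less_imp_le[OF assms(1)]] AE_space
    proof eventually_elim
      case (elim \<omega>)
      have "?c \<omega> \<le> v + d" using clip_bounds(2)[of v "v + d"] assms by simp
      moreover have "?c \<omega> = v" if "\<not> X t \<omega> \<le> exp (- v / t)"
      proof -
        have "0 < X t \<omega>" using that by (meson exp_gt_zero less_le_trans linear order_less_le_trans)
        then show ?thesis using pos(1)[of \<omega>] pos(2)[of \<omega> v] that assms by simp
      qed
      ultimately show ?case using assms elim(2) by (auto simp: indicator_def divide_le_eq)
    qed
  qed
qed

lemma clip_integral_bounds: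
  assumes "real_distribution \<mu>" "0 < d"
  shows "measure \<mu> {v + d<..} \<le> ((LINT x|\<mu>. max v (min (v + d) x)) - v) / d"
    and "((LINT x|\<mu>. max v (min (v + d) x)) - v) / d \<le> measure \<mu> {v<..}"
proof -
  interpret \<mu>: real_distribution \<mu> by fact
  let ?c = "\<lambda>x::real. max v (min (v + d) x)"
  have int: "integrable \<mu> ?c"
    using assms(2) by (intro \<mu>.integrable_const_bound[where B = "\<bar>v\<bar> + \<bar>v + d\<bar>"]) auto
  have eq: "((LINT x|\<mu>. ?c x) - v) / d = (LINT x|\<mu>. (?c x - v) / d)"
    using int \<mu>.prob_space by simp
  have ind: "measure \<mu> {w<..} = (LINT x|\<mu>. indicator {w<..} x)" for w by simp
  have int1: "integrable \<mu> (\<lambda>x. indicator {w<..} x :: real)" for w by (auto simp: less_top[symmetric])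
  have int2: "integrable \<mu> (\<lambda>x. (?c x - v) / d)" using int by simp
  show "measure \<mu> {v + d<..} \<le> ((LINT x|\<mu>. ?c x) - v) / d"
    unfolding eq ind by (rule integral_mono[OF int1 int2]) (use assms(2) in \<open>auto simp: indicator_def\<close>)
  show "((LINT x|\<mu>. ?c x) - v) / d \<le> measure \<mu> {v<..}"
    unfolding eq ind by (rule integral_mono[OF int2 int1]) (use assms(2) in \<open>auto simp: indicator_def divide_le_eq\<close>)
qed

text \<open>The slack \<open>2 * d\<close> is spent in halves: one \<open>d\<close> on the width of
  the ramp, one on the bounds between \<open>G\<close> and the Laplace transform. Without an atom at
  \<open>v\<close> the cdf is continuous there, so the slack costs nothing in the limit.\<close>

lemma scaled_neg_log_converges_laplace:
  assumes "real_distribution \<mu>" and conv: "scaled_neg_log_converges P X \<mu>"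
    and v: "0 < v" "measure \<mu> {v} = 0"
  shows "((\<lambda>t. exp (- t * \<phi> (exp (v / t)))) \<longlongrightarrow> measure \<mu> {v<..}) (at_right 0)"
proof (rule order_tendstoI)
  interpret \<mu>: real_distribution \<mu> by fact
  have pos: "\<forall>\<^sub>F t in at_right 0. (0::real) < t" by (rule eventually_at_right_less)
  have "isCont (cdf \<mu>) v" using \<mu>.isCont_cdf v by simp
  then have cont: "((\<lambda>d. 1 - cdf \<mu> (v + 2 * d)) \<longlongrightarrow> 1 - cdf \<mu> v) (at_right 0)"
    "((\<lambda>d. 1 - cdf \<mu> (v - 2 * d)) \<longlongrightarrow> 1 - cdf \<mu> v) (at_right 0)"
    by (auto intro!: tendsto_eq_intros isCont_tendsto_compose[of v "cdf \<mu>"])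
  note clip_lim = scaled_neg_log_converges_clip[OF conv \<mu>.events_eq_borel]
  fix a
  {
    assume "a < measure \<mu> {v<..}"
    then obtain d where d: "0 < d" "a < 1 - cdf \<mu> (v + 2 * d)"
      using at_right_ex(1)[OF cont(1) zero_less_one, of a] measure_greaterThan_cdf[OF assms(1)] by auto
    let ?I = "((LINT x|\<mu>. max (v + d) (min (v + d + d) x)) - (v + d)) / d"
    have "a < ?I"
      using clip_integral_bounds(1)[OF assms(1) d(1), of "v + d"] d(2) measure_greaterThan_cdf[OF assms(1)]
      by (simp add: add.assoc)
    moreover have "((\<lambda>t. exp (- exp (- d / t)) * (((LINT \<omega>|P. clip (v + d) (v + d + d) (ereal t * neg_log (X t \<omega>))) - (v + d)) / d)) \<longlongrightarrow> 1 * ?I) (at_right 0)"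
      using d by (intro tendsto_mult tendsto_divide tendsto_diff clip_lim exp_small_time_limits tendsto_const) auto
    ultimately have "\<forall>\<^sub>F t in at_right 0. a < exp (- exp (- d / t)) * (((LINT \<omega>|P. clip (v + d) (v + d + d) (ereal t * neg_log (X t \<omega>))) - (v + d)) / d)"
      by (intro order_tendstoD(1)) auto
    then show "\<forall>\<^sub>F t in at_right 0. a < exp (- t * \<phi> (exp (v / t)))"
      using pos
    proof eventually_elim
      case (elim t)
      have "exp (- exp (- d / t)) * (((LINT \<omega>|P. clip (v + d) (v + d + d) (ereal t * neg_log (X t \<omega>))) - (v + d)) / d)
          \<le> exp (- exp (- d / t)) * G t (exp (- (v + d) / t))"
        by (intro mult_left_mono clip_between_G(2) elim(2) d(1)) simp
      also have "\<dots> \<le> exp (- t * \<phi> (exp (v / t)))" by (rule G_le_laplace_scaled[OF elim(2)])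
      finally show ?case using elim(1) by simp
    qed
  next
    assume "measure \<mu> {v<..} < a"
    then obtain d where d: "0 < d" "1 - cdf \<mu> (v - 2 * d) < a"
      using at_right_ex(2)[OF cont(2) zero_less_one, of a] measure_greaterThan_cdf[OF assms(1)] by auto
    define w where "w = v - 2 * d"
    have w: "v - d = w + d" by (simp add: w_def)
    let ?I = "((LINT x|\<mu>. max w (min (w + d) x)) - w) / d"
    have "?I < a"
      using clip_integral_bounds(2)[OF assms(1) d(1), of w] d(2) measure_greaterThan_cdf[OF assms(1), of w]
      by (simp add: w_def)
    moreover have "((\<lambda>t. ((LINT \<omega>|P. clip w (w + d) (ereal t * neg_log (X t \<omega>))) - w) / d + exp (- exp (d / t))) \<longlongrightarrow> ?I + 0) (at_right 0)"
      using d by (intro tendsto_add tendsto_divide tendsto_diff clip_lim exp_small_time_limits tendsto_const) auto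
    ultimately have "\<forall>\<^sub>F t in at_right 0. ((LINT \<omega>|P. clip w (w + d) (ereal t * neg_log (X t \<omega>))) - w) / d + exp (- exp (d / t)) < a"
      by (intro order_tendstoD(2)) auto
    then show "\<forall>\<^sub>F t in at_right 0. exp (- t * \<phi> (exp (v / t))) < a"
      using pos
    proof eventually_elim
      case (elim t)
      have "exp (- t * \<phi> (exp (v / t))) \<le> G t (exp (- (w + d) / t)) + exp (- exp (d / t))"
        using laplace_le_G_scaled[OF elim(2), of v d] by (simp add: w)
      then show ?case using clip_between_G(1)[OF elim(2) d(1), of w] elim(1) by linarith
    qed
  }
qed

lemma S1_imp_S5:
  assumes "cond_S1 P X"
  shows "\<exists>\<gamma>>0. cond_S5 \<nu> \<gamma>"
proof -
  obtain \<mu> where \<mu>: "real_distribution \<mu>" "AE x in \<mu>. 0 < x" and conv: "scaled_neg_log_converges P X \<mu>"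
    using assms unfolding cond_S1_def positive_nondegenerate_law_def by blast
  show ?thesis
    using laplace_limit_imp_S5[OF \<mu> scaled_neg_log_converges_laplace[OF \<mu>(1) conv]] by blast
qed

end

lemma exponential_law:
  assumes "0 < \<gamma>"
  shows "real_distribution (exponential_law \<gamma>)" "AE x in exponential_law \<gamma>. 0 < x"
    "measure (exponential_law \<gamma>) {v} = 0" "0 \<le> v \<Longrightarrow> measure (exponential_law \<gamma>) {v<..} = exp (- \<gamma> * v)"
proof -
  have ps: "prob_space (exponential_law \<gamma>)"
    unfolding exponential_law_def by (rule prob_space_exponential_density[OF assms])
  have sets: "sets (exponential_law \<gamma>) = sets borel" by (simp add: exponential_law_def)
  show rd: "real_distribution (exponential_law \<gamma>)"
    using ps sets by (auto simp: real_distribution_def real_distribution_axioms_def exponential_law_def)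
  have "AE x in lborel. (x::real) \<noteq> 0" by (rule AE_lborel_singleton)
  then have "AE x in lborel. ennreal (exponential_density \<gamma> x) > 0 \<longrightarrow> 0 < x"
    by eventually_elim (auto simp: exponential_density_def not_less)
  then show "AE x in exponential_law \<gamma>. 0 < x"
    unfolding exponential_law_def by (subst AE_density) auto
  have "AE x in lborel. x \<noteq> v" by (rule AE_lborel_singleton)
  then have "AE x in exponential_law \<gamma>. x \<noteq> v"
    unfolding exponential_law_def by (subst AE_density) (auto elim: eventually_mono)
  interpret prob_space "exponential_law \<gamma>" by (rule ps)
  from \<open>AE x in exponential_law \<gamma>. x \<noteq> v\<close> show "measure (exponential_law \<gamma>) {v} = 0"
    using prob_eq_0[of "{v}"] by (simp add: sets)
  assume "0 \<le> v"
  have "distributed (exponential_law \<gamma>) lborel (\<lambda>x. x) (exponential_density \<gamma>)"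
    unfolding distributed_def by (auto simp: exponential_law_def distr_id2 sets intro!: distr_id2)
  from exponential_distributedD_gt[OF this \<open>0 \<le> v\<close> assms]
  show "measure (exponential_law \<gamma>) {v<..} = exp (- \<gamma> * v)"
    by (simp add: exponential_law_def greaterThan_def mult.commute)
qed

context subordinator
begin

lemma S4_imp_S5:
  assumes "0 < \<gamma>" and conv: "scaled_neg_log_converges P X (exponential_law \<gamma>)"
  shows "cond_S5 \<nu> \<gamma>"
proof -
  note e = exponential_law[OF assms(1)]
  obtain \<gamma>' where \<gamma>': "cond_S5 \<nu> \<gamma>'" "measure (exponential_law \<gamma>) {1<..} = exp (- \<gamma>' * 1)"
    using laplace_limit_imp_S5[OF e(1,2) scaled_neg_log_converges_laplace[OF e(1) conv]] e(3) by force
  then have "\<gamma>' = \<gamma>" using e(4)[of 1] by simp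
  then show ?thesis using \<gamma>'(1) by simp
qed

text \<open>From above, the choice \<open>x = 1 / s\<close> loses only a factor
  \<open>exp (-1)\<close>. From below, \<open>x\<close> is taken as a power of \<open>s\<close>
  slightly larger than \<open>1 / s\<close>: then \<open>s * x = s powr d\<close>, and
  \<open>exp (- (s powr d))\<close> is negligible against any negative power of
  \<open>s\<close>.\<close>

lemma S6_imp_S5:
  assumes S6: "cond_S6 P X \<gamma>" and "0 < \<gamma>"
  shows "cond_S5 \<nu> \<gamma>"
  unfolding cond_S5_def
proof (rule order_tendstoI)
  define g where "g x = G 1 x" for x
  have cdf: "cdf (distr P borel (X 1)) x = g x" for x
    using measure_distr[OF measurable_X[of 1], of "{..x}"]
    by (simp add: cdf_def2 g_def G_def vimage_def Int_def conj_commute)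
  have lim: "((\<lambda>x. ln (g x) / ln x) \<longlongrightarrow> \<gamma>) (at_right 0)"
    using S6 by (simp add: cond_S6_def cdf)
  then have "\<forall>\<^sub>F x in at_right 0. 0 < ln (g x) / ln x" using \<open>0 < \<gamma>\<close> by (rule order_tendstoD(1))
  then have gpos: "\<forall>\<^sub>F x in at_right 0. 0 < g x"
  proof eventually_elim
    case (elim x)
    then have "g x \<noteq> 0" by auto
    then show ?case using G_bounds(1)[of 1 x] by (simp add: g_def)
  qed
  have big: "\<forall>\<^sub>F s in at_top. (1::real) < s" by (rule eventually_gt_at_top)
  fix a
  {
    assume "\<gamma> < a"
    have inv: "filterlim (\<lambda>s. 1 / s :: real) (at_right 0) at_top" by real_asymp
    have "((\<lambda>s. 1 / ln s + ln (g (1 / s)) / ln (1 / s)) \<longlongrightarrow> 0 + \<gamma>) at_top"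
      by (intro tendsto_add filterlim_compose[OF lim inv]) real_asymp
    then have "\<forall>\<^sub>F s in at_top. 1 / ln s + ln (g (1 / s)) / ln (1 / s) < a"
      using \<open>\<gamma> < a\<close> by (intro order_tendstoD(2)) auto
    then show "\<forall>\<^sub>F s in at_top. \<phi> s / ln s < a"
      using big eventually_compose_filterlim[OF gpos inv]
    proof eventually_elim
      case (elim s)
      have "exp (-1) * g (1 / s) \<le> exp (- \<phi> s)"
        using G_le_laplace[of 1 s "1 / s"] elim by (simp add: g_def)
      then have "ln (exp (-1) * g (1 / s)) \<le> - \<phi> s"
        using elim ln_le_cancel_iff[of "exp (-1) * g (1 / s)" "exp (- \<phi> s)"] by simp
      then have "\<phi> s \<le> 1 - ln (g (1 / s))" using elim by (simp add: ln_mult)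
      then have "\<phi> s / ln s \<le> (1 - ln (g (1 / s))) / ln s" using elim by (intro divide_right_mono) auto
      also have "\<dots> = 1 / ln s + ln (g (1 / s)) / ln (1 / s)"
        using elim by (simp add: ln_div diff_divide_distrib)
      finally show ?case using elim by simp
    qed
  next
    assume "a < \<gamma>"
    \<comment> \<open>The choice of \<open>d\<close> makes \<open>\<gamma> * (1 - d)\<close> the
      midpoint of \<open>b\<close> and \<open>\<gamma>\<close>; \<open>c\<close> is the midpoint of
      \<open>b\<close> and that value.\<close>
    define b where "b = (max a 0 + \<gamma>) / 2"
    have b: "0 < b" "a < b" "b < \<gamma>" using \<open>a < \<gamma>\<close> \<open>0 < \<gamma>\<close> by (auto simp: b_def max_def)
    define c where "c = (3 * b + \<gamma>) / 4"
    define d where "d = (\<gamma> - b) / (2 * \<gamma>)"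
    have c: "b < c" "c < \<gamma> * (1 - d)" using b \<open>0 < \<gamma>\<close> by (auto simp: c_def d_def field_simps)
    have d: "0 < d" "d < 1" using b \<open>0 < \<gamma>\<close> by (auto simp: d_def field_simps)
    have inv: "filterlim (\<lambda>s. s powr - (1 - d)) (at_right 0) at_top" using d by real_asymp
    have "((\<lambda>s. ln (g (s powr - (1 - d))) / ln (s powr - (1 - d)) * (1 - d)) \<longlongrightarrow> \<gamma> * (1 - d)) at_top"
      by (intro tendsto_mult filterlim_compose[OF lim inv] tendsto_const)
    then have 1: "\<forall>\<^sub>F s in at_top. c < ln (g (s powr - (1 - d))) / ln (s powr - (1 - d)) * (1 - d)"
      using c by (intro order_tendstoD(1)) auto
    have "((\<lambda>s. s powr (b - c) + s powr b * exp (- (s powr d))) \<longlongrightarrow> 0) at_top"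
    proof -
      have "((\<lambda>s. s powr (b - c)) \<longlongrightarrow> 0) at_top" using c by real_asymp
      moreover have "((\<lambda>s. s powr b * exp (- (s powr d))) \<longlongrightarrow> 0) at_top" using b d by real_asymp
      ultimately show ?thesis using tendsto_add by fastforce
    qed
    then have 2: "\<forall>\<^sub>F s in at_top. s powr (b - c) + s powr b * exp (- (s powr d)) < 1"
      by (rule order_tendstoD(2)) simp
    show "\<forall>\<^sub>F s in at_top. a < \<phi> s / ln s"
      using 1 2 big eventually_compose_filterlim[OF gpos inv]
    proof eventually_elim
      case (elim s)
      define x where "x = s powr - (1 - d)"
      have ls: "0 < ln s" using elim by simp
      have lnx: "ln x = - (1 - d) * ln s" using elim by (simp add: x_def ln_powr)
      have "y / (- b * l) * b = - y / l" if "b \<noteq> 0" for y b l :: real using that by simp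
      from this[of "1 - d" "ln (g x)" "ln s"] have "ln (g x) / ln x * (1 - d) = - ln (g x) / ln s"
        unfolding lnx using d by linarith
      then have "c < - ln (g x) / ln s"
        using elim(1)[folded x_def] by simp
      then have "ln (g x) \<le> - c * ln s" using ls pos_less_divide_eq[of "ln s" c "- ln (g x)"] by simp
      then have "g x \<le> exp (- c * ln s)" using elim(4)[folded x_def] ln_le_cancel_iff[of "g x" "exp (- c * ln s)"] by simp
      then have gx: "g x \<le> s powr (- c)" using elim(3) by (simp add: powr_def)
      have sx: "s * x = s powr d"
        using elim(3) powr_add[of s 1 "- (1 - d)"] by (simp add: x_def)
      have "exp (- \<phi> s) \<le> g x + exp (- (s * x))"
        using laplace_le_G[of 1 s x] elim(3) by (simp add: g_def)
      also have "\<dots> \<le> s powr (- c) + exp (- (s powr d))" using gx by (simp add: sx)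
      also have "\<dots> = s powr (- b) * (s powr (b - c) + s powr b * exp (- (s powr d)))"
        using elim(3) by (simp add: distrib_left mult.assoc[symmetric] powr_add[symmetric])
      also have "\<dots> \<le> s powr (- b) * 1" using elim(2) by (intro mult_left_mono) auto
      also have "\<dots> = exp (- (b * ln s))" using elim(3) by (simp add: powr_def)
      finally have "b * ln s \<le> \<phi> s" by simp
      then have "b \<le> \<phi> s / ln s" using ls by (simp add: pos_le_divide_eq)
      then show ?case using b by simp
    qed
  }
qed

section \<open>Laplace exponent and tails of the Levy measure\<close>

lemma levy_measure: "sets \<nu> = sets borel" "emeasure \<nu> {1<..} < \<infinity>" "(\<integral>\<^sup>+u\<in>{0<..1}. ennreal u \<partial>\<nu>) < \<infinity>"
  using X by (simp_all add: pure_jump_subordinator_def subordinator_levy_measure_def)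

lemma emeasure_tail_finite:
  assumes "0 < x"
  shows "emeasure \<nu> {x<..} < \<infinity>"
proof -
  note [measurable_cong] = levy_measure(1)
  have "emeasure \<nu> {x<..} \<le> (\<integral>\<^sup>+u. ennreal (1 / x) * (ennreal u * indicator {0<..1} u) + indicator {1<..} u \<partial>\<nu>)"
  proof (subst nn_integral_indicator[symmetric])
    show "{x<..} \<in> sets \<nu>" by (simp add: levy_measure)
    show "(\<integral>\<^sup>+u. indicator {x<..} u \<partial>\<nu>) \<le> (\<integral>\<^sup>+u. ennreal (1 / x) * (ennreal u * indicator {0<..1} u) + indicator {1<..} u \<partial>\<nu>)"
    proof (rule nn_integral_mono)
      fix u
      have "1 \<le> ennreal (1 / x) * ennreal u" if "x < u"
        using that assms by (subst ennreal_mult'[symmetric]) (auto simp: ennreal_1[symmetric] simp del: ennreal_1 intro!: ennreal_leI)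
      then show "indicator {x<..} u \<le> ennreal (1 / x) * (ennreal u * indicator {0<..1} u) + indicator {1<..} u"
        using assms by (auto simp: indicator_def)
    qed
  qed
  also have "\<dots> = ennreal (1 / x) * (\<integral>\<^sup>+u\<in>{0<..1}. ennreal u \<partial>\<nu>) + emeasure \<nu> {1<..}"
    by (subst nn_integral_add, (measurable; fail)+, subst nn_integral_cmult, measurable)
  also have "\<dots> < \<infinity>" using levy_measure(2,3) by (simp add: ennreal_mult_less_top)
  finally show ?thesis .
qed

lemma emeasure_tail: "0 < x \<Longrightarrow> emeasure \<nu> {x<..} = ennreal (measure \<nu> {x<..})"
  using emeasure_tail_finite[of x] by (simp add: emeasure_eq_ennreal_measure less_top)

text \<open>Integrability guards against the default value 0 of the Bochner integral in
  \<open>laplace_exponent\<close>; it comes from bounding the integrand by \<open>s * x\<close> on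
  \<open>{0<..1}\<close> and by 1 beyond.\<close>

lemma laplace_exponent_nn_integral:
  assumes "0 < s"
  shows "ennreal (\<phi> s) = (\<integral>\<^sup>+x. ennreal (indicator {0<..} x * (1 - exp (- s * x))) \<partial>\<nu>)"
    and "integrable \<nu> (\<lambda>x. indicator {0<..} x * (1 - exp (- s * x)))"
proof -
  note [measurable_cong] = levy_measure(1)
  let ?F = "\<lambda>x::real. indicator {0<..} x * (1 - exp (- s * x))"
  have nonneg: "0 \<le> ?F x" for x using assms by (auto simp: indicator_def)
  have "(\<integral>\<^sup>+x. ennreal (?F x) \<partial>\<nu>) \<le> (\<integral>\<^sup>+u. ennreal s * (ennreal u * indicator {0<..1} u) + indicator {1<..} u \<partial>\<nu>)"
  proof (rule nn_integral_mono)
    fix u :: real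
    have "1 - exp (- s * u) \<le> s * u" using exp_ge_add_one_self[of "- s * u"] by simp
    then have "ennreal (1 - exp (- s * u)) \<le> ennreal s * ennreal u" if "0 < u"
      using that assms by (subst ennreal_mult[symmetric]) (auto intro!: ennreal_leI)
    moreover have "ennreal (1 - exp (- s * u)) \<le> 1"
      using ennreal_leI[of "1 - exp (- s * u)" 1] by simp
    ultimately show "ennreal (?F u) \<le> ennreal s * (ennreal u * indicator {0<..1} u) + indicator {1<..} u"
      by (auto simp: indicator_def)
  qed
  also have "\<dots> = ennreal s * (\<integral>\<^sup>+u\<in>{0<..1}. ennreal u \<partial>\<nu>) + emeasure \<nu> {1<..}"
    by (subst nn_integral_add, (measurable; fail)+, subst nn_integral_cmult, measurable)
  also have "\<dots> < \<infinity>" using levy_measure(2,3) by (simp add: ennreal_mult_less_top)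
  finally have fin: "(\<integral>\<^sup>+x. ennreal (?F x) \<partial>\<nu>) < \<infinity>" .
  show int: "integrable \<nu> ?F"
    by (rule integrableI_nonneg) (use fin nonneg in simp_all)
  have "\<phi> s = integral\<^sup>L \<nu> ?F" by (simp add: laplace_exponent_def set_lebesgue_integral_def)
  then show "ennreal (\<phi> s) = (\<integral>\<^sup>+x. ennreal (?F x) \<partial>\<nu>)"
    using nn_integral_eq_integral[OF int] nonneg by simp
qed

lemma laplace_exponent_ge_tail:
  assumes "0 < s" "0 < K"
  shows "(1 - exp (- K)) * measure \<nu> {K / s<..} \<le> \<phi> s"
proof -
  have [simp]: "{K / s<..} \<in> sets \<nu>" by (simp add: levy_measure)
  have "(1 - exp (- K)) * measure \<nu> {K / s<..} = (LINT x|\<nu>. (1 - exp (- K)) * indicator {K / s<..} x)"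
    by simp
  also have "\<dots> \<le> (LINT x|\<nu>. indicator {0<..} x * (1 - exp (- s * x)))"
  proof (rule integral_mono)
    show "integrable \<nu> (\<lambda>x. (1 - exp (- K)) * indicator {K / s<..} x)"
      using emeasure_tail_finite[of "K / s"] assms by (intro integrable_mult_right) (auto simp: less_top)
    show "(1 - exp (- K)) * indicator {K / s<..} x \<le> indicator {0<..} x * (1 - exp (- s * x))" for x
    proof (cases "K / s < x")
      case True
      have "0 < K / s" using assms by simp
      then have "0 < x" using True by linarith
      moreover have "K \<le> s * x" using True assms by (simp add: divide_less_eq mult.commute)
      ultimately show ?thesis using True by simp
    next
      case False
      then show ?thesis using assms by (auto simp: indicator_def)
    qed
  qed (rule laplace_exponent_nn_integral(2)[OF assms(1)])
  also have "\<dots> = \<phi> s" by (simp add: laplace_exponent_def set_lebesgue_integral_def)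
  finally show ?thesis .
qed

text \<open>The part of the integral over \<open>(0, e / s]\<close> is split along the points \<open>e / (2\<^sup>k s)\<close>.\<close>

lemma laplace_exponent_le_dyadic:
  assumes "0 < s" "0 < e"
  shows "ennreal (\<phi> s) \<le> ennreal (measure \<nu> {e / s<..}) +
    (\<Sum>k. ennreal (e * (1 / 2) ^ k * measure \<nu> {e * (1 / 2) ^ Suc k / s<..}))"
proof -
  note [measurable_cong] = levy_measure(1)
  let ?f = "\<lambda>k x. ennreal (e * (1 / 2) ^ k) * indicator {e * (1 / 2) ^ Suc k / s<..} x"
  have "ennreal (\<phi> s) \<le> (\<integral>\<^sup>+x. indicator {e / s<..} x + (\<Sum>k. ?f k x) \<partial>\<nu>)"
    unfolding laplace_exponent_nn_integral(1)[OF assms(1)]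
  proof (rule nn_integral_mono)
    fix x :: real
    consider "x \<le> 0" | "e / s < x" | "0 < x" "x \<le> e / s" by linarith
    then show "ennreal (indicator {0<..} x * (1 - exp (- s * x))) \<le> indicator {e / s<..} x + (\<Sum>k. ?f k x)"
    proof cases
      case 2
      have "ennreal (indicator {0<..} x * (1 - exp (- s * x))) \<le> ennreal 1"
        by (intro ennreal_leI) (auto simp: indicator_def)
      also have "\<dots> \<le> 1 + (\<Sum>k. ?f k x)" by simp
      finally show ?thesis using 2 by simp
    next
      case 3
      have le_suminf: "f k \<le> suminf f" for f :: "nat \<Rightarrow> ennreal" and k
        using sum_le_suminf[of f "{k}"] by simp
      have sx: "0 < s * x / e" using 3 assms by simp
      obtain n where "(1 / 2 :: real) ^ n < s * x / e" using real_arch_pow_inv[OF sx, of "1 / 2"] by auto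
      moreover have "(1 / 2 :: real) ^ Suc n \<le> (1 / 2) ^ n" by simp
      ultimately have "(1 / 2 :: real) ^ Suc n < s * x / e" by linarith
      then have ex: "\<exists>n. (1 / 2 :: real) ^ Suc n < s * x / e" ..
      \<comment> \<open>The index of the dyadic interval that contains \<open>x\<close>; this single
        term of the series already dominates the integrand, which is at most
        \<open>s * x\<close>.\<close>
      define k where "k = (LEAST n. (1 / 2 :: real) ^ Suc n < s * x / e)"
      have k: "(1 / 2 :: real) ^ Suc k < s * x / e" unfolding k_def by (rule LeastI_ex[OF ex])
      have k': "s * x / e \<le> (1 / 2) ^ k"
      proof (cases k)
        case 0
        then show ?thesis using 3 assms by (simp add: field_simps)
      next
        case (Suc j)
        then have "\<not> (1 / 2 :: real) ^ Suc j < s * x / e" unfolding k_def by (intro not_less_Least) simp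
        then show ?thesis using Suc by simp
      qed
      have "1 - exp (- s * x) \<le> s * x" using exp_ge_add_one_self[of "- s * x"] by simp
      also have "\<dots> \<le> e * (1 / 2) ^ k" using k' assms by (simp add: divide_le_eq mult.commute)
      finally have "ennreal (indicator {0<..} x * (1 - exp (- s * x))) \<le> ennreal (e * (1 / 2) ^ k)"
        using 3 by (intro ennreal_leI) simp
      also have "\<dots> = ?f k x"
      proof -
        have "e * (1 / 2) ^ Suc k < s * x"
          using k assms by (simp add: pos_less_divide_eq mult.commute del: power_Suc)
        then have "e * (1 / 2) ^ Suc k / s < x"
          using assms by (simp add: pos_divide_less_eq mult.commute del: power_Suc)
        then show ?thesis by (simp del: power_Suc)
      qed
      also have "\<dots> \<le> (\<Sum>k. ?f k x)" by (rule le_suminf)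
      finally show ?thesis by (simp add: add_increasing)
    qed simp
  qed
  also have "\<dots> = emeasure \<nu> {e / s<..} + (\<Sum>k. \<integral>\<^sup>+x. ?f k x \<partial>\<nu>)"
    by (subst nn_integral_add, (measurable; fail)+, subst nn_integral_suminf, measurable)
  also have "(\<Sum>k. \<integral>\<^sup>+x. ?f k x \<partial>\<nu>) = (\<Sum>k. ennreal (e * (1 / 2) ^ k * measure \<nu> {e * (1 / 2) ^ Suc k / s<..}))"
  proof (rule suminf_cong)
    fix k
    have "0 < e * (1 / 2) ^ Suc k / s" using assms by simp
    from emeasure_tail[OF this]
    show "(\<integral>\<^sup>+x. ?f k x \<partial>\<nu>) = ennreal (e * (1 / 2) ^ k * measure \<nu> {e * (1 / 2) ^ Suc k / s<..})"
      using assms by (subst nn_integral_cmult_indicator) (simp_all add: levy_measure ennreal_mult)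
  qed
  finally show ?thesis using emeasure_tail[of "e / s"] assms by simp
qed

text \<open>The tail at \<open>K / s\<close> is asymptotic to \<open>\<gamma> * ln s\<close> for
  every fixed \<open>K\<close>. A large \<open>K\<close> makes the lower bound
  \<open>laplace_exponent_ge_tail\<close> sharp; in the upper bound a small \<open>e\<close> makes
  the dyadic sum a small multiple of \<open>ln s\<close>.\<close>

lemma S7_imp_S5:
  assumes S7: "cond_S7 \<nu> \<gamma>" and "0 < \<gamma>"
  shows "cond_S5 \<nu> \<gamma>"
  unfolding cond_S5_def
proof (rule order_tendstoI)
  define m where "m x = measure \<nu> {x<..}" for x
  have lim: "((\<lambda>x. m x / ln x) \<longlongrightarrow> - \<gamma>) (at_right 0)"
    using S7 by (simp add: cond_S7_def m_def)
  have lim': "((\<lambda>s. m (K / s) / ln s) \<longlongrightarrow> \<gamma>) at_top" if "0 < K" for K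
  proof -
    have inv: "filterlim (\<lambda>s. K / s) (at_right 0) at_top" using that by real_asymp
    have r: "((\<lambda>s. ln (K / s) / ln s) \<longlongrightarrow> - 1) at_top" using that by real_asymp
    have "((\<lambda>s. m (K / s) / ln (K / s) * (ln (K / s) / ln s)) \<longlongrightarrow> - \<gamma> * - 1) at_top"
      by (intro tendsto_mult filterlim_compose[OF lim inv] r)
    moreover have "\<forall>\<^sub>F s in at_top. m (K / s) / ln (K / s) * (ln (K / s) / ln s) = m (K / s) / ln s"
      using eventually_gt_at_top[of "max K 1"]
    proof eventually_elim
      case (elim s)
      then have "ln (K / s) < ln 1" using that by (subst ln_less_cancel_iff) auto
      then show ?case by simp
    qed
    ultimately show ?thesis by (simp add: Lim_transform_eventually)
  qed
  have big: "\<forall>\<^sub>F s in at_top. (1::real) < s" by (rule eventually_gt_at_top)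
  fix a
  {
    assume "a < \<gamma>"
    have "((\<lambda>d. (1 - exp (- (1 / d))) * \<gamma>) \<longlongrightarrow> \<gamma>) (at_right 0)" by real_asymp
    from at_right_ex(1)[OF this zero_less_one \<open>a < \<gamma>\<close>]
    obtain d where d: "0 < d" "a < (1 - exp (- (1 / d))) * \<gamma>" by blast
    define K where "K = 1 / d"
    have K: "0 < K" "a < (1 - exp (- K)) * \<gamma>" using d by (auto simp: K_def)
    have "((\<lambda>s. (1 - exp (- K)) * (m (K / s) / ln s)) \<longlongrightarrow> (1 - exp (- K)) * \<gamma>) at_top"
      by (intro tendsto_mult tendsto_const lim' K(1))
    then have "\<forall>\<^sub>F s in at_top. a < (1 - exp (- K)) * (m (K / s) / ln s)" using K(2) by (rule order_tendstoD(1))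
    then show "\<forall>\<^sub>F s in at_top. a < \<phi> s / ln s"
      using big
    proof eventually_elim
      case (elim s)
      have "(1 - exp (- K)) * m (K / s) / ln s \<le> \<phi> s / ln s"
        using elim laplace_exponent_ge_tail[of s K] K(1) by (intro divide_right_mono) (auto simp: m_def)
      then show ?case using elim by simp
    qed
  next
    assume "\<gamma> < a"
    \<comment> \<open>The leading \<open>\<gamma>\<close> is the limit of
      \<open>m (e / s) / ln s\<close>. The rest bounds the dyadic sum: \<open>2 * \<gamma>\<close>
      is a crude tail constant, affordable because of the factor \<open>e\<close>, and the last
      \<open>2\<close> is the sum of the powers of \<open>1 / 2\<close>.\<close>
    have "((\<lambda>e. \<gamma> + 2 * \<gamma> * e * 2) \<longlongrightarrow> \<gamma>) (at_right 0)" by real_asymp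
    from at_right_ex(2)[OF this zero_less_one \<open>\<gamma> < a\<close>]
    obtain e where e: "0 < e" "e < 1" "\<gamma> + 2 * \<gamma> * e * 2 < a" by blast
    have "\<forall>\<^sub>F x in at_right 0. - 2 * \<gamma> < m x / ln x"
      using lim \<open>0 < \<gamma>\<close> by (intro order_tendstoD(1)[OF lim]) simp
    then obtain x0 where x0: "0 < x0" "\<And>x. 0 < x \<Longrightarrow> x < x0 \<Longrightarrow> - 2 * \<gamma> < m x / ln x"
      unfolding eventually_at_right_field by auto
    define x1 where "x1 = min x0 1"
    have x1: "0 < x1" "m x \<le> 2 * \<gamma> * - ln x" if "0 < x" "x < x1" for x
    proof -
      show "0 < x1" using x0 by (simp add: x1_def)
      have "ln x < 0" using that by (simp add: x1_def)
      moreover have "- 2 * \<gamma> < m x / ln x" using x0(2)[of x] that by (simp add: x1_def)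
      ultimately show "m x \<le> 2 * \<gamma> * - ln x" by (simp add: neg_less_divide_eq)
    qed
    have x1pos: "0 < x1" using x0 by (simp add: x1_def)
    have "((\<lambda>s. m (e / s) / ln s + 2 * \<gamma> * e * ((2 * (ln s - ln e) + 8) / ln s)) \<longlongrightarrow> \<gamma> + 2 * \<gamma> * e * 2) at_top"
      by (intro tendsto_add tendsto_mult tendsto_const lim' e(1)) (use e(1) in real_asymp)
    then have 1: "\<forall>\<^sub>F s in at_top. m (e / s) / ln s + 2 * \<gamma> * e * ((2 * (ln s - ln e) + 8) / ln s) < a"
      using e(3) by (rule order_tendstoD(2))
    show "\<forall>\<^sub>F s in at_top. \<phi> s / ln s < a"
      using 1 big eventually_gt_at_top[of "e / x1"]
    proof eventually_elim
      case (elim s)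
      define B where "B = ln s - ln e"
      have "ln e < 0" "0 < ln s" using e elim by auto
      then have B: "0 \<le> B" by (simp add: B_def)
      have term_le: "e * (1 / 2) ^ k * m (e * (1 / 2) ^ Suc k / s) \<le> 2 * \<gamma> * e * (B * (1 / 2) ^ k + 2 * (3 / 4) ^ k)" for k
      proof -
        let ?x = "e * (1 / 2) ^ Suc k / s"
        have "0 < ?x" using e elim by simp
        have "?x \<le> e / s" using e elim power_le_one[of "1/2::real" "Suc k"] by (intro divide_right_mono) (auto simp: mult_left_le simp del: power_Suc)
        also have "e / s < x1" using elim x1pos by (simp add: divide_less_eq mult.commute)
        finally have "m ?x \<le> 2 * \<gamma> * - ln ?x" using x1(2) \<open>0 < ?x\<close> by blast
        also have "- ln ?x = B + real (Suc k) * ln 2"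
          using e elim by (simp add: B_def ln_div ln_mult ln_realpow power_divide del: power_Suc)
        also have "\<dots> \<le> B + real (Suc k) * 1"
          using ln_2_less_1 by (intro add_left_mono mult_left_mono) auto
        \<comment> \<open>A geometric bound for the linear term: multiplied by
          \<open>(1 / 2) ^ k\<close> it leaves \<open>(3 / 4) ^ k\<close>, which sums to 4.\<close>
        also have "real (Suc k) * 1 \<le> 2 * (3 / 2) ^ k"
          using Bernoulli_inequality[of "1 / 2 :: real" k] by simp
        finally have "m ?x \<le> 2 * \<gamma> * (B + 2 * (3 / 2) ^ k)" using \<open>0 < \<gamma>\<close> by simp
        then have "e * (1 / 2) ^ k * m ?x \<le> e * (1 / 2) ^ k * (2 * \<gamma> * (B + 2 * (3 / 2) ^ k))"
          using e by (intro mult_left_mono) auto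
        also have "(1 / 2) ^ k * (3 / 2) ^ k = (3 / 4 :: real) ^ k" by (simp flip: power_mult_distrib)
        then have "e * (1 / 2) ^ k * (2 * \<gamma> * (B + 2 * (3 / 2) ^ k)) = 2 * \<gamma> * e * (B * (1 / 2) ^ k + 2 * (3 / 4) ^ k)"
          by (simp add: algebra_simps)
        finally show ?thesis .
      qed
      have sums: "(\<lambda>k. 2 * \<gamma> * e * (B * (1 / 2) ^ k + 2 * (3 / 4) ^ k)) sums (2 * \<gamma> * e * (B * 2 + 2 * 4))"
        using geometric_sums[of "1 / 2 :: real"] geometric_sums[of "3 / 4 :: real"]
        by (intro sums_mult sums_add) simp_all
      have "(\<Sum>k. ennreal (e * (1 / 2) ^ k * m (e * (1 / 2) ^ Suc k / s))) \<le>
          (\<Sum>k. ennreal (2 * \<gamma> * e * (B * (1 / 2) ^ k + 2 * (3 / 4) ^ k)))"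
        by (intro suminf_le ennreal_leI term_le summableI)
      also have "\<dots> = ennreal (2 * \<gamma> * e * (B * 2 + 2 * 4))"
        using sums e B \<open>0 < \<gamma>\<close> by (intro suminf_ennreal_eq) auto
      finally have "ennreal (\<phi> s) \<le> ennreal (m (e / s)) + ennreal (2 * \<gamma> * e * (B * 2 + 2 * 4))"
        using laplace_exponent_le_dyadic[of s e] e elim unfolding m_def[symmetric]
        by (meson add_left_mono order_trans less_trans zero_less_one)
      also have "\<dots> = ennreal (m (e / s) + 2 * \<gamma> * e * (B * 2 + 2 * 4))"
        using e B \<open>0 < \<gamma>\<close> by (intro ennreal_plus[symmetric]) (auto simp: m_def)
      finally have "\<phi> s \<le> m (e / s) + 2 * \<gamma> * e * (B * 2 + 2 * 4)"
        using e B \<open>0 < \<gamma>\<close> by (subst (asm) ennreal_le_iff) (auto simp: m_def)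
      then have "\<phi> s / ln s \<le> (m (e / s) + 2 * \<gamma> * e * (B * 2 + 2 * 4)) / ln s"
        using \<open>0 < ln s\<close> by (intro divide_right_mono) auto
      also have "\<dots> = m (e / s) / ln s + 2 * \<gamma> * e * ((2 * (ln s - ln e) + 8) / ln s)"
        using \<open>0 < ln s\<close> by (simp add: B_def field_simps)
      finally show ?case using elim(1) by simp
    qed
  }
qed

lemma small_time_condition_imp_S5:
  assumes "cond_S1 P X \<or> cond_S2 \<nu> \<or>
      (\<exists>\<gamma>>0. cond_S3_S4 P X \<gamma> \<or> cond_S5 \<nu> \<gamma> \<or> cond_S6 P X \<gamma> \<or> cond_S7 \<nu> \<gamma>)"
  shows "\<exists>\<gamma>>0. cond_S5 \<nu> \<gamma>"
  using assms S1_imp_S5 S2_imp_S5 S4_imp_S5 S6_imp_S5 S7_imp_S5 unfolding cond_S3_S4_def by blast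

end

section \<open>Paths of the subordinator\<close>

text \<open>On \<open>x \<ge> 0\<close> this is \<open>z \<and> (- t log x)\<close>, with \<open>log 0 = - \<infinity>\<close>.\<close>

definition trunc :: "real \<Rightarrow> real \<Rightarrow> real \<Rightarrow> real" where
  "trunc z t x = - t * ln (max x (exp (- z / t)))"

lemma trunc_eq:
  assumes "0 < t" "0 \<le> x"
  shows "real_of_ereal (min (ereal z) (ereal t * neg_log x)) = trunc z t x"
proof (cases "x = 0")
  case True
  then show ?thesis using assms by (simp add: trunc_def neg_log_def max_def)
next
  case False
  then have x: "0 < x" using assms by simp
  have "ln (max x (exp (- z / t))) = max (ln x) (- z / t)"
    using x ln_le_cancel_iff[of x "exp (- z / t)"] by (auto simp: max_def)
  then have "trunc z t x = min (- t * ln x) z"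
    using assms by (auto simp: trunc_def max_def min_def field_simps)
  then show ?thesis using x assms by (auto simp: neg_log_def min_def)
qed

lemma isCont_trunc: "isCont (trunc z t) x"
  unfolding trunc_def[abs_def]
  by (intro continuous_intros) (auto simp: max_def)

lemma measurable_trunc [measurable]: "trunc z t \<in> borel_measurable borel"
  unfolding trunc_def[abs_def] by measurable

lemma trunc_antimono: "0 < t \<Longrightarrow> x \<le> y \<Longrightarrow> trunc z t y \<le> trunc z t x"
  by (auto simp: trunc_def less_max_iff_disj intro!: mult_left_mono)

text \<open>The drop forces \<open>y\<close> above the truncation level \<open>exp (- z / t)\<close>
  and \<open>x\<close> below \<open>exp (- e / t) * y\<close>. So \<open>y - x\<close> is at least
  \<open>(1 - exp (- e / t)) * y\<close>, a product of two factors of which one is at least and the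
  other above \<open>exp (- z / t)\<close>.\<close>

lemma trunc_drop:
  assumes "0 < t" and small: "exp (- e / t) + exp (- z / t) \<le> 1"
    and drop: "e < trunc z t x - trunc z t y"
  shows "exp (- 2 * z / t) < y - x"
proof -
  let ?c = "exp (- z / t)"
  have pos: "0 < max y ?c" "0 < max x ?c" by (auto simp: less_max_iff_disj)
  have "e < t * (ln (max y ?c) - ln (max x ?c))" using drop by (simp add: trunc_def right_diff_distrib)
  then have "e / t < ln (max y ?c) - ln (max x ?c)" using assms(1) by (simp add: pos_divide_less_eq mult.commute)
  then have "ln (max x ?c) < - e / t + ln (max y ?c)" by simp
  also have "\<dots> = ln (exp (- e / t) * max y ?c)" using pos by (simp add: ln_mult)
  finally have less: "max x ?c < exp (- e / t) * max y ?c"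
    using pos ln_less_cancel_iff[of "max x ?c" "exp (- e / t) * max y ?c"] by simp
  have c: "?c \<le> max x ?c" "x \<le> max x ?c" by auto
  have "exp (- e / t) < 1" using small by (smt (verit) exp_gt_zero)
  then have "exp (- e / t) * max y ?c \<le> 1 * max y ?c" by (intro mult_right_mono) (auto simp: le_max_iff_disj)
  then have "?c < max y ?c" using less c by linarith
  then have y: "max y ?c = y" "?c < y" by (auto simp: max_def split: if_splits)
  have "exp (- 2 * z / t) = ?c * ?c" by (simp add: exp_add[symmetric])
  also have "\<dots> < ?c * y" using y(2) by simp
  also have "\<dots> \<le> (1 - exp (- e / t)) * y"
    using small y(2) less_trans[OF exp_gt_zero y(2)] by (intro mult_right_mono) auto
  also have "\<dots> \<le> y - x" using less c y(1) by (simp add: left_diff_distrib)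
  finally show ?thesis .
qed

definition grid_disc :: "nat \<Rightarrow> (real \<Rightarrow> real) \<Rightarrow> real \<Rightarrow> real" where
  "grid_disc m y = grid_path (mesh m) (cells m) (\<lambda>k. y (real k * mesh m))"

text \<open>Regularity of every path, not only of almost every one, so that the path-valued maps
  take values in the path space everywhere; \<open>regular_version\<close> reduces the general case
  to this one.\<close>

locale regular_subordinator = subordinator +
  assumes X_zero: "\<omega> \<in> space P \<Longrightarrow> X 0 \<omega> = 0"
    and X_cadlag: "\<omega> \<in> space P \<Longrightarrow> cadlag_on {0..} (\<lambda>t. X t \<omega>)"
    and X_mono: "\<omega> \<in> space P \<Longrightarrow> mono_on {0..} (\<lambda>t. X t \<omega>)"
begin

lemma X_le: "\<omega> \<in> space P \<Longrightarrow> 0 \<le> s \<Longrightarrow> s \<le> t \<Longrightarrow> X s \<omega> \<le> X t \<omega>"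
  using monotone_onD[OF X_mono, of \<omega> s t] by simp

lemma X_ge_0: "\<omega> \<in> space P \<Longrightarrow> 0 \<le> t \<Longrightarrow> 0 \<le> X t \<omega>"
  using X_le[of \<omega> 0 t] X_zero[of \<omega>] by simp

lemma truncated_path_eq:
  assumes "\<omega> \<in> space P" "0 < t"
  shows "truncated_path z X t \<omega> = (\<lambda>s\<in>{0..}. trunc z t (X (t * s) \<omega>))"
  unfolding truncated_path_def using assms X_ge_0
  by (intro restrict_ext trunc_eq) simp_all

lemma truncated_path_skorohod:
  assumes "\<omega> \<in> space P" "0 < t"
  shows "truncated_path z X t \<omega> \<in> skorohod_space"
  unfolding truncated_path_eq[OF assms]
  by (rule cadlag_on_compose_scaled[OF X_cadlag isCont_trunc]) (use assms in simp_all)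

lemma truncated_path_antimono:
  assumes "\<omega> \<in> space P" "0 < t"
  shows "antimono_on {0..} (truncated_path z X t \<omega>)"
  unfolding truncated_path_eq[OF assms]
  by (rule monotone_onI) (use assms in \<open>auto intro!: trunc_antimono X_le\<close>)

lemma truncated_path_disc:
  assumes "\<omega> \<in> space P" "0 < t"
  shows "grid_disc m (truncated_path z X t \<omega>) =
    grid_path (mesh m) (cells m) (\<lambda>k. trunc z t (X (t * (real k * mesh m)) \<omega>))"
  unfolding grid_disc_def truncated_path_eq[OF assms] by (simp add: less_imp_le)

lemma measurable_grid_disc:
  assumes "0 < t"
  shows "(\<lambda>\<omega>. grid_disc m (truncated_path z X t \<omega>)) \<in> P \<rightarrow>\<^sub>M borel_of j1_topology"
proof (subst measurable_cong)
  show "grid_disc m (truncated_path z X t \<omega>) = grid_path (mesh m) (cells m) (\<lambda>k. trunc z t (X (t * (real k * mesh m)) \<omega>))"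
    if "\<omega> \<in> space P" for \<omega> by (rule truncated_path_disc[OF that assms])
  show "(\<lambda>\<omega>. grid_path (mesh m) (cells m) (\<lambda>k. trunc z t (X (t * (real k * mesh m)) \<omega>))) \<in> P \<rightarrow>\<^sub>M borel_of j1_topology"
  proof (rule measurable_grid_path)
    fix k
    have "0 \<le> t * (real k * mesh m)" using assms by (simp add: less_imp_le)
    from measurable_X[OF this] show "(\<lambda>\<omega>. trunc z t (X (t * (real k * mesh m)) \<omega>)) \<in> borel_measurable P"
      by measurable
  qed simp
qed

lemma measurable_truncated_path:
  assumes "0 < t"
  shows "truncated_path z X t \<in> P \<rightarrow>\<^sub>M borel_of j1_topology"
proof (rule measurable_limit_j1[OF measurable_grid_disc[OF assms]])
  fix \<omega> assume "\<omega> \<in> space P"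
  note y = truncated_path_skorohod[OF this assms, of z] truncated_path_antimono[OF this assms, of z]
  show "limitin j1_topology (\<lambda>m. grid_disc m (truncated_path z X t \<omega>)) (truncated_path z X t \<omega>) sequentially"
    unfolding grid_disc_def by (rule grid_paths_converge) (use y in \<open>auto simp: skorohod_space_def\<close>)
qed

section \<open>Independent increments and double jumps\<close>

lemma increments:
  assumes "0 \<le> t 0" "\<And>i. i < n \<Longrightarrow> t i < t (Suc i)"
  shows "indep_vars (\<lambda>_. borel) (\<lambda>i \<omega>. X (t (Suc i)) \<omega> - X (t i) \<omega>) {..<n::nat}"
  using levy assms unfolding levy_process_def by blast

lemma increment_distr:
  "0 \<le> s \<Longrightarrow> 0 \<le> t \<Longrightarrow> distr P borel (\<lambda>\<omega>. X (s + t) \<omega> - X s \<omega>) = distr P borel (X t)"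
  using levy unfolding levy_process_def by blast

lemma prob_increment_gt:
  assumes "0 \<le> a" "0 \<le> r"
  shows "prob {\<omega> \<in> space P. c < X (a + r) \<omega> - X a \<omega>} = 1 - G r c"
proof -
  have [measurable]: "X (a + r) \<in> borel_measurable P" "X a \<in> borel_measurable P" "X r \<in> borel_measurable P"
    using measurable_X assms by auto
  have "prob {\<omega> \<in> space P. c < X (a + r) \<omega> - X a \<omega>} = measure (distr P borel (\<lambda>\<omega>. X (a + r) \<omega> - X a \<omega>)) {c<..}"
    by (subst measure_distr) (auto simp: vimage_def Int_def conj_commute)
  also have "\<dots> = measure (distr P borel (X r)) {c<..}" by (simp add: increment_distr[OF assms])
  also have "\<dots> = prob (space P - {\<omega> \<in> space P. X r \<omega> \<le> c})"
    by (subst measure_distr) (auto intro!: arg_cong[where f = prob])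
  also have "\<dots> = 1 - G r c" unfolding G_def by (rule prob_compl) measurable
  finally show ?thesis .
qed

text \<open>The second of two big jumps is independent of the first passage over \<open>c\<close>.\<close>

lemma double_jump_grid:
  assumes "0 \<le> a" "0 < r" "0 < N"
  defines "s \<equiv> \<lambda>i. a + r * real i / real N"
  shows "prob {\<omega> \<in> space P. \<exists>i\<in>{..N}. c < X (s i) \<omega> - X a \<omega> \<and> c < X (a + r) \<omega> - X (s i) \<omega>} \<le> (1 - G r c)\<^sup>2"
proof -
  have s0: "s 0 = a" and sN: "s N = a + r" using assms by (simp_all add: s_def)
  have s_mono: "s i \<le> s j" if "i \<le> j" for i j
    unfolding s_def using that assms by (intro add_left_mono divide_right_mono mult_left_mono) auto
  have s_nonneg: "0 \<le> s i" for i using s_mono[of 0 i] assms(1) s0 by simp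
  have [measurable]: "X (s i) \<in> borel_measurable P" for i by (rule measurable_X[OF s_nonneg])
  have [measurable]: "X a \<in> borel_measurable P" "X (a + r) \<in> borel_measurable P"
    using measurable_X assms by auto
  define D where "D i \<omega> = X (s (Suc i)) \<omega> - X (s i) \<omega>" for i \<omega>
  have ind: "indep_vars (\<lambda>_. borel) D {..<N}"
    unfolding D_def by (rule increments[OF s_nonneg]) (use assms in \<open>simp add: s_def divide_strict_right_mono\<close>)
  have tele: "(\<Sum>j<i. D j \<omega>) = X (s i) \<omega> - X a \<omega>" for i \<omega>
    unfolding D_def using sum_lessThan_telescope[of "\<lambda>i. X (s i) \<omega>" i] s0 by simp
  have tele': "(\<Sum>j\<in>{i..<N}. D j \<omega>) = X (a + r) \<omega> - X (s i) \<omega>" if "i \<le> N" for i \<omega>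
    unfolding D_def using sum_Suc_diff'[OF that, of "\<lambda>i. X (s i) \<omega>"] sN by simp
  define p where "p = 1 - G r c"
  have p: "prob {\<omega> \<in> space P. c < X (a + r) \<omega> - X a \<omega>} = p"
    unfolding p_def by (rule prob_increment_gt) (use assms in auto)
  \<comment> \<open>\<open>F i\<close> says that the first passage over \<open>c\<close> on the grid
    happens at \<open>i\<close>, which depends on the increments before \<open>i\<close>;
    \<open>B i\<close> depends on those from \<open>i\<close> on.\<close>
  define F where "F i = {\<omega> \<in> space P. c < X (s i) \<omega> - X a \<omega> \<and> (\<forall>j\<in>{..<i}. X (s j) \<omega> - X a \<omega> \<le> c)}" for i
  define B where "B i = {\<omega> \<in> space P. c < X (a + r) \<omega> - X (s i) \<omega>}" for i
  have [measurable]: "F i \<in> events" "B i \<in> events" for i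
    unfolding F_def B_def by measurable
  have FB: "prob (F i \<inter> B i) = prob (F i) * prob (B i)" if "i \<le> N" for i
  proof -
    have "indep_var (PiM {..<i} (\<lambda>_. borel)) (\<lambda>\<omega>. \<lambda>j\<in>{..<i}. D j \<omega>) (PiM {i..<N} (\<lambda>_. borel)) (\<lambda>\<omega>. \<lambda>j\<in>{i..<N}. D j \<omega>)"
      by (rule indep_var_restrict[OF ind]) (use that in auto)
    moreover define FS where "FS = {f \<in> space (PiM {..<i} (\<lambda>_. borel :: real measure)). c < (\<Sum>j<i. f j) \<and> (\<forall>k\<in>{..<i}. (\<Sum>j<k. f j) \<le> c)}"
    moreover define BS where "BS = {f \<in> space (PiM {i..<N} (\<lambda>_. borel :: real measure)). c < (\<Sum>j\<in>{i..<N}. f j)}"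
    moreover have "FS \<in> sets (PiM {..<i} (\<lambda>_. borel))"
    proof -
      have [measurable]: "(\<lambda>f. \<Sum>j<k. f j) \<in> borel_measurable (PiM {..<i} (\<lambda>_. borel :: real measure))" if "k \<le> i" for k
        by (intro borel_measurable_sum measurable_component_singleton) (use that in auto)
      have "{f \<in> space (PiM {..<i} (\<lambda>_. borel :: real measure)). c < (\<Sum>j<i. f j)} \<in> sets (PiM {..<i} (\<lambda>_. borel))"
        by measurable
      moreover have "{f \<in> space (PiM {..<i} (\<lambda>_. borel :: real measure)). \<forall>k\<in>{..<i}. (\<Sum>j<k. f j) \<le> c} \<in> sets (PiM {..<i} (\<lambda>_. borel))"
        by (intro sets.sets_Collect_finite_All; (measurable; simp)?)
      ultimately show ?thesis
        unfolding FS_def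
        using sets.Int[of "{f \<in> space (PiM {..<i} (\<lambda>_. borel :: real measure)). c < (\<Sum>j<i. f j)}" "PiM {..<i} (\<lambda>_. borel)"
          "{f \<in> space (PiM {..<i} (\<lambda>_. borel :: real measure)). \<forall>k\<in>{..<i}. (\<Sum>j<k. f j) \<le> c}"]
        by (simp add: Int_def conj_ac cong: conj_cong)
    qed
    moreover have "BS \<in> sets (PiM {i..<N} (\<lambda>_. borel))"
    proof -
      have [measurable]: "(\<lambda>f. \<Sum>j\<in>{i..<N}. f j) \<in> borel_measurable (PiM {i..<N} (\<lambda>_. borel :: real measure))"
        by (intro borel_measurable_sum measurable_component_singleton) auto
      show ?thesis unfolding BS_def by measurable
    qed
    ultimately have "prob ((\<lambda>\<omega>. (\<lambda>j\<in>{..<i}. D j \<omega>, \<lambda>j\<in>{i..<N}. D j \<omega>)) -` (FS \<times> BS) \<inter> space P) =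
        prob ((\<lambda>\<omega>. \<lambda>j\<in>{..<i}. D j \<omega>) -` FS \<inter> space P) * prob ((\<lambda>\<omega>. \<lambda>j\<in>{i..<N}. D j \<omega>) -` BS \<inter> space P)"
      by (intro indep_varD) auto
    moreover have "(\<lambda>\<omega>. \<lambda>j\<in>{..<i}. D j \<omega>) -` FS \<inter> space P = F i"
    proof -
      have "(\<Sum>j<k. (\<lambda>j\<in>{..<i}. D j \<omega>) j) = X (s k) \<omega> - X a \<omega>" if "k \<le> i" for k :: nat and \<omega>
        using that by (auto intro!: sum.cong simp flip: tele)
      then show ?thesis by (auto simp: FS_def F_def space_PiM)
    qed
    moreover have "(\<lambda>\<omega>. \<lambda>j\<in>{i..<N}. D j \<omega>) -` BS \<inter> space P = B i"
      using tele'[OF that] by (auto simp: BS_def B_def space_PiM)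
    moreover have "(\<lambda>\<omega>. (\<lambda>j\<in>{..<i}. D j \<omega>, \<lambda>j\<in>{i..<N}. D j \<omega>)) -` (FS \<times> BS) \<inter> space P =
      ((\<lambda>\<omega>. \<lambda>j\<in>{..<i}. D j \<omega>) -` FS \<inter> space P) \<inter> ((\<lambda>\<omega>. \<lambda>j\<in>{i..<N}. D j \<omega>) -` BS \<inter> space P)"
      by blast
    ultimately show ?thesis by simp
  qed
  \<comment> \<open>Increasing paths: what is gained after \<open>s i\<close> is at most what is
    gained after \<open>a\<close>.\<close>
  have pB: "prob (B i) \<le> p" for i
    unfolding p[symmetric] B_def
    by (intro finite_measure_mono) (use X_le[OF _ assms(1), of _ "s i"] s_mono[of 0 i] s0 in force, measurable)
  have F_disj: "F i \<inter> F j = {}" if "i < j" for i j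
  proof (intro equals0I)
    fix \<omega> assume "\<omega> \<in> F i \<inter> F j"
    then have "c < X (s i) \<omega> - X a \<omega>" "X (s i) \<omega> - X a \<omega> \<le> c" using that by (simp_all add: F_def)
    then show False by simp
  qed
  have disj: "disjoint_family_on F {..N}"
    unfolding disjoint_family_on_def
  proof (intro ballI impI)
    fix i j :: nat assume "i \<noteq> j"
    then show "F i \<inter> F j = {}" using F_disj[of i j] F_disj[of j i] by (cases "i < j") auto
  qed
  have "(\<Sum>i\<le>N. prob (F i)) = prob (\<Union>i\<le>N. F i)"
    by (rule finite_measure_finite_Union[symmetric]) (use disj in auto)
  also have "\<dots> \<le> p"
    unfolding p[symmetric]
  proof (intro finite_measure_mono subsetI)
    fix \<omega> assume "\<omega> \<in> (\<Union>i\<le>N. F i)"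
    then obtain i where "i \<le> N" "\<omega> \<in> space P" "c < X (s i) \<omega> - X a \<omega>" by (auto simp: F_def)
    then show "\<omega> \<in> {\<omega> \<in> space P. c < X (a + r) \<omega> - X a \<omega>}"
      using X_le[of \<omega> "s i" "s N"] s_mono[of i N] s_nonneg[of i] sN by auto
  qed measurable
  finally have sumF: "(\<Sum>i\<le>N. prob (F i)) \<le> p" .
  have p0: "0 \<le> p" unfolding p[symmetric] by simp
  have "prob {\<omega> \<in> space P. \<exists>i\<in>{..N}. c < X (s i) \<omega> - X a \<omega> \<and> c < X (a + r) \<omega> - X (s i) \<omega>} \<le> prob (\<Union>i\<le>N. F i \<inter> B i)"
  proof (intro finite_measure_mono subsetI)
    fix \<omega> assume "\<omega> \<in> {\<omega> \<in> space P. \<exists>i\<in>{..N}. c < X (s i) \<omega> - X a \<omega> \<and> c < X (a + r) \<omega> - X (s i) \<omega>}"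
    then obtain i where i: "\<omega> \<in> space P" "i \<le> N" "c < X (s i) \<omega> - X a \<omega>" "c < X (a + r) \<omega> - X (s i) \<omega>" by auto
    \<comment> \<open>Going back from \<open>i\<close> to the first passage \<open>k\<close> can
      only enlarge the increment that remains.\<close>
    define k where "k = (LEAST k. c < X (s k) \<omega> - X a \<omega>)"
    have k: "c < X (s k) \<omega> - X a \<omega>" "k \<le> i" unfolding k_def using i(3) by (auto intro: LeastI Least_le)
    have "\<not> c < X (s j) \<omega> - X a \<omega>" if "j < k" for j using that unfolding k_def by (rule not_less_Least)
    then have "\<omega> \<in> F k" using k i(1) by (auto simp: F_def not_less)
    moreover have "\<omega> \<in> B k"
      using i(1,4) X_le[OF i(1) s_nonneg s_mono[OF k(2)]] by (auto simp: B_def)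
    ultimately show "\<omega> \<in> (\<Union>i\<le>N. F i \<inter> B i)" using k(2) i(2) by auto
  qed auto
  also have "\<dots> \<le> (\<Sum>i\<le>N. prob (F i \<inter> B i))"
    by (rule finite_measure_subadditive_finite) auto
  also have "\<dots> \<le> (\<Sum>i\<le>N. prob (F i) * p)"
    by (intro sum_mono) (use FB pB in \<open>auto intro!: mult_left_mono\<close>)
  also have "\<dots> = (\<Sum>i\<le>N. prob (F i)) * p" by (simp add: sum_distrib_right)
  also have "\<dots> \<le> p * p" using sumF p0 by (rule mult_right_mono)
  finally show ?thesis by (simp add: p_def power2_eq_square)
qed

text \<open>Dyadic grids are nested, so their events increase and the bound survives the limit.
  Right-continuity moves a double jump at an arbitrary time to a nearby later grid time, so the
  countable union \<open>Z\<close> also covers the uncountably many times \<open>s\<close>.\<close>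

lemma double_jump:
  assumes "0 \<le> a" "0 < r" "0 \<le> c"
  shows "\<exists>Z\<in>events. prob Z \<le> (1 - G r c)\<^sup>2 \<and>
    (\<forall>\<omega>\<in>space P - Z. \<forall>s\<in>{a..a + r}. \<not> (c < X s \<omega> - X a \<omega> \<and> c < X (a + r) \<omega> - X s \<omega>))"
proof -
  define s where "s n i = a + r * real i / real (2 ^ n :: nat)" for n i
  define E where "E n = {\<omega> \<in> space P. \<exists>i\<in>{..2 ^ n :: nat}. c < X (s n i) \<omega> - X a \<omega> \<and> c < X (a + r) \<omega> - X (s n i) \<omega>}" for n
  have s_nonneg: "0 \<le> s n i" for n i using assms by (simp add: s_def)
  have [measurable]: "X (s n i) \<in> borel_measurable P" for n i by (rule measurable_X[OF s_nonneg])
  have [measurable]: "X a \<in> borel_measurable P" "X (a + r) \<in> borel_measurable P"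
    using measurable_X assms by auto
  have E: "E n \<in> events" for n unfolding E_def by measurable
  have "incseq E"
  proof (rule incseq_SucI, rule subsetI)
    fix n \<omega> assume "\<omega> \<in> E n"
    then obtain i where i: "\<omega> \<in> space P" "i \<le> 2 ^ n" "c < X (s n i) \<omega> - X a \<omega> \<and> c < X (a + r) \<omega> - X (s n i) \<omega>"
      by (auto simp: E_def)
    have "s (Suc n) (2 * i) = s n i" by (simp add: s_def)
    then show "\<omega> \<in> E (Suc n)" using i by (auto simp: E_def intro!: bexI[of _ "2 * i"])
  qed
  then have "(\<lambda>n. prob (E n)) \<longlonglongrightarrow> prob (\<Union>n. E n)"
    using E by (intro finite_Lim_measure_incseq) auto
  moreover have "prob (E n) \<le> (1 - G r c)\<^sup>2" for n
    using double_jump_grid[OF assms(1,2), of "2 ^ n" c] by (simp add: E_def s_def)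
  ultimately have "prob (\<Union>n. E n) \<le> (1 - G r c)\<^sup>2" by (intro LIMSEQ_le_const2) auto
  moreover have hit: "\<omega> \<in> (\<Union>n. E n)"
    if \<omega>: "\<omega> \<in> space P" and u: "u \<in> {a..a + r}" "c < X u \<omega> - X a \<omega>" "c < X (a + r) \<omega> - X u \<omega>" for \<omega> u
  proof -
    \<comment> \<open>At the right end the second increment is 0, so there is room to move to the
      right of \<open>u\<close>.\<close>
    have "u \<noteq> a + r" using u(3) assms(3) by auto
    then have "u < a + r" using u(1) by simp
    have "((\<lambda>t. X t \<omega>) \<longlongrightarrow> X u \<omega>) (at_right u)"
      by (rule cadlag_on_right_limit[OF X_cadlag[OF \<omega>]]) (use u(1) assms(1) in auto)
    then have "\<forall>\<^sub>F t in at_right u. X t \<omega> < X (a + r) \<omega> - c" using u(3) by (intro order_tendstoD(2)) auto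
    then obtain b where b: "u < b" "\<And>t. u < t \<Longrightarrow> t < b \<Longrightarrow> X t \<omega> < X (a + r) \<omega> - c"
      unfolding eventually_at_right_field by blast
    have near: "c < X (a + r) \<omega> - X t \<omega>" if "u \<le> t" "t < b" for t
      using b(2)[of t] that u(3) by (cases "t = u") auto
    obtain n where n: "(1 / 2 :: real) ^ n < (b - u) / r"
      using real_arch_pow_inv[of "(b - u) / r" "1 / 2"] b(1) assms(2) by auto
    \<comment> \<open>The first grid point at or after \<open>u\<close>; the level \<open>n\<close>
      makes the spacing \<open>r / 2 ^ n\<close> less than \<open>b - u\<close>.\<close>
    define i where "i = nat \<lceil>(u - a) * 2 ^ n / r\<rceil>"
    have "0 \<le> (u - a) * 2 ^ n / r" using u(1) assms(2) by simp
    then have i: "(u - a) * 2 ^ n / r \<le> real i" "real i < (u - a) * 2 ^ n / r + 1" unfolding i_def by linarith+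
    have "(u - a) * 2 ^ n / r \<le> 2 ^ n" using u(1) assms(2) by (simp add: pos_divide_le_eq)
    then have "\<lceil>(u - a) * 2 ^ n / r\<rceil> \<le> 2 ^ n" by (simp add: ceiling_le_iff)
    then have iN: "i \<le> 2 ^ n" unfolding i_def by (simp add: nat_le_iff)
    have "u \<le> s n i" using i(1) assms(2) by (simp add: s_def field_simps)
    moreover have "s n i < b"
    proof -
      have "real i * r < (u - a) * 2 ^ n + r" using i(2) assms(2) by (simp add: field_simps)
      moreover have "r < (b - u) * 2 ^ n" using n assms(2) by (simp add: field_simps)
      ultimately have "real i * r < (b - a) * 2 ^ n" by (simp add: algebra_simps)
      then show ?thesis by (simp add: s_def field_simps)
    qed
    ultimately have "c < X (a + r) \<omega> - X (s n i) \<omega>" "X u \<omega> \<le> X (s n i) \<omega>"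
      using near X_le[OF \<omega>, of u "s n i"] u(1) assms(1) by auto
    then have "\<omega> \<in> E n" using \<omega> u(2) iN by (auto simp: E_def intro!: bexI[of _ i])
    then show ?thesis by blast
  qed
  ultimately show ?thesis
  proof (intro bexI[of _ "\<Union>n. E n"] conjI ballI notI)
    fix \<omega> u
    assume "\<omega> \<in> space P - (\<Union>n. E n)" "u \<in> {a..a + r}" "c < X u \<omega> - X a \<omega> \<and> c < X (a + r) \<omega> - X u \<omega>"
    then show False using hit[of \<omega> u] by blast
  qed (use E in auto)
qed

lemma truncated_path_close:
  assumes S5: "cond_S5 \<nu> \<gamma>" and "0 < \<gamma>" "0 < z" "0 < d" "0 < e"
  shows "\<forall>\<^sub>F m in sequentially. \<forall>\<^sub>F t in at_right 0. \<exists>Z\<in>events. prob Z \<le> e \<and>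
    (\<forall>\<omega>\<in>space P - Z. truncated_path z X t \<omega> \<in> j1_nhd d (grid_disc m (truncated_path z X t \<omega>)))"
proof -
  \<comment> \<open>The grid path will be found near the path, whereas the claim is the reverse;
    \<open>d'\<close> meets the window condition of \<open>j1_nhd_sym\<close>.\<close>
  define d' where "d' = min d (1 / (1 / d + d))"
  have pos: "0 < 1 / d + d" using \<open>0 < d\<close> by (simp add: add_pos_pos)
  have d': "0 < d'" "d' \<le> d" using pos \<open>0 < d\<close> by (auto simp: d'_def)
  have "d' \<le> 1 / (1 / d + d)" by (simp add: d'_def)
  then have "1 / d + d \<le> 1 / d'" using d' pos by (simp add: pos_le_divide_eq mult.commute)
  then have d'': "1 / d + d' \<le> 1 / d'" using d' by simp
  \<comment> \<open>Twice the linear coefficient of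
    \<open>1 - exp (- \<gamma> * (2 * z * h))\<close> in \<open>h\<close>, so that the limiting
    probability is strictly below \<open>C * h\<close> and the actual one is so for small
    \<open>t\<close>.\<close>
  define C where "C = 4 * \<gamma> * z"
  have C: "0 < C" using assms by (simp add: C_def)
  have "\<forall>\<^sub>F m in sequentially. mesh m < d'"
    using d' by (intro order_tendstoD(2)[OF mesh_tendsto_0]) auto
  moreover have "\<forall>\<^sub>F m in sequentially. max (1 / d') (C\<^sup>2 / e) \<le> real m"
    by (rule eventually_sequentiallyI[of "nat \<lceil>max (1 / d') (C\<^sup>2 / e)\<rceil>"]) linarith
  ultimately show ?thesis
  proof eventually_elim
    case (elim m)
    define h K where "h = mesh m" and "K = cells m"
    have h: "0 < h" "h \<le> d'" using elim by (auto simp: h_def)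
    have Kh: "1 / d' \<le> real K * h" using elim cells_mesh[of m] by (simp add: h_def K_def)
    have "C\<^sup>2 / e \<le> real (Suc m)" using elim by simp
    then have "C\<^sup>2 * (1 / real (Suc m)) \<le> e"
      using \<open>0 < e\<close> by (simp add: pos_divide_le_eq mult.commute del: of_nat_Suc)
    also have "C\<^sup>2 * (1 / real (Suc m)) = real K * (C * h)\<^sup>2"
      unfolding cells_mesh_sq[symmetric] by (simp add: h_def K_def power_mult_distrib)
    finally have bound: "real K * (C * h)\<^sup>2 \<le> e" .
    \<comment> \<open>A cell lasts \<open>\<tau> = t * h\<close>, and
      \<open>exp (- 2 * z / t)\<close> equals \<open>exp (- (2 * z * h) / \<tau>)\<close>: on the
      time scale of one cell the jump threshold becomes the fixed level
      \<open>2 * z * h\<close>.\<close>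
    have "((\<lambda>\<tau>. 1 - G \<tau> (exp (- (2 * z * h) / \<tau>))) \<longlongrightarrow> 1 - exp (- \<gamma> * (2 * z * h))) (at_right 0)"
      using h assms by (intro tendsto_diff tendsto_const S5_imp_tail[OF S5]) auto
    moreover have "1 - exp (- \<gamma> * (2 * z * h)) < C * h"
    proof -
      have "1 - exp (- \<gamma> * (2 * z * h)) \<le> \<gamma> * (2 * z * h)"
        using exp_ge_add_one_self[of "- \<gamma> * (2 * z * h)"] by simp
      moreover have "0 < \<gamma> * z * h" using assms h by simp
      ultimately show ?thesis by (simp add: C_def)
    qed
    ultimately have "\<forall>\<^sub>F \<tau> in at_right 0. 1 - G \<tau> (exp (- (2 * z * h) / \<tau>)) < C * h"
      by (rule order_tendstoD(2))
    moreover have "filterlim (\<lambda>t. t * h) (at_right 0) (at_right 0)" using h by real_asymp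
    ultimately have "\<forall>\<^sub>F t in at_right 0. 1 - G (t * h) (exp (- (2 * z * h) / (t * h))) < C * h"
      by (rule eventually_compose_filterlim)
    moreover have "\<forall>\<^sub>F t in at_right 0. exp (- d' / t) + exp (- z / t) < 1"
    proof -
      have "((\<lambda>t. exp (- d' / t) + exp (- z / t)) \<longlongrightarrow> 0) (at_right 0)"
      proof -
        have "((\<lambda>t. exp (- x / t)) \<longlongrightarrow> 0) (at_right 0)" if "0 < x" for x :: real
          using that by real_asymp
        from tendsto_add[OF this[OF d'(1)] this[OF \<open>0 < z\<close>]] show ?thesis by simp
      qed
      then show ?thesis by (rule order_tendstoD(2)) simp
    qed
    ultimately show ?case
      using eventually_at_right_less[of "0::real"]
    proof eventually_elim
      case (elim t)
      define c where "c = exp (- 2 * z / t)"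
      have "- (2 * z * h) / (t * h) = - 2 * z / t" using h by simp
      then have G1: "1 - G (t * h) c < C * h" using elim(1) by (simp only: c_def)
      have G0: "0 \<le> 1 - G (t * h) c" using G_bounds(2)[of "t * h" c] by simp
      have "\<exists>Z\<in>events. prob Z \<le> (1 - G (t * h) c)\<^sup>2 \<and> (\<forall>\<omega>\<in>space P - Z. \<forall>s\<in>{t * (real k * h)..t * (real k * h) + t * h}.
          \<not> (c < X s \<omega> - X (t * (real k * h)) \<omega> \<and> c < X (t * (real k * h) + t * h) \<omega> - X s \<omega>))" for k
        by (rule double_jump) (use elim(3) h in \<open>auto simp: c_def\<close>)
      then obtain Z where Z: "\<And>k. Z k \<in> events" "\<And>k. prob (Z k) \<le> (1 - G (t * h) c)\<^sup>2"
        "\<And>k \<omega> s. \<omega> \<in> space P - Z k \<Longrightarrow> s \<in> {t * (real k * h)..t * (real k * h) + t * h} \<Longrightarrow>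
          \<not> (c < X s \<omega> - X (t * (real k * h)) \<omega> \<and> c < X (t * (real k * h) + t * h) \<omega> - X s \<omega>)"
        by metis
      have "prob (\<Union>k<K. Z k) \<le> (\<Sum>k<K. prob (Z k))"
        by (rule finite_measure_subadditive_finite) (use Z in auto)
      also have "\<dots> \<le> (\<Sum>k<K. (C * h)\<^sup>2)"
      proof (rule sum_mono)
        fix k
        have "(1 - G (t * h) c)\<^sup>2 \<le> (C * h)\<^sup>2" using G0 G1 by (intro power_mono) auto
        then show "prob (Z k) \<le> (C * h)\<^sup>2" using Z(2)[of k] by simp
      qed
      also have "\<dots> \<le> e" using bound by simp
      finally have pZ: "prob (\<Union>k<K. Z k) \<le> e" .
      have "truncated_path z X t \<omega> \<in> j1_nhd d (grid_disc m (truncated_path z X t \<omega>))"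
        if \<omega>: "\<omega> \<in> space P" "\<omega> \<notin> (\<Union>k<K. Z k)" for \<omega>
      proof -
        note sk = truncated_path_skorohod[OF \<omega>(1) elim(3), of z]
        have val: "truncated_path z X t \<omega> s = trunc z t (X (t * s) \<omega>)" if "0 \<le> s" for s
          using that by (simp add: truncated_path_eq[OF \<omega>(1) elim(3)])
        have "grid_path h K (\<lambda>k. truncated_path z X t \<omega> (real k * h)) \<in> j1_nhd d' (truncated_path z X t \<omega>)"
        proof (rule grid_path_in_j1_nhd[where d = d' and K = K])
          fix k s assume k: "k < K" "s \<in> {real k * h..real (Suc k) * h}"
          have kh: "0 \<le> real k * h" using h by simp
          have ends: "t * (real k * h) + t * h = t * (real (Suc k) * h)" by (simp add: algebra_simps)
          have "t * s \<in> {t * (real k * h)..t * (real k * h) + t * h}"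
            unfolding ends using k(2) elim(3) by simp
          then have nj: "\<not> (c < X (t * s) \<omega> - X (t * (real k * h)) \<omega> \<and> c < X (t * (real (Suc k) * h)) \<omega> - X (t * s) \<omega>)"
            using Z(3)[of \<omega> k "t * s"] \<omega> k(1) unfolding ends by blast
          have s: "0 \<le> s" "0 \<le> real (Suc k) * h"
            using k(2) h order_trans[OF kh, of s] by auto
          have "trunc z t (X (t * (real k * h)) \<omega>) - trunc z t (X (t * s) \<omega>) \<le> d' \<or>
              trunc z t (X (t * s) \<omega>) - trunc z t (X (t * (real (Suc k) * h)) \<omega>) \<le> d'"
          proof (rule ccontr)
            assume "\<not> ?thesis"
            then have "c < X (t * s) \<omega> - X (t * (real k * h)) \<omega>" "c < X (t * (real (Suc k) * h)) \<omega> - X (t * s) \<omega>"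
              unfolding c_def not_le de_Morgan_disj
              by (blast intro: trunc_drop[OF elim(3) less_imp_le[OF elim(2)]])+
            with nj show False by blast
          qed
          then show "truncated_path z X t \<omega> (real k * h) - truncated_path z X t \<omega> s \<le> d' \<or>
              truncated_path z X t \<omega> s - truncated_path z X t \<omega> (real (Suc k) * h) \<le> d'"
            unfolding val[OF kh] val[OF s(1)] val[OF s(2)] .
        qed (use h d' Kh sk truncated_path_antimono[OF \<omega>(1) elim(3)] in \<open>auto simp: skorohod_space_def\<close>)
        then have "grid_disc m (truncated_path z X t \<omega>) \<in> j1_nhd d' (truncated_path z X t \<omega>)"
          by (simp add: grid_disc_def h_def K_def)
        from j1_nhd_sym[OF this sk d' d''] show ?thesis .
      qed
      moreover have "(\<Union>k<K. Z k) \<in> events" using Z(1) by auto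
      ultimately show ?case using pZ by blast
    qed
  qed
qed

end

text \<open>Independence is a property of the joint law, and changing countably many variables on
  null sets leaves that law as it is.\<close>

lemma (in prob_space) indep_vars_cong_AE:
  fixes I :: "'i set" and Y Y' :: "'i \<Rightarrow> 'a \<Rightarrow> 'b"
  assumes ind: "indep_vars M' Y I" and "countable I"
    and Y': "\<And>i. i \<in> I \<Longrightarrow> Y' i \<in> M \<rightarrow>\<^sub>M M' i" and ae: "\<And>i. i \<in> I \<Longrightarrow> AE \<omega> in M. Y' i \<omega> = Y i \<omega>"
  shows "indep_vars M' Y' I"
proof (cases "I = {}")
  case True
  then show ?thesis by (simp add: indep_vars_def indep_sets_def)
next
  case False
  have Y: "Y i \<in> M \<rightarrow>\<^sub>M M' i" if "i \<in> I" for i using ind that by (simp add: indep_vars_def)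
  have "AE \<omega> in M. \<forall>i\<in>I. Y' i \<omega> = Y i \<omega>"
    using ae by (subst AE_ball_countable[OF \<open>countable I\<close>]) blast
  then have "AE \<omega> in M. (\<lambda>i\<in>I. Y' i \<omega>) = (\<lambda>i\<in>I. Y i \<omega>)"
    by eventually_elim auto
  then have "distr M (PiM I M') (\<lambda>\<omega>. \<lambda>i\<in>I. Y' i \<omega>) = distr M (PiM I M') (\<lambda>\<omega>. \<lambda>i\<in>I. Y i \<omega>)"
    by (intro distr_cong_AE measurable_restrict Y Y') auto
  also have "\<dots> = (PiM I (\<lambda>i. distr M (M' i) (Y i)))"
    using ind by (subst (asm) indep_vars_iff_distr_eq_PiM'[OF False Y]) auto
  also have "\<dots> = (PiM I (\<lambda>i. distr M (M' i) (Y' i)))"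
  proof (intro PiM_cong distr_cong_AE refl Y Y')
    fix i assume "i \<in> I"
    from ae[OF this] show "AE \<omega> in M. Y i \<omega> = Y' i \<omega>" by eventually_elim simp
  qed
  finally show ?thesis
    by (subst indep_vars_iff_distr_eq_PiM'[OF False Y']) auto
qed

context subordinator
begin

text \<open>All bad paths lie in one measurable null set, on which the process is set to 0 at all
  times simultaneously; the laws of the increments do not notice.\<close>

lemma regular_version:
  "\<exists>X'. regular_subordinator P X' \<nu> \<and> (AE \<omega> in P. \<forall>t\<ge>0. X' t \<omega> = X t \<omega>)"
proof -
  define R where "R \<omega> \<longleftrightarrow> X 0 \<omega> = 0 \<and> cadlag_on {0..} (\<lambda>t. X t \<omega>) \<and> mono_on {0..} (\<lambda>t. X t \<omega>)" for \<omega>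
  have "AE \<omega> in P. X 0 \<omega> = 0" "AE \<omega> in P. cadlag_on {0..} (\<lambda>t. X t \<omega>)" "AE \<omega> in P. mono_on {0..} (\<lambda>t. X t \<omega>)"
    using X levy by (simp_all add: pure_jump_subordinator_def levy_process_def)
  then have "AE \<omega> in P. R \<omega>" unfolding R_def by eventually_elim blast
  then obtain N where N: "{\<omega> \<in> space P. \<not> R \<omega>} \<subseteq> N" "N \<in> events" "emeasure P N = 0"
    by (rule AE_E)
  define X' where "X' t \<omega> = (if \<omega> \<in> N then 0 else X t \<omega>)" for t \<omega>
  have "AE \<omega> in P. \<omega> \<notin> N" using N by (intro AE_not_in) auto
  then have ae: "AE \<omega> in P. \<forall>t. X' t \<omega> = X t \<omega>" by eventually_elim (simp add: X'_def)
  have meas: "X' t \<in> borel_measurable P" if "0 \<le> t" for t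
    unfolding X'_def[abs_def] using N(2) measurable_X[OF that] by measurable
  have reg: "X' 0 \<omega> = 0 \<and> cadlag_on {0..} (\<lambda>t. X' t \<omega>) \<and> mono_on {0..} (\<lambda>t. X' t \<omega>)" if "\<omega> \<in> space P" for \<omega>
  proof (cases "\<omega> \<in> N")
    case True
    have "cadlag_on {0..} (\<lambda>_. 0)" by (auto simp: cadlag_on_def)
    then show ?thesis using True by (simp add: X'_def monotone_on_def)
  next
    case False
    then have "R \<omega>" using N(1) that by blast
    then show ?thesis using False by (simp add: X'_def R_def)
  qed
  have ind: "indep_vars (\<lambda>_. borel) (\<lambda>i \<omega>. X' (t (Suc i)) \<omega> - X' (t i) \<omega>) {..<n}"
    if t: "0 \<le> t 0 \<and> (\<forall>i<n. t i < t (Suc i))" for n :: nat and t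
  proof (rule indep_vars_cong_AE)
    show "indep_vars (\<lambda>_. borel) (\<lambda>i \<omega>. X (t (Suc i)) \<omega> - X (t i) \<omega>) {..<n}"
      using levy t unfolding levy_process_def by blast
    have tpos: "0 \<le> t i" if "i \<le> n" for i
      using that by (induction i) (use t in \<open>auto intro: order_trans less_imp_le simp: Suc_le_eq\<close>)
    show "(\<lambda>\<omega>. X' (t (Suc i)) \<omega> - X' (t i) \<omega>) \<in> borel_measurable P" if "i \<in> {..<n}" for i
      using that by (intro borel_measurable_diff meas tpos) auto
    show "AE \<omega> in P. X' (t (Suc i)) \<omega> - X' (t i) \<omega> = X (t (Suc i)) \<omega> - X (t i) \<omega>" for i
      using ae by eventually_elim simp
  qed auto
  have stat: "distr P borel (\<lambda>\<omega>. X' (s + t) \<omega> - X' s \<omega>) = distr P borel (X' t)" if "0 \<le> s" "0 \<le> t" for s t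
  proof -
    have "distr P borel (\<lambda>\<omega>. X' (s + t) \<omega> - X' s \<omega>) = distr P borel (\<lambda>\<omega>. X (s + t) \<omega> - X s \<omega>)"
      by (intro distr_cong_AE borel_measurable_diff meas measurable_X refl) (use that ae in \<open>auto elim!: eventually_mono\<close>)
    also have "\<dots> = distr P borel (X t)" using levy that unfolding levy_process_def by blast
    also have "\<dots> = distr P borel (X' t)"
      by (intro distr_cong_AE meas measurable_X refl) (use that ae in \<open>auto elim!: eventually_mono\<close>)
    finally show ?thesis .
  qed
  have "levy_process P X'"
    unfolding levy_process_def
    by (intro conjI allI impI prob_space_axioms meas AE_I2 ind stat) (use reg in auto)
  moreover have "(LINT \<omega>|P. exp (- u * X' t \<omega>)) = exp (- t * \<phi> u)" if "0 \<le> t" "0 \<le> u" for t u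
  proof -
    have [measurable]: "X' t \<in> borel_measurable P" "X t \<in> borel_measurable P" using meas measurable_X that by auto
    have "(LINT \<omega>|P. exp (- u * X' t \<omega>)) = (LINT \<omega>|P. exp (- u * X t \<omega>))"
    proof (rule integral_cong_AE)
      show "AE \<omega> in P. exp (- u * X' t \<omega>) = exp (- u * X t \<omega>)" using ae by eventually_elim simp
    qed measurable
    then show ?thesis using laplace[OF that] by simp
  qed
  ultimately have "pure_jump_subordinator P X' \<nu>"
    using X reg unfolding pure_jump_subordinator_def by (auto intro!: AE_I2)
  then have "regular_subordinator P X' \<nu>"
    using reg by unfold_locales auto
  moreover have "AE \<omega> in P. \<forall>t\<ge>0. X' t \<omega> = X t \<omega>" using ae by eventually_elim simp
  ultimately show ?thesis by blast
qed

end

section \<open>Coupling on a grid\<close>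

lemma measure_exponential_law:
  assumes "0 < \<gamma>"
  shows "measure (exponential_law \<gamma>) {v<..} = exp (- \<gamma> * max 0 v)"
proof (cases "0 \<le> v")
  case False
  interpret real_distribution "exponential_law \<gamma>" by (rule exponential_law(1)[OF assms])
  have "AE x in exponential_law \<gamma>. x \<in> {v<..}"
    using exponential_law(2)[OF assms] by eventually_elim (use False in simp)
  then have "prob {v<..} = 1" by (subst prob_eq_1) auto
  then show ?thesis using False by (simp add: max_def)
qed (use exponential_law(4)[OF assms] in \<open>simp add: max_def\<close>)

lemma cdf_exponential_law: "0 < \<gamma> \<Longrightarrow> cdf (exponential_law \<gamma>) v = 1 - exp (- \<gamma> * max 0 v)"
  using measure_greaterThan_cdf[OF exponential_law(1), of \<gamma> v] measure_exponential_law[of \<gamma> v] by simp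

lemma exponential_law_scale:
  assumes "0 < \<gamma>"
  shows "distr (exponential_law 1) borel (\<lambda>x. x / \<gamma>) = exponential_law \<gamma>"
proof (rule cdf_unique)
  interpret real_distribution "exponential_law 1" by (rule exponential_law(1)) simp
  show rd: "real_distribution (distr (exponential_law 1) borel (\<lambda>x. x / \<gamma>))"
    by (rule real_distribution_distr) simp
  show "real_distribution (exponential_law \<gamma>)" by (rule exponential_law(1)[OF assms])
  have "(\<lambda>x. x / \<gamma>) -` {..v} = {..\<gamma> * v}" for v using assms by (auto simp: field_simps)
  then have "cdf (distr (exponential_law 1) borel (\<lambda>x. x / \<gamma>)) v = cdf (exponential_law 1) (\<gamma> * v)" for v
    by (simp add: cdf_def2 measure_distr)
  moreover have "max 0 (\<gamma> * v) = \<gamma> * max 0 v" for v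
    using assms by (auto simp: max_def zero_le_mult_iff)
  ultimately show "cdf (distr (exponential_law 1) borel (\<lambda>x. x / \<gamma>)) = cdf (exponential_law \<gamma>)"
    using assms by (intro ext) (simp add: cdf_exponential_law)
qed

primrec run_min :: "real \<Rightarrow> (nat \<Rightarrow> real) \<Rightarrow> nat \<Rightarrow> real" where
  "run_min z w 0 = z"
| "run_min z w (Suc k) = min (run_min z w k) (w (Suc k))"

lemma run_min_cong: "(\<And>i. i \<in> {1..k} \<Longrightarrow> w i = w' i) \<Longrightarrow> run_min z w k = run_min z w' k"
  by (induction k) auto

lemma tendsto_run_min:
  assumes "\<And>i. i \<in> {1..k} \<Longrightarrow> (\<lambda>n. w n i) \<longlonglongrightarrow> w' i"
  shows "(\<lambda>n. run_min z (w n) k) \<longlonglongrightarrow> run_min z w' k"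
  using assms by (induction k) (auto intro!: tendsto_min)

lemma run_min_Min:
  assumes "0 < c"
  shows "run_min z (\<lambda>i. c * w i) k = (if k = 0 then z else min z (c * Min (w ` {1..k})))"
proof (induction k)
  case (Suc k)
  show ?case
  proof (cases "k = 0")
    case False
    have "Min (w ` {1..Suc k}) = min (w (Suc k)) (Min (w ` {1..k}))"
      using False by (simp add: atLeastAtMostSuc_conv)
    moreover have "c * min x y = min (c * x) (c * y)" for x y :: real
      using assms by (simp add: min_mult_distrib_left)
    ultimately show ?thesis using Suc False by (simp add: min.assoc min.commute min.left_commute)
  qed simp
qed simp

lemma measurable_run_min:
  assumes "\<And>i. i \<in> {1..k} \<Longrightarrow> (\<lambda>\<omega>. w \<omega> i) \<in> borel_measurable M"
  shows "(\<lambda>\<omega>. run_min z (w \<omega>) k) \<in> borel_measurable M"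
  using assms by (induction k) (auto intro!: borel_measurable_min)

text \<open>On the scale \<open>- t log\<close> a sum of positive numbers is given by its largest term.\<close>

lemma trunc_sum_bounds:
  assumes "0 < t"
  shows "run_min z w k - t * ln (real (Suc k)) \<le> trunc z t (\<Sum>i\<in>{1..k}. exp (- w i / t))"
    and "trunc z t (\<Sum>i\<in>{1..k}. exp (- w i / t)) \<le> run_min z w k"
proof -
  define M where "M k = max (\<Sum>i\<in>{1..k}. exp (- w i / t)) (exp (- z / t))" for k
  have e_min: "exp (- min x y / t) = max (exp (- x / t)) (exp (- y / t))" for x y
    using assms by (auto simp: min_def max_def divide_le_cancel)
  \<comment> \<open>The \<open>k\<close> summands and the truncation level make \<open>Suc k\<close>
    terms, each at most \<open>exp (- run_min z w k / t)\<close>; the factor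
    \<open>real (Suc k)\<close> turns into the error \<open>t * ln (real (Suc k))\<close>.\<close>
  have M: "exp (- run_min z w k / t) \<le> M k \<and> M k \<le> real (Suc k) * exp (- run_min z w k / t)"
  proof (induction k)
    case 0
    then show ?case by (simp add: M_def)
  next
    case (Suc k)
    let ?e = "exp (- w (Suc k) / t)" and ?r = "exp (- run_min z w k / t)"
    have sum: "(\<Sum>i\<in>{1..Suc k}. exp (- w i / t)) = (\<Sum>i\<in>{1..k}. exp (- w i / t)) + ?e" by simp
    have s0: "0 \<le> (\<Sum>i\<in>{1..k}. exp (- w i / t))" by (intro sum_nonneg) auto
    have "max s c \<le> max (s + e) c \<and> e \<le> max (s + e) c \<and> max (s + e) c \<le> max s c + e"
      if "0 \<le> s" "0 < e" "0 < c" for s e c :: real using that by (auto simp: max_def)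
    from this[OF s0 exp_gt_zero[of "- w (Suc k) / t"] exp_gt_zero[of "- z / t"]]
    have "M k \<le> M (Suc k)" "?e \<le> M (Suc k)" "M (Suc k) \<le> M k + ?e"
      unfolding M_def sum by auto
    moreover have "real (Suc k) * ?r + ?e \<le> real (Suc (Suc k)) * max ?r ?e"
    proof -
      have "real (Suc k) * ?r + ?e \<le> real (Suc k) * max ?r ?e + max ?r ?e"
        by (intro add_mono mult_left_mono) auto
      then show ?thesis by (simp add: algebra_simps)
    qed
    ultimately show ?case using Suc unfolding run_min.simps e_min by (auto simp: max_def split: if_splits)
  qed
  have Mpos: "0 < M k" by (simp add: M_def less_max_iff_disj)
  have eq: "trunc z t (\<Sum>i\<in>{1..k}. exp (- w i / t)) = - t * ln (M k)" by (simp add: trunc_def M_def)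
  have "- run_min z w k / t \<le> ln (M k)"
    using M Mpos ln_le_cancel_iff[of "exp (- run_min z w k / t)" "M k"] by simp
  then show "trunc z t (\<Sum>i\<in>{1..k}. exp (- w i / t)) \<le> run_min z w k"
    unfolding eq using assms pos_divide_le_eq[of t "- run_min z w k" "ln (M k)"] by (simp add: mult.commute)
  have "ln (M k) \<le> ln (real (Suc k) * exp (- run_min z w k / t))"
    using M Mpos by (subst ln_le_cancel_iff) simp_all
  also have "\<dots> = ln (real (Suc k)) - run_min z w k / t" by (simp add: ln_mult del: of_nat_Suc)
  finally have "t * ln (M k) \<le> t * (ln (real (Suc k)) - run_min z w k / t)" using assms by (intro mult_left_mono) auto
  also have "\<dots> = t * ln (real (Suc k)) - run_min z w k" using assms by (simp add: right_diff_distrib del: of_nat_Suc)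
  finally show "run_min z w k - t * ln (real (Suc k)) \<le> trunc z t (\<Sum>i\<in>{1..k}. exp (- w i / t))"
    unfolding eq by simp
qed

lemma trunc_sum_tendsto:
  assumes t: "\<And>n. 0 < t n" "t \<longlonglongrightarrow> 0" and w: "\<And>i. i \<in> {1..k} \<Longrightarrow> (\<lambda>n. w n i) \<longlonglongrightarrow> w' i"
  shows "(\<lambda>n. trunc z (t n) (\<Sum>i\<in>{1..k}. exp (- w n i / t n))) \<longlonglongrightarrow> run_min z w' k"
proof (rule tendsto_sandwich)
  have "(\<lambda>n. run_min z (w n) k - t n * ln (real (Suc k))) \<longlonglongrightarrow> run_min z w' k - 0 * ln (real (Suc k))"
    by (intro tendsto_diff tendsto_mult tendsto_run_min w t tendsto_const)
  then show "(\<lambda>n. run_min z (w n) k - t n * ln (real (Suc k))) \<longlonglongrightarrow> run_min z w' k" by simp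
  show "(\<lambda>n. run_min z (w n) k) \<longlonglongrightarrow> run_min z w' k" by (rule tendsto_run_min[OF w])
qed (use trunc_sum_bounds[OF t(1)] in \<open>auto intro!: always_eventually\<close>)

section \<open>Convergence of \<open>- t log X\<close> at small times\<close>

context subordinator
begin

text \<open>\<open>cond_S5\<close> makes \<open>\<phi>\<close> unbounded, and
  \<open>exp (- t * \<phi> s)\<close> bounds the mass at 0 for every \<open>s\<close>.\<close>

lemma prob_X_zero:
  assumes S5: "cond_S5 \<nu> \<gamma>" and "0 < \<gamma>" "0 < t"
  shows "G t 0 = 0"
proof -
  have "filterlim (\<lambda>s. \<phi> s / ln s * ln s) at_top at_top"
    by (rule filterlim_tendsto_pos_mult_at_top[OF S5[unfolded cond_S5_def] \<open>0 < \<gamma>\<close> ln_at_top])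
  then have "filterlim \<phi> at_top at_top"
  proof (rule filterlim_mono_eventually[OF _ order_refl order_refl])
    show "\<forall>\<^sub>F s in at_top. \<phi> s / ln s * ln s = \<phi> s"
      using eventually_gt_at_top[of "1::real"] by eventually_elim simp
  qed
  from filterlim_tendsto_pos_mult_at_top[OF tendsto_const \<open>0 < t\<close> this]
  have "filterlim (\<lambda>s. - t * \<phi> s) at_bot at_top" by (simp add: filterlim_uminus_at_top)
  from filterlim_compose[OF exp_at_bot this] have "((\<lambda>s. exp (- t * \<phi> s)) \<longlongrightarrow> 0) at_top" .
  moreover have "\<forall>\<^sub>F s in at_top. G t 0 \<le> exp (- t * \<phi> s)"
    using eventually_ge_at_top[of "0::real"] by eventually_elim (use G_le_laplace[of t _ 0] \<open>0 < t\<close> in force)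
  ultimately have "G t 0 \<le> 0" by (intro tendsto_lowerbound[of _ 0 at_top]) auto
  then show ?thesis using G_bounds(1)[of t 0] by simp
qed

lemma X_pos:
  assumes "cond_S5 \<nu> \<gamma>" "0 < \<gamma>" "0 < t"
  shows "AE \<omega> in P. 0 < X t \<omega>"
proof -
  have [measurable]: "X t \<in> borel_measurable P" using measurable_X assms(3) by simp
  have "prob {\<omega> \<in> space P. X t \<omega> \<le> 0} = 0" using prob_X_zero[OF assms] by (simp add: G_def)
  then have "AE \<omega> in P. \<not> X t \<omega> \<le> 0" by (subst (asm) prob_eq_0) (auto elim: AE_mp)
  then show ?thesis by eventually_elim simp
qed

lemma weak_conv_log:
  assumes S5: "cond_S5 \<nu> \<gamma>" and "0 < \<gamma>" and t: "\<And>n. 0 < t n" "t \<longlonglongrightarrow> 0"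
  shows "weak_conv_m (\<lambda>n. distr P borel (\<lambda>\<omega>. - t n * ln (X (t n) \<omega>))) (exponential_law \<gamma>)"
  unfolding weak_conv_m_def weak_conv_def
proof (intro allI impI order_tendstoI)
  have X_meas [measurable]: "X (t n) \<in> borel_measurable P" for n using measurable_X[of "t n"] t(1)[of n] by simp
  define F where "F n v = cdf (distr P borel (\<lambda>\<omega>. - t n * ln (X (t n) \<omega>))) v" for n v
  have F: "F n v = prob {\<omega> \<in> space P. - t n * ln (X (t n) \<omega>) \<le> v}" for n v
    unfolding F_def cdf_def2 by (subst measure_distr) (auto simp: vimage_def Int_def conj_commute)
  have pos: "AE \<omega> in P. 0 < X (t n) \<omega>" for n by (rule X_pos[OF S5 \<open>0 < \<gamma>\<close> t(1)])
  have ln_iff: "x \<le> exp (- w / t n) \<longleftrightarrow> w \<le> - t n * ln x" if "0 < x" for x w n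
  proof -
    have "x \<le> exp (- w / t n) \<longleftrightarrow> ln x \<le> - w / t n" using that ln_le_cancel_iff[of x "exp (- w / t n)"] by simp
    also have "\<dots> \<longleftrightarrow> ln x * t n \<le> - w" using pos_le_divide_eq[OF t(1), of "ln x" "- w" n] by simp
    also have "\<dots> \<longleftrightarrow> w \<le> - t n * ln x" using mult.commute[of "t n" "ln x"] by linarith
    finally show ?thesis .
  qed
  have compl: "1 - G (t n) (exp (- w / t n)) = prob {\<omega> \<in> space P. \<not> w \<le> - t n * ln (X (t n) \<omega>)}" for w n
  proof -
    have "G (t n) (exp (- w / t n)) = prob {\<omega> \<in> space P. w \<le> - t n * ln (X (t n) \<omega>)}"
      unfolding G_def
    proof (rule finite_measure_eq_AE)
      show "AE \<omega> in P. \<omega> \<in> {\<omega> \<in> space P. X (t n) \<omega> \<le> exp (- w / t n)} \<longleftrightarrow> \<omega> \<in> {\<omega> \<in> space P. w \<le> - t n * ln (X (t n) \<omega>)}"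
        using pos[of n] by eventually_elim (simp only: mem_Collect_eq ln_iff)
    qed measurable
    then have "1 - G (t n) (exp (- w / t n)) = prob (space P - {\<omega> \<in> space P. w \<le> - t n * ln (X (t n) \<omega>)})"
      by (subst prob_compl) auto
    also have "space P - {\<omega> \<in> space P. w \<le> - t n * ln (X (t n) \<omega>)} = {\<omega> \<in> space P. \<not> w \<le> - t n * ln (X (t n) \<omega>)}" by blast
    finally show ?thesis .
  qed
  have tright: "filterlim t (at_right 0) sequentially"
    unfolding filterlim_at using t(2) by (simp add: t(1) less_imp_neq[OF t(1), symmetric])
  have tail: "(\<lambda>n. 1 - G (t n) (exp (- w / t n))) \<longlonglongrightarrow> 1 - exp (- \<gamma> * w)" if "0 < w" for w
    by (intro tendsto_diff tendsto_const filterlim_compose[OF S5_imp_tail[OF S5 that] tright])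
  fix v a
  {
    assume a: "a < cdf (exponential_law \<gamma>) v"
    show "\<forall>\<^sub>F n in sequentially. a < cdf (distr P borel (\<lambda>\<omega>. - t n * ln (X (t n) \<omega>))) v"
    proof (cases "0 < v")
      case True
      have "\<forall>\<^sub>F n in sequentially. a < 1 - G (t n) (exp (- v / t n))"
        using tail[OF True] by (rule order_tendstoD(1)) (use a True \<open>0 < \<gamma>\<close> in \<open>simp add: cdf_exponential_law max_def\<close>)
      then show ?thesis
      proof eventually_elim
        case (elim n)
        have "1 - G (t n) (exp (- v / t n)) \<le> F n v"
          unfolding compl F by (intro finite_measure_mono) auto
        then show ?case using elim by (simp add: F_def)
      qed
    next
      case False
      then have "a < 0" using a \<open>0 < \<gamma>\<close> by (simp add: cdf_exponential_law max_def split: if_splits)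
      moreover have "0 \<le> F n v" for n unfolding F by simp
      ultimately show ?thesis unfolding F_def by (intro always_eventually) (auto intro: less_le_trans)
    qed
  next
    assume a: "cdf (exponential_law \<gamma>) v < a"
    have "((\<lambda>d. 1 - exp (- \<gamma> * (max 0 v + d))) \<longlongrightarrow> 1 - exp (- \<gamma> * (max 0 v + 0))) (at_right 0)"
      by (intro tendsto_intros)
    from at_right_ex(2)[OF this zero_less_one, of a] obtain d where d: "0 < d" "1 - exp (- \<gamma> * (max 0 v + d)) < a"
      using a \<open>0 < \<gamma>\<close> by (auto simp: cdf_exponential_law)
    define w where "w = max 0 v + d"
    have w: "0 < w" "v < w" using d(1) by (auto simp: w_def)
    have "\<forall>\<^sub>F n in sequentially. 1 - G (t n) (exp (- w / t n)) < a"
      using tail[OF w(1)] by (rule order_tendstoD(2)) (use d in \<open>simp add: w_def\<close>)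
    then show "\<forall>\<^sub>F n in sequentially. cdf (distr P borel (\<lambda>\<omega>. - t n * ln (X (t n) \<omega>))) v < a"
    proof eventually_elim
      case (elim n)
      have "F n v \<le> 1 - G (t n) (exp (- w / t n))"
        unfolding compl F using w by (intro finite_measure_mono) auto
      then show ?case using elim by (simp add: F_def)
    qed
  }
qed

text \<open>By positivity of \<open>X t\<close>, \<open>neg_log\<close> is almost surely finite, so
  real weak convergence along sequences transfers to test functions on the extended reals.\<close>

lemma S5_imp_scaled_neg_log_converges:
  assumes S5: "cond_S5 \<nu> \<gamma>" and "0 < \<gamma>"
  shows "scaled_neg_log_converges P X (exponential_law \<gamma>)"
  unfolding scaled_neg_log_converges_def converges_in_distribution_def
proof (intro exI conjI)
  let ?Y = "\<lambda>t \<omega>. ereal t * neg_log (X t \<omega>)"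
  have Y: "?Y t \<in> P \<rightarrow>\<^sub>M borel_of euclidean" if "0 < t" for t
    using measurable_scaled_neg_log[of t] that by (simp add: borel_of_euclidean)
  show "\<forall>\<^sub>F t in at_right 0. has_law P euclidean (?Y t) (distr P (borel_of euclidean) (?Y t))"
    using eventually_at_right_less[of "0::real"] by eventually_elim (intro has_law_measurable Y)
  interpret E: real_distribution "exponential_law \<gamma>" by (rule exponential_law(1)[OF \<open>0 < \<gamma>\<close>])
  have ereal: "ereal \<in> exponential_law \<gamma> \<rightarrow>\<^sub>M borel_of euclidean"
    unfolding borel_of_euclidean measurable_cong_sets[OF E.events_eq_borel refl] by measurable
  show "has_law (exponential_law \<gamma>) euclidean ereal (distr (exponential_law \<gamma>) (borel_of euclidean) ereal)"
    by (rule has_law_measurable[OF ereal])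
  show "weakly_converges euclidean (at_right 0) (\<lambda>t. distr P (borel_of euclidean) (?Y t))
      (distr (exponential_law \<gamma>) (borel_of euclidean) ereal)"
    unfolding weakly_converges_def
  proof (intro allI impI)
    fix f :: "ereal \<Rightarrow> real"
    assume f: "continuous_map euclidean euclideanreal f \<and> bounded (f ` topspace euclidean)"
    then have cont: "continuous_on UNIV f" by (simp add: continuous_map_iff_continuous2)
    have mf: "f \<in> borel_measurable (borel_of euclidean)"
      using f by (intro continuous_map_borel_measurable) simp
    obtain B where B: "\<And>x. \<bar>f x\<bar> \<le> B" using f by (auto simp: bounded_iff)
    have isc: "isCont (\<lambda>x. f (ereal x)) x" for x
      using continuous_on_compose2[OF cont, of UNIV ereal] by (simp add: continuous_on_eq_continuous_at)
    have "((\<lambda>t. LINT \<omega>|P. f (?Y t \<omega>)) \<longlongrightarrow> (LINT x|exponential_law \<gamma>. f (ereal x))) (at_right 0)"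
      unfolding tendsto_at_iff_sequentially
    proof (intro allI impI)
      fix t :: "nat \<Rightarrow> real" assume tn: "\<forall>i. t i \<in> {0<..} - {0}" "t \<longlonglongrightarrow> 0"
      then have t: "0 < t n" for n by auto
      have [measurable]: "X (t n) \<in> borel_measurable P" for n using measurable_X[of "t n"] t[of n] by simp
      have "(\<lambda>n. integral\<^sup>L (distr P borel (\<lambda>\<omega>. - t n * ln (X (t n) \<omega>))) (\<lambda>x. f (ereal x))) \<longlonglongrightarrow>
          integral\<^sup>L (exponential_law \<gamma>) (\<lambda>x. f (ereal x))"
      proof (rule weak_conv_imp_integral_bdd_continuous_conv)
        show "real_distribution (distr P borel (\<lambda>\<omega>. - t n * ln (X (t n) \<omega>)))" for n
          by (rule real_distribution_distr) measurable
        show "norm (f (ereal x)) \<le> B" for x using B by simp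
      qed (rule E.real_distribution_axioms weak_conv_log[OF S5 \<open>0 < \<gamma>\<close> t tn(2)] isc)+
      moreover have "integral\<^sup>L (distr P borel (\<lambda>\<omega>. - t n * ln (X (t n) \<omega>))) (\<lambda>x. f (ereal x)) = (LINT \<omega>|P. f (?Y (t n) \<omega>))" for n
      proof -
        have mfe: "(\<lambda>x. f (ereal x)) \<in> borel_measurable borel"
          using isc by (intro borel_measurable_continuous_onI) (simp add: continuous_at_imp_continuous_on)
        have "integral\<^sup>L (distr P borel (\<lambda>\<omega>. - t n * ln (X (t n) \<omega>))) (\<lambda>x. f (ereal x)) = (LINT \<omega>|P. f (ereal (- t n * ln (X (t n) \<omega>))))"
          by (rule integral_distr[OF _ mfe]) measurable
        also have "\<dots> = (LINT \<omega>|P. f (?Y (t n) \<omega>))"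
        proof (rule integral_cong_AE)
          show "(\<lambda>\<omega>. f (ereal (- t n * ln (X (t n) \<omega>)))) \<in> borel_measurable P"
            by (rule measurable_compose[OF _ mfe]) measurable
          show "(\<lambda>\<omega>. f (?Y (t n) \<omega>)) \<in> borel_measurable P" by (rule measurable_compose[OF Y[OF t] mf])
          show "AE \<omega> in P. f (ereal (- t n * ln (X (t n) \<omega>))) = f (?Y (t n) \<omega>)"
            using X_pos[OF S5 \<open>0 < \<gamma>\<close> t[of n]] by eventually_elim (simp add: neg_log_def)
        qed
        finally show ?thesis .
      qed
      ultimately show "((\<lambda>t. LINT \<omega>|P. f (?Y t \<omega>)) \<circ> t) \<longlonglongrightarrow> (LINT x|exponential_law \<gamma>. f (ereal x))"
        by (simp add: comp_def)
    qed
    moreover have "\<forall>\<^sub>F t in at_right 0. (LINT \<omega>|P. f (?Y t \<omega>)) = integral\<^sup>L (distr P (borel_of euclidean) (?Y t)) f"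
      using eventually_at_right_less[of "0::real"]
    proof eventually_elim
      case (elim t)
      show ?case by (rule integral_distr[OF Y[OF elim] mf, symmetric])
    qed
    ultimately have "((\<lambda>t. integral\<^sup>L (distr P (borel_of euclidean) (?Y t)) f) \<longlongrightarrow> (LINT x|exponential_law \<gamma>. f (ereal x))) (at_right 0)"
      by (rule Lim_transform_eventually)
    then show "((\<lambda>t. integral\<^sup>L (distr P (borel_of euclidean) (?Y t)) f) \<longlongrightarrow>
        integral\<^sup>L (distr (exponential_law \<gamma>) (borel_of euclidean) ereal) f) (at_right 0)"
      by (simp add: integral_distr[OF ereal mf])
  qed
qed

end

text \<open>\<open>u i\<close> stands for \<open>- (t * mesh m) * ln\<close> of the
  \<open>i\<close>-th increment, the scale on which its law converges; the exponential turns it back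
  into the increment.\<close>

definition sum_path :: "nat \<Rightarrow> real \<Rightarrow> real \<Rightarrow> (nat \<Rightarrow> real) \<Rightarrow> real \<Rightarrow> real" where
  "sum_path m z t u = grid_path (mesh m) (cells m) (\<lambda>k. trunc z t (\<Sum>i\<in>{1..k}. exp (- u i / (t * mesh m))))"

text \<open>The limit of \<open>sum_path\<close> as \<open>t\<close> tends to 0; division by
  \<open>mesh m\<close> returns from the time scale of one cell to that of the path.\<close>

definition min_path :: "nat \<Rightarrow> real \<Rightarrow> (nat \<Rightarrow> real) \<Rightarrow> real \<Rightarrow> real" where
  "min_path m z u = grid_path (mesh m) (cells m) (run_min z (\<lambda>i. u i / mesh m))"

lemma grid_path_cong: "(\<And>k. k \<le> K \<Longrightarrow> v k = v' k) \<Longrightarrow> grid_path h K v = grid_path h K v'"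
  unfolding grid_path_def by (intro restrict_ext) simp

lemma measurable_sum_path:
  "sum_path m z t \<in> PiM {1..cells m} (\<lambda>_. borel) \<rightarrow>\<^sub>M borel_of j1_topology"
  unfolding sum_path_def[abs_def]
proof (rule measurable_grid_path)
  fix k assume "k \<le> cells m"
  then have "(\<lambda>u. \<Sum>i\<in>{1..k}. exp (- u i / (t * mesh m))) \<in> borel_measurable (PiM {1..cells m} (\<lambda>_. borel))"
    by (intro borel_measurable_sum borel_measurable_exp borel_measurable_divide borel_measurable_uminus
        measurable_component_singleton borel_measurable_const) auto
  then show "(\<lambda>u. trunc z t (\<Sum>i\<in>{1..k}. exp (- u i / (t * mesh m)))) \<in> borel_measurable (PiM {1..cells m} (\<lambda>_. borel))"
    by measurable
qed simp

lemma measurable_min_path: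
  "min_path m z \<in> PiM {1..cells m} (\<lambda>_. borel) \<rightarrow>\<^sub>M borel_of j1_topology"
  unfolding min_path_def[abs_def]
  by (intro measurable_grid_path measurable_run_min borel_measurable_divide
        measurable_component_singleton borel_measurable_const) auto

lemma sum_path_tendsto:
  assumes t: "\<And>n. 0 < t n" "t \<longlonglongrightarrow> 0" and u: "\<And>i. i \<in> {1..cells m} \<Longrightarrow> (\<lambda>n. u n i) \<longlonglongrightarrow> u' i"
  shows "limitin j1_topology (\<lambda>n. sum_path m z (t n) (u n)) (min_path m z u') sequentially"
  unfolding sum_path_def min_path_def
proof (rule limitin_grid_path)
  fix k assume "k \<le> cells m"
  then have "(\<lambda>n. u n i / mesh m) \<longlonglongrightarrow> u' i / mesh m" if "i \<in> {1..k}" for i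
    using that by (intro tendsto_divide u tendsto_const) (auto simp: less_imp_neq[OF mesh_pos, symmetric])
  from trunc_sum_tendsto[where w = "\<lambda>n i. u n i / mesh m", OF t this]
  show "(\<lambda>n. trunc z (t n) (\<Sum>i\<in>{1..k}. exp (- u n i / (t n * mesh m)))) \<longlonglongrightarrow> run_min z (\<lambda>i. u' i / mesh m) k"
    by (simp add: mult.commute)
qed simp

lemma measurable_compose_PiM:
  assumes "g \<in> \<Omega> \<rightarrow>\<^sub>M borel"
  shows "compose I g \<in> PiM I (\<lambda>_. \<Omega>) \<rightarrow>\<^sub>M PiM I (\<lambda>_. borel)"
  unfolding compose_def
proof (rule measurable_restrict)
  fix i assume "i \<in> I"
  then have "(\<lambda>\<omega>. \<omega> i) \<in> PiM I (\<lambda>_. \<Omega>) \<rightarrow>\<^sub>M \<Omega>" by (rule measurable_component_singleton)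
  from measurable_compose[OF this assms] show "(\<lambda>\<omega>. g (\<omega> i)) \<in> PiM I (\<lambda>_. \<Omega>) \<rightarrow>\<^sub>M borel" .
qed

lemma distr_PiM_compose:
  assumes "prob_space \<Omega>" "g \<in> \<Omega> \<rightarrow>\<^sub>M borel" "finite I" "F \<in> PiM I (\<lambda>_. borel) \<rightarrow>\<^sub>M L"
  shows "distr (PiM I (\<lambda>_. \<Omega>)) L (\<lambda>\<omega>. F (compose I g \<omega>)) = distr (PiM I (\<lambda>_. distr \<Omega> borel g)) L F"
proof -
  let ?M' = "distr \<Omega> borel g" and ?Q = "PiM I (\<lambda>_. \<Omega>)"
  have "distr ?Q (PiM I (\<lambda>_. borel)) (compose I g) = distr ?Q (PiM I (\<lambda>_. ?M')) (compose I g)"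
    by (rule distr_cong) (auto intro!: sets_PiM_cong)
  also have "\<dots> = PiM I (\<lambda>_. distr \<Omega> ?M' g)"
    by (rule distr_PiM_finite_prob_space') (use assms in \<open>auto intro: prob_space.prob_space_distr\<close>)
  also have "distr \<Omega> ?M' g = ?M'" by (rule distr_cong) auto
  finally have law: "distr ?Q (PiM I (\<lambda>_. borel)) (compose I g) = PiM I (\<lambda>_. ?M')" .
  show ?thesis
    using distr_distr[OF assms(4) measurable_compose_PiM[OF assms(2)]] by (simp only: law comp_def)
qed

text \<open>Skorohod's representation of the one-dimensional marginals, used independently in each cell.\<close>

lemma sum_path_coupling:
  fixes \<mu> :: "nat \<Rightarrow> real measure"
  assumes \<mu>: "\<And>n. real_distribution (\<mu> n)" "real_distribution M" and weak: "weak_conv_m \<mu> M"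
    and t: "\<And>n. 0 < t n" "t \<longlonglongrightarrow> 0"
  shows "\<exists>(Q :: (nat \<Rightarrow> real) measure) G G'. prob_space Q \<and> (\<forall>n. G n \<in> Q \<rightarrow>\<^sub>M borel_of j1_topology) \<and>
      G' \<in> Q \<rightarrow>\<^sub>M borel_of j1_topology \<and>
      (\<forall>n. distr Q (borel_of j1_topology) (G n) =
        distr (PiM {1..cells m} (\<lambda>_. \<mu> n)) (borel_of j1_topology) (sum_path m z (t n))) \<and>
      distr Q (borel_of j1_topology) G' = distr (PiM {1..cells m} (\<lambda>_. M)) (borel_of j1_topology) (min_path m z) \<and>
      (\<forall>\<omega>\<in>space Q. limitin j1_topology (\<lambda>n. G n \<omega>) (G' \<omega>) sequentially)"
proof -
  obtain \<Omega> :: "real measure" and U V where \<Omega>: "prob_space \<Omega>" "\<And>n. U n \<in> \<Omega> \<rightarrow>\<^sub>M borel"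
    "\<And>n. distr \<Omega> borel (U n) = \<mu> n" "V \<in> \<Omega> \<rightarrow>\<^sub>M borel" "distr \<Omega> borel V = M"
    "\<And>x. x \<in> space \<Omega> \<Longrightarrow> (\<lambda>n. U n x) \<longlonglongrightarrow> V x"
    using Skorohod[OF \<mu> weak] unfolding measurable_lborel1 by metis
  let ?I = "{1..cells m}"
  define Q where "Q = PiM ?I (\<lambda>_. \<Omega>)"
  have Q: "prob_space Q" unfolding Q_def by (intro prob_space_PiM \<Omega>(1))
  note comp = measurable_compose_PiM[of _ \<Omega> ?I, folded Q_def]
  have push: "distr Q (borel_of j1_topology) (\<lambda>\<omega>. F (compose ?I g \<omega>)) = distr (PiM ?I (\<lambda>_. distr \<Omega> borel g)) (borel_of j1_topology) F"
    if "g \<in> \<Omega> \<rightarrow>\<^sub>M borel" "F \<in> PiM ?I (\<lambda>_. borel) \<rightarrow>\<^sub>M borel_of j1_topology" for g :: "real \<Rightarrow> real" and F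
    unfolding Q_def by (rule distr_PiM_compose[OF \<Omega>(1) that(1) _ that(2)]) simp
  define G where "G n \<omega> = sum_path m z (t n) (compose ?I (U n) \<omega>)" for n \<omega>
  define G' where "G' \<omega> = min_path m z (compose ?I V \<omega>)" for \<omega>
  have "limitin j1_topology (\<lambda>n. G n \<omega>) (G' \<omega>) sequentially" if "\<omega> \<in> space Q" for \<omega>
    unfolding G_def G'_def
  proof (rule sum_path_tendsto[OF t])
    fix i assume i: "i \<in> ?I"
    then have "\<omega> i \<in> space \<Omega>" using that by (auto simp: Q_def space_PiM)
    from \<Omega>(6)[OF this] show "(\<lambda>n. compose ?I (U n) \<omega> i) \<longlonglongrightarrow> compose ?I V \<omega> i"
      using i by (simp add: compose_def)
  qed
  moreover have "G n \<in> Q \<rightarrow>\<^sub>M borel_of j1_topology" for n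
    unfolding G_def by (rule measurable_compose[OF comp[OF \<Omega>(2)] measurable_sum_path])
  moreover have "G' \<in> Q \<rightarrow>\<^sub>M borel_of j1_topology"
    unfolding G'_def by (rule measurable_compose[OF comp[OF \<Omega>(4)] measurable_min_path])
  moreover have "distr Q (borel_of j1_topology) (G n) = distr (PiM ?I (\<lambda>_. \<mu> n)) (borel_of j1_topology) (sum_path m z (t n))" for n
    unfolding G_def push[OF \<Omega>(2) measurable_sum_path] \<Omega>(3) ..
  moreover have "distr Q (borel_of j1_topology) G' = distr (PiM ?I (\<lambda>_. M)) (borel_of j1_topology) (min_path m z)"
    unfolding G'_def push[OF \<Omega>(4) measurable_min_path] \<Omega>(5) ..
  ultimately show ?thesis using Q by blast
qed

section \<open>Laws of the discretised paths of the subordinator\<close>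

context regular_subordinator
begin

lemma increment_pos:
  assumes "cond_S5 \<nu> \<gamma>" "0 < \<gamma>" "0 \<le> s" "0 < r"
  shows "AE \<omega> in P. 0 < X (s + r) \<omega> - X s \<omega>"
proof -
  have [measurable]: "X (s + r) \<in> borel_measurable P" "X s \<in> borel_measurable P"
    using measurable_X assms by auto
  have "prob {\<omega> \<in> space P. 0 < X (s + r) \<omega> - X s \<omega>} = 1"
    using prob_increment_gt[of s r 0] prob_X_zero[OF assms(1,2,4)] assms by simp
  then have "AE \<omega> in P. \<omega> \<in> {\<omega> \<in> space P. 0 < X (s + r) \<omega> - X s \<omega>}" by (subst (asm) prob_eq_1) auto
  then show ?thesis by eventually_elim simp
qed

definition log_increments :: "nat \<Rightarrow> real \<Rightarrow> 'a \<Rightarrow> nat \<Rightarrow> real" where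
  "log_increments m t \<omega> = (\<lambda>i\<in>{1..cells m}. - (t * mesh m) *
     ln (X (t * (real i * mesh m)) \<omega> - X (t * (real (i - 1) * mesh m)) \<omega>))"

lemma
  assumes "0 < t"
  shows measurable_log_increments: "log_increments m t \<in> P \<rightarrow>\<^sub>M PiM {1..cells m} (\<lambda>_. borel)"
    and distr_log_increments: "distr P (PiM {1..cells m} (\<lambda>_. borel)) (log_increments m t) =
      PiM {1..cells m} (\<lambda>_. distr P borel (\<lambda>\<omega>. - (t * mesh m) * ln (X (t * mesh m) \<omega>)))"
proof -
  define s where "s i = t * (real i * mesh m)" for i
  define \<tau> where "\<tau> = t * mesh m"
  define K where "K = cells m"
  define E where "E i \<omega> = - \<tau> * ln (X (s (Suc i)) \<omega> - X (s i) \<omega>)" for i \<omega>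
  define \<mu> where "\<mu> = distr P borel (\<lambda>\<omega>. - \<tau> * ln (X \<tau> \<omega>))"
  have \<tau>: "0 < \<tau>" using assms by (simp add: \<tau>_def)
  have s: "0 \<le> s i" "s i < s (Suc i)" "s (Suc i) = s i + \<tau>" for i
    using assms by (simp_all add: s_def \<tau>_def algebra_simps less_imp_le)
  have K: "0 < K" by (simp add: K_def cells_def)
  have [measurable]: "X (s i) \<in> borel_measurable P" "X \<tau> \<in> borel_measurable P" for i
    using measurable_X s \<tau> by (auto simp: less_imp_le)
  have E [measurable]: "E i \<in> borel_measurable P" for i unfolding E_def by measurable
  have "indep_vars (\<lambda>_. borel) E {..<K}"
    unfolding E_def by (rule indep_vars_compose2[where Y = "\<lambda>_ x. - \<tau> * ln x", OF increments]) (use s in auto)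
  moreover have dE: "distr P borel (E i) = \<mu>" for i
  proof -
    have "distr P borel (E i) = distr (distr P borel (\<lambda>\<omega>. X (s i + \<tau>) \<omega> - X (s i) \<omega>)) borel (\<lambda>x. - \<tau> * ln x)"
      unfolding s(3)[symmetric] by (subst distr_distr) (auto simp: E_def[abs_def] comp_def)
    also have "\<dots> = distr (distr P borel (X \<tau>)) borel (\<lambda>x. - \<tau> * ln x)"
      using increment_distr[OF s(1), of \<tau> i] \<tau> by simp
    also have "\<dots> = \<mu>" by (subst distr_distr) (auto simp: \<mu>_def comp_def)
    finally show ?thesis .
  qed
  ultimately have joint: "distr P (PiM {..<K} (\<lambda>_. borel)) (\<lambda>\<omega>. \<lambda>i\<in>{..<K}. E i \<omega>) = PiM {..<K} (\<lambda>_. \<mu>)"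
    using K by (subst (asm) indep_vars_iff_distr_eq_PiM') auto
  interpret \<mu>: prob_space \<mu> unfolding \<mu>_def by (rule prob_space_distr) measurable
  \<comment> \<open>The independent increments are numbered from 0, the cells from 1.\<close>
  define r where "r \<omega> = (\<lambda>n\<in>{1..K}. \<omega> (n - 1))" for \<omega> :: "nat \<Rightarrow> real"
  have L: "log_increments m t = (\<lambda>\<omega>. r (\<lambda>i\<in>{..<K}. E i \<omega>))"
    unfolding log_increments_def r_def E_def s_def \<tau>_def K_def by (intro ext) auto
  have r: "r \<in> PiM {..<K} (\<lambda>_. borel) \<rightarrow>\<^sub>M PiM {1..K} (\<lambda>_. borel)"
    unfolding r_def by (intro measurable_restrict measurable_component_singleton) auto
  have E': "(\<lambda>\<omega>. \<lambda>i\<in>{..<K}. E i \<omega>) \<in> P \<rightarrow>\<^sub>M PiM {..<K} (\<lambda>_. borel)"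
    by (intro measurable_restrict E)
  show "log_increments m t \<in> P \<rightarrow>\<^sub>M PiM {1..cells m} (\<lambda>_. borel)"
    using measurable_compose[OF E' r] by (simp add: L K_def)
  have "distr P (PiM {1..K} (\<lambda>_. borel)) (log_increments m t) = distr (PiM {..<K} (\<lambda>_. \<mu>)) (PiM {1..K} (\<lambda>_. borel)) r"
    unfolding L joint[symmetric] by (subst distr_distr[OF r E']) (simp add: comp_def)
  also have "\<dots> = distr (PiM {..<K} (\<lambda>_. \<mu>)) (PiM {1..K} (\<lambda>_. \<mu>)) r"
    by (rule distr_cong) (auto intro!: sets_PiM_cong simp: \<mu>_def)
  also have "\<dots> = PiM {1..K} (\<lambda>_. \<mu>)"
    unfolding r_def
    by (rule distr_PiM_reindex) (auto intro!: \<mu>.prob_space_axioms inj_onI)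
  finally show "distr P (PiM {1..cells m} (\<lambda>_. borel)) (log_increments m t) =
      PiM {1..cells m} (\<lambda>_. distr P borel (\<lambda>\<omega>. - (t * mesh m) * ln (X (t * mesh m) \<omega>)))"
    by (simp add: K_def \<mu>_def \<tau>_def)
qed

text \<open>Almost surely all increments are positive, so exponentiation undoes their logarithms and
  the partial sums telescope to \<open>X\<close>.\<close>

lemma distr_grid_disc:
  assumes S5: "cond_S5 \<nu> \<gamma>" "0 < \<gamma>" and t: "0 < t"
  shows "distr P (borel_of j1_topology) (\<lambda>\<omega>. grid_disc m (truncated_path z X t \<omega>)) =
    distr (PiM {1..cells m} (\<lambda>_. distr P borel (\<lambda>\<omega>. - (t * mesh m) * ln (X (t * mesh m) \<omega>))))
      (borel_of j1_topology) (sum_path m z t)"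
proof -
  define s where "s i = t * (real i * mesh m)" for i
  have s: "0 \<le> s i" "s (Suc i) = s i + t * mesh m" for i
    using t by (simp_all add: s_def algebra_simps less_imp_le)
  have "AE \<omega> in P. \<forall>i. 0 < X (s i + t * mesh m) \<omega> - X (s i) \<omega>"
    unfolding AE_all_countable using increment_pos[OF S5 s(1)] t by simp
  then have "AE \<omega> in P. grid_disc m (truncated_path z X t \<omega>) = sum_path m z t (log_increments m t \<omega>)"
    using AE_space
  proof eventually_elim
    case (elim \<omega>)
    show ?case
      unfolding truncated_path_disc[OF elim(2) t] sum_path_def
    proof (intro grid_path_cong arg_cong[where f = "trunc z t"])
      fix k assume k: "k \<le> cells m"
      have "(\<Sum>i\<in>{1..k}. exp (- log_increments m t \<omega> i / (t * mesh m))) = (\<Sum>i\<in>{1..k}. X (s i) \<omega> - X (s (i - 1)) \<omega>)"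
      proof (intro sum.cong refl)
        fix i assume i: "i \<in> {1..k}"
        then obtain j where j: "i = Suc j" by (cases i) auto
        have "0 < X (s i) \<omega> - X (s (i - 1)) \<omega>" using elim(1) s(2)[of j] by (simp add: j)
        then show "exp (- log_increments m t \<omega> i / (t * mesh m)) = X (s i) \<omega> - X (s (i - 1)) \<omega>"
          using i k t by (simp add: log_increments_def s_def less_imp_neq[OF mesh_pos, symmetric])
      qed
      also have "\<dots> = X (s k) \<omega>"
      proof (induction k)
        case 0
        then show ?case using X_zero[OF elim(2)] by (simp add: s_def)
      qed simp
      finally show "X (t * (real k * mesh m)) \<omega> = (\<Sum>i\<in>{1..k}. exp (- log_increments m t \<omega> i / (t * mesh m)))"
        by (simp add: s_def)
    qed
  qed
  then have "distr P (borel_of j1_topology) (\<lambda>\<omega>. grid_disc m (truncated_path z X t \<omega>)) =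
      distr P (borel_of j1_topology) (\<lambda>\<omega>. sum_path m z t (log_increments m t \<omega>))"
    by (intro distr_cong_AE measurable_grid_disc[OF t]
          measurable_compose[OF measurable_log_increments[OF t] measurable_sum_path]) auto
  also have "\<dots> = distr (distr P (PiM {1..cells m} (\<lambda>_. borel)) (log_increments m t)) (borel_of j1_topology) (sum_path m z t)"
    by (subst distr_distr[OF measurable_sum_path measurable_log_increments[OF t]]) (simp add: comp_def)
  finally show ?thesis by (simp only: distr_log_increments[OF t])
qed

end

section \<open>The extremal process\<close>

text \<open>By monotonicity \<open>x\<close> exceeds \<open>z\<close> on all of
  \<open>{0<..s0}\<close>, so the truncated path equals \<open>z\<close> near 0; this gives
  right-continuity at 0.\<close>

lemma truncated_extremal_regular:
  fixes x :: "real \<Rightarrow> real"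
  assumes anti: "antimono_on {0<..} x" and cadlag: "cadlag_on {0<..} x" and s0: "0 < s0" "z < x s0"
  defines "p \<equiv> \<lambda>s\<in>{0..}. if s = 0 then z else min z (x s)"
  shows "p \<in> skorohod_space" "antimono_on {0..} p"
proof -
  have dec: "x t \<le> x s" if "0 < s" "s \<le> t" for s t using monotone_onD[OF anti, of s t] that by simp
  show "antimono_on {0..} p"
    by (rule monotone_onI) (auto simp: p_def intro!: min.coboundedI2 dec)
  have lim: "(p \<longlongrightarrow> min z l) (at t within A)"
    if "(x \<longlongrightarrow> l) (at t within A)" "0 < t" "A \<subseteq> {0..}" for l t A
  proof -
    have "((\<lambda>s. min z (x s)) \<longlongrightarrow> min z l) (at t within A)" by (intro tendsto_min tendsto_const that)
    moreover have "\<forall>\<^sub>F s in at t within A. 0 < s"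
      using that(2) by (intro order_tendstoD(1)[OF tendsto_ident_at])
    then have "\<forall>\<^sub>F s in at t within A. min z (x s) = p s"
      by eventually_elim (simp add: p_def)
    ultimately show ?thesis by (rule Lim_transform_eventually)
  qed
  have "continuous (at t within {0..} \<inter> {t..}) p" if "0 \<le> t" for t
  proof (cases "t = 0")
    case True
    have "\<forall>\<^sub>F s in at t within {0..} \<inter> {t..}. s < s0"
      using True s0 by (intro order_tendstoD(2)[OF tendsto_ident_at]) simp
    moreover have "\<forall>\<^sub>F s in at t within {0..} \<inter> {t..}. s \<in> {0..} \<inter> {t..}" by (simp add: eventually_at_filter)
    ultimately have "\<forall>\<^sub>F s in at t within {0..} \<inter> {t..}. p s = p t"
    proof eventually_elim
      case (elim s)
      then show ?case using dec[of s s0] s0 True by (cases "s = 0") (auto simp: p_def min_def)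
    qed
    then show ?thesis unfolding continuous_within by (rule tendsto_eventually)
  next
    case False
    then have t: "0 < t" using that by simp
    have "{0<..} \<inter> {t..} = {0..} \<inter> {t..}" using t by auto
    then have "(x \<longlongrightarrow> x t) (at t within {0..} \<inter> {t..})"
      using cadlag t unfolding cadlag_on_def continuous_within by (metis greaterThan_iff)
    from lim[OF this t] show ?thesis using t by (simp add: continuous_within p_def)
  qed
  moreover have "\<exists>l. (p \<longlongrightarrow> l) (at t within {0..} \<inter> {..<t})" if "0 \<le> t" for t
  proof (cases "t = 0")
    case True
    have "{0..} \<inter> {..<t} = {}" using True by auto
    then show ?thesis by simp
  next
    case False
    then have t: "0 < t" using that by simp
    have "\<exists>l. (x \<longlongrightarrow> l) (at t within {0<..} \<inter> {..<t})"
      using cadlag t unfolding cadlag_on_def by simp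
    moreover have "at t within {0<..} \<inter> {..<t} = at t within {0..} \<inter> {..<t}"
      by (rule at_within_nhd[of t "{0<..}"]) (use t in auto)
    ultimately obtain l where "(x \<longlongrightarrow> l) (at t within {0..} \<inter> {..<t})" by auto
    from lim[OF this t] show ?thesis by blast
  qed
  ultimately show "p \<in> skorohod_space"
    unfolding skorohod_space_def cadlag_on_def by (simp add: p_def)
qed

lemma extremal_process_law:
  assumes ext: "extremal_process \<gamma> N \<eta>" and "0 < h"
  shows "distr N (PiM {1..n::nat} (\<lambda>_. borel)) (\<lambda>\<omega>. \<lambda>k\<in>{1..n}. \<eta> (real k * h) \<omega>) =
        distr (PiM {1..n} (\<lambda>_. exponential_law 1)) (PiM {1..n} (\<lambda>_. borel))
          (\<lambda>Z. \<lambda>k\<in>{1..n}. 1 / \<gamma> * Min ((\<lambda>i. Z i / h) ` {1..k}))"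
proof -
  define s where "s i = real i * h" for i
  have "s 0 = 0 \<and> (\<forall>i<n. s i < s (Suc i))" using \<open>0 < h\<close> by (simp add: s_def)
  then have "distr N (PiM {1..n::nat} (\<lambda>_. borel)) (\<lambda>\<omega>. \<lambda>k\<in>{1..n}. \<eta> (s k) \<omega>) =
        distr (PiM {1..n} (\<lambda>_. exponential_law 1)) (PiM {1..n} (\<lambda>_. borel))
          (\<lambda>Z. \<lambda>k\<in>{1..n}. 1 / \<gamma> * Min ((\<lambda>i. Z i / (s i - s (i - 1))) ` {1..k}))"
    using ext unfolding extremal_process_def by blast
  moreover have "(\<lambda>i. Z i / (s i - s (i - 1))) ` {1..k} = (\<lambda>i. Z i / h) ` {1..k}" for Z and k :: nat
    by (intro image_cong refl) (auto simp: s_def of_nat_diff algebra_simps)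
  ultimately show ?thesis by (simp add: s_def)
qed

lemma measurable_scaled_Min:
  "(\<lambda>Z. \<lambda>k\<in>{1..n::nat}. 1 / \<gamma> * Min ((\<lambda>i. Z i / h) ` {1..k})) \<in>
    PiM {1..n} (\<lambda>_. exponential_law 1) \<rightarrow>\<^sub>M PiM {1..n} (\<lambda>_. borel)"
proof (rule measurable_restrict)
  fix k assume "k \<in> {1..n}"
  have sets: "sets (PiM {1..n} (\<lambda>_. exponential_law 1)) = sets (PiM {1..n} (\<lambda>_. borel))"
    by (rule sets_PiM_cong) (auto simp: exponential_law_def)
  show "(\<lambda>Z. 1 / \<gamma> * Min ((\<lambda>i. Z i / h) ` {1..k})) \<in> borel_measurable (PiM {1..n} (\<lambda>_. exponential_law 1))"
    unfolding measurable_cong_sets[OF sets refl]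
    by (intro borel_measurable_times borel_measurable_const borel_measurable_Min borel_measurable_divide
        measurable_component_singleton) (use \<open>k \<in> {1..n}\<close> in auto)
qed

text \<open>The one-dimensional marginal; letting \<open>h\<close> tend to 0 will show that almost
  every path exceeds \<open>z\<close> near 0.\<close>

lemma extremal_process_tail:
  assumes ext: "extremal_process \<gamma> N \<eta>" and "0 < \<gamma>" "0 < z" "0 < h"
  shows "measure N {\<omega> \<in> space N. z < \<eta> h \<omega>} = exp (- \<gamma> * z * h)"
proof -
  have \<eta>: "\<eta> h \<in> borel_measurable N" using ext \<open>0 < h\<close> by (simp add: extremal_process_def)
  let ?B = "PiM {1..1::nat} (\<lambda>_. borel :: real measure)" and ?E = "PiM {1..1::nat} (\<lambda>_. exponential_law 1)"
  let ?S = "{f \<in> space ?B. z < f 1}"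
  have S: "?S \<in> sets ?B"
  proof -
    have [measurable]: "(\<lambda>f. f 1) \<in> borel_measurable ?B" by (rule measurable_component_singleton) simp
    show ?thesis by measurable
  qed
  have W: "(\<lambda>\<omega>. \<lambda>k\<in>{1..1::nat}. \<eta> (real k * h) \<omega>) \<in> N \<rightarrow>\<^sub>M ?B"
    by (rule measurable_restrict) (use \<eta> in simp)
  have E1: "prob_space (exponential_law 1)" using exponential_law(1)[of 1] by (simp add: real_distribution_def)
  have comp: "(\<lambda>Z. Z 1) \<in> ?E \<rightarrow>\<^sub>M exponential_law 1" by (rule measurable_component_singleton) simp
  have "measure N {\<omega> \<in> space N. z < \<eta> h \<omega>} = measure (distr N ?B (\<lambda>\<omega>. \<lambda>k\<in>{1..1::nat}. \<eta> (real k * h) \<omega>)) ?S"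
    unfolding measure_distr[OF W S] by (intro arg_cong[where f = "measure N"]) (auto simp: space_PiM)
  also have "\<dots> = measure ?E ((\<lambda>Z. Z 1) -` {\<gamma> * z * h<..} \<inter> space ?E)"
    unfolding extremal_process_law[OF ext \<open>0 < h\<close>] measure_distr[OF measurable_scaled_Min S]
    using \<open>0 < \<gamma>\<close> \<open>0 < h\<close>
    by (intro arg_cong[where f = "measure ?E"]) (auto simp: space_PiM field_simps)
  also have "\<dots> = measure (distr ?E (exponential_law 1) (\<lambda>Z. Z 1)) {\<gamma> * z * h<..}"
    by (rule measure_distr[OF comp, symmetric]) (simp add: exponential_law_def)
  also have "distr ?E (exponential_law 1) (\<lambda>Z. Z 1) = exponential_law 1"
    by (rule distr_PiM_component) (use E1 in auto)
  also have "measure (exponential_law 1) {\<gamma> * z * h<..} = exp (- \<gamma> * z * h)"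
    using assms by (subst measure_exponential_law) (auto simp: max_def)
  finally show ?thesis .
qed

text \<open>That the paths exceed \<open>z\<close> near 0 has to be derived: by
  \<open>extremal_process_tail\<close> this has probability at least
  \<open>exp (- \<gamma> * z * (1 / real (Suc n)))\<close> for every \<open>n\<close>, hence 1. The
  remaining null set carries the constant path \<open>z\<close>.\<close>

lemma extremal_process_regular_version:
  assumes ext: "extremal_process \<gamma> N \<eta>" and "0 < \<gamma>" "0 < z"
  shows "\<exists>q. (\<forall>\<omega>\<in>space N. q \<omega> \<in> skorohod_space \<and> antimono_on {0..} (q \<omega>)) \<and>
    (AE \<omega> in N. truncated_extremal_path z \<eta> \<omega> = q \<omega>) \<and> (\<forall>s\<ge>0. (\<lambda>\<omega>. q \<omega> s) \<in> borel_measurable N)"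
proof -
  interpret prob_space N using ext by (simp add: extremal_process_def)
  have \<eta> [measurable]: "\<eta> s \<in> borel_measurable N" if "0 < s" for s using ext that by (simp add: extremal_process_def)
  define R where "R \<omega> \<longleftrightarrow> antimono_on {0<..} (\<lambda>s. \<eta> s \<omega>) \<and> cadlag_on {0<..} (\<lambda>s. \<eta> s \<omega>) \<and> (\<exists>n. z < \<eta> (1 / real (Suc n)) \<omega>)" for \<omega>
  have "prob (\<Union>n. {\<omega> \<in> space N. z < \<eta> (1 / real (Suc n)) \<omega>}) = 1"
  proof (rule antisym)
    have "(\<lambda>n. exp (- \<gamma> * z * (1 / real (Suc n)))) \<longlonglongrightarrow> exp (- \<gamma> * z * 0)"
      using LIMSEQ_inverse_real_of_nat by (intro tendsto_intros) (simp add: inverse_eq_divide)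
    moreover have "exp (- \<gamma> * z * (1 / real (Suc n))) \<le> prob (\<Union>n. {\<omega> \<in> space N. z < \<eta> (1 / real (Suc n)) \<omega>})" for n
    proof -
      have "exp (- \<gamma> * z * (1 / real (Suc n))) = prob {\<omega> \<in> space N. z < \<eta> (1 / real (Suc n)) \<omega>}"
        by (rule extremal_process_tail[OF assms, symmetric]) simp
      also have "\<dots> \<le> prob (\<Union>n. {\<omega> \<in> space N. z < \<eta> (1 / real (Suc n)) \<omega>})"
        by (intro finite_measure_mono) auto
      finally show ?thesis .
    qed
    ultimately show "1 \<le> prob (\<Union>n. {\<omega> \<in> space N. z < \<eta> (1 / real (Suc n)) \<omega>})"
      by (intro LIMSEQ_le_const2) auto
  qed simp
  then have "AE \<omega> in N. \<omega> \<in> (\<Union>n. {\<omega> \<in> space N. z < \<eta> (1 / real (Suc n)) \<omega>})"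
    by (subst (asm) prob_eq_1) auto
  moreover have "AE \<omega> in N. antimono_on {0<..} (\<lambda>s. \<eta> s \<omega>) \<and> piecewise_constant (\<lambda>s. \<eta> s \<omega>) \<and> cadlag_on {0<..} (\<lambda>s. \<eta> s \<omega>)"
    using ext by (simp add: extremal_process_def)
  ultimately have "AE \<omega> in N. R \<omega>" unfolding R_def by eventually_elim blast
  then obtain N0 where N0: "{\<omega> \<in> space N. \<not> R \<omega>} \<subseteq> N0" "N0 \<in> events" "emeasure N N0 = 0" by (rule AE_E)
  define q where "q \<omega> = (if \<omega> \<in> N0 then (\<lambda>s\<in>{0..}. z) else truncated_extremal_path z \<eta> \<omega>)" for \<omega>
  have reg: "q \<omega> \<in> skorohod_space \<and> antimono_on {0..} (q \<omega>)" if "\<omega> \<in> space N" for \<omega>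
  proof (cases "\<omega> \<in> N0")
    case True
    have "cadlag_on {0..} (\<lambda>_. 0)" by (auto simp: cadlag_on_def)
    from cadlag_on_compose_scaled[OF this, of "\<lambda>_. z" 1]
    have "(\<lambda>s\<in>{0..}. z) \<in> skorohod_space" by simp
    then show ?thesis using True by (auto simp: q_def monotone_on_def)
  next
    case False
    then have "R \<omega>" using N0(1) that by blast
    then obtain n where n: "antimono_on {0<..} (\<lambda>s. \<eta> s \<omega>)" "cadlag_on {0<..} (\<lambda>s. \<eta> s \<omega>)" "z < \<eta> (1 / real (Suc n)) \<omega>"
      by (auto simp: R_def)
    show ?thesis
      using truncated_extremal_regular[OF n(1,2) _ n(3)] False by (simp add: q_def truncated_extremal_path_def)
  qed
  have "AE \<omega> in N. \<omega> \<notin> N0" using N0 by (intro AE_not_in) auto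
  then have ae: "AE \<omega> in N. truncated_extremal_path z \<eta> \<omega> = q \<omega>" by eventually_elim (simp add: q_def)
  have "(\<lambda>\<omega>. q \<omega> s) \<in> borel_measurable N" if "0 \<le> s" for s
  proof -
    have "(\<lambda>\<omega>. q \<omega> s) = (\<lambda>\<omega>. if \<omega> \<in> N0 then z else if s = 0 then z else min z (\<eta> s \<omega>))"
      using that by (auto simp: q_def truncated_extremal_path_def)
    also have "\<dots> \<in> borel_measurable N"
    proof (cases "s = 0")
      case False
      then have [measurable]: "\<eta> s \<in> borel_measurable N" using \<eta> that by simp
      show ?thesis using N0(2) False by simp
    next
      case True
      then have "(\<lambda>\<omega>. if \<omega> \<in> N0 then z else if s = 0 then z else min z (\<eta> s \<omega>)) = (\<lambda>_. z)" by (auto simp: fun_eq_iff)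
      then show ?thesis by (simp only: measurable_const space_borel UNIV_I)
    qed
    finally show ?thesis .
  qed
  with reg ae show ?thesis by blast
qed

text \<open>On an equidistant grid the prescribed minima are running minima of the variables
  \<open>Z i / \<gamma>\<close>, divided by the mesh, and \<open>Z i / \<gamma>\<close> has the law
  \<open>exponential_law \<gamma>\<close>. This is the limit law of the coupling.\<close>

lemma distr_extremal_grid_disc:
  assumes ext: "extremal_process \<gamma> N \<eta>" and "0 < \<gamma>"
    and ae: "AE \<omega> in N. truncated_extremal_path z \<eta> \<omega> = q \<omega>" and q: "\<And>s. 0 \<le> s \<Longrightarrow> (\<lambda>\<omega>. q \<omega> s) \<in> borel_measurable N"
  shows "distr N (borel_of j1_topology) (\<lambda>\<omega>. grid_disc m (q \<omega>)) =
    distr (PiM {1..cells m} (\<lambda>_. exponential_law \<gamma>)) (borel_of j1_topology) (min_path m z)"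
proof -
  let ?I = "{1..cells m}" and ?h = "mesh m" and ?D = "borel_of j1_topology"
  let ?E = "PiM ?I (\<lambda>_. exponential_law 1)" and ?B = "PiM ?I (\<lambda>_. borel :: real measure)"
  define \<Theta> where "\<Theta> w = grid_path ?h (cells m) (\<lambda>k. if k = 0 then z else min z (w k))" for w
  define R where "R Z = (\<lambda>k\<in>?I. 1 / \<gamma> * Min ((\<lambda>i. Z i / ?h) ` {1..k}))" for Z :: "nat \<Rightarrow> real"
  define W where "W \<omega> = (\<lambda>k\<in>?I. \<eta> (real k * ?h) \<omega>)" for \<omega>
  have \<Theta>: "\<Theta> \<in> ?B \<rightarrow>\<^sub>M ?D"
    unfolding \<Theta>_def
  proof (rule measurable_grid_path)
    fix k assume "k \<le> cells m"
    show "(\<lambda>w. if k = 0 then z else min z (w k)) \<in> borel_measurable ?B"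
    proof (cases "k = 0")
      case False
      then have "(\<lambda>w. w k) \<in> borel_measurable ?B" using \<open>k \<le> cells m\<close> by (intro measurable_component_singleton) simp
      then show ?thesis using False by simp
    qed simp
  qed simp
  have W: "W \<in> N \<rightarrow>\<^sub>M ?B"
    unfolding W_def by (rule measurable_restrict) (use ext in \<open>simp add: extremal_process_def\<close>)
  have R: "R \<in> ?E \<rightarrow>\<^sub>M ?B" unfolding R_def by (rule measurable_scaled_Min)
  have qm: "(\<lambda>\<omega>. grid_disc m (q \<omega>)) \<in> N \<rightarrow>\<^sub>M ?D"
    unfolding grid_disc_def by (intro measurable_grid_path q) (auto simp: less_imp_le)
  have "AE \<omega> in N. grid_disc m (q \<omega>) = \<Theta> (W \<omega>)"
    using ae
  proof eventually_elim
    case (elim \<omega>)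
    show ?case
      unfolding elim[symmetric] grid_disc_def \<Theta>_def W_def
      by (rule grid_path_cong) (auto simp: truncated_extremal_path_def less_imp_le less_imp_neq[OF mesh_pos, symmetric])
  qed
  then have "distr N ?D (\<lambda>\<omega>. grid_disc m (q \<omega>)) = distr N ?D (\<lambda>\<omega>. \<Theta> (W \<omega>))"
    by (intro distr_cong_AE qm measurable_compose[OF W \<Theta>]) auto
  also have "\<dots> = distr (distr N ?B W) ?D \<Theta>" by (subst distr_distr[OF \<Theta> W]) (simp add: comp_def)
  also have "distr N ?B W = distr ?E ?B R"
    unfolding W_def R_def by (rule extremal_process_law[OF ext mesh_pos])
  also have "distr (distr ?E ?B R) ?D \<Theta> = distr ?E ?D (\<lambda>Z. \<Theta> (R Z))" by (subst distr_distr[OF \<Theta> R]) (simp add: comp_def)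
  also have "(\<lambda>Z. \<Theta> (R Z)) = (\<lambda>Z. min_path m z (compose ?I (\<lambda>x. x / \<gamma>) Z))"
  proof
    fix Z :: "nat \<Rightarrow> real"
    show "\<Theta> (R Z) = min_path m z (compose ?I (\<lambda>x. x / \<gamma>) Z)"
      unfolding \<Theta>_def min_path_def
    proof (rule grid_path_cong)
      fix k assume k: "k \<le> cells m"
      have "run_min z (\<lambda>i. compose ?I (\<lambda>x. x / \<gamma>) Z i / ?h) k = run_min z (\<lambda>i. 1 / \<gamma> * (Z i / ?h)) k"
        by (rule run_min_cong) (use k in \<open>auto simp: compose_def\<close>)
      also have "\<dots> = (if k = 0 then z else min z (1 / \<gamma> * Min ((\<lambda>i. Z i / ?h) ` {1..k})))"
        by (rule run_min_Min) (use \<open>0 < \<gamma>\<close> in simp)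
      finally show "(if k = 0 then z else min z (R Z k)) = run_min z (\<lambda>i. compose ?I (\<lambda>x. x / \<gamma>) Z i / ?h) k"
        using k by (simp add: R_def)
    qed
  qed
  also have "distr ?E ?D (\<lambda>Z. min_path m z (compose ?I (\<lambda>x. x / \<gamma>) Z)) =
      distr (PiM ?I (\<lambda>_. distr (exponential_law 1) borel (\<lambda>x. x / \<gamma>))) ?D (min_path m z)"
  proof (rule distr_PiM_compose[OF _ _ _ measurable_min_path])
    show "prob_space (exponential_law 1)" using exponential_law(1)[of 1] by (simp add: real_distribution_def)
    show "(\<lambda>x. x / \<gamma>) \<in> borel_measurable (exponential_law 1)" by (simp add: exponential_law_def)
  qed simp
  finally show ?thesis by (simp only: exponential_law_scale[OF \<open>0 < \<gamma>\<close>])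
qed

section \<open>The weak limit of the truncated paths\<close>

lemma (in regular_subordinator) truncated_path_weak_limit:
  fixes f :: "(real \<Rightarrow> real) \<Rightarrow> real" and N :: "'v measure"
  assumes S5: "cond_S5 \<nu> \<gamma>" "0 < \<gamma>" and z: "0 < z" and ext: "extremal_process \<gamma> N \<eta>"
    and q: "\<And>\<omega>. \<omega> \<in> space N \<Longrightarrow> q \<omega> \<in> skorohod_space" "\<And>\<omega>. \<omega> \<in> space N \<Longrightarrow> antimono_on {0..} (q \<omega>)"
      "AE \<omega> in N. truncated_extremal_path z \<eta> \<omega> = q \<omega>" "\<And>s. 0 \<le> s \<Longrightarrow> (\<lambda>\<omega>. q \<omega> s) \<in> borel_measurable N"
    and qm: "q \<in> N \<rightarrow>\<^sub>M borel_of j1_topology"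
    and f: "continuous_map j1_topology euclideanreal f" "bounded (f ` skorohod_space)"
    and t: "\<And>n. 0 < t n" "t \<longlonglongrightarrow> 0"
  shows "(\<lambda>n. LINT \<omega>|P. f (truncated_path z X (t n) \<omega>)) \<longlonglongrightarrow> (LINT \<omega>|N. f (q \<omega>))"
proof -
  obtain B where B: "\<And>x. x \<in> skorohod_space \<Longrightarrow> \<bar>f x\<bar> \<le> B" using f(2) by (auto simp: bounded_iff)
  have tright: "filterlim t (at_right 0) sequentially"
    unfolding filterlim_at using t(2) by (simp add: t(1) less_imp_neq[OF t(1), symmetric])
  have extremal: "distr N (borel_of j1_topology) (\<lambda>\<omega>. grid_disc m (q \<omega>)) =
      distr (PiM {1..cells m} (\<lambda>_. exponential_law \<gamma>)) (borel_of j1_topology) (min_path m z)" for m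
    by (rule distr_extremal_grid_disc[OF ext \<open>0 < \<gamma>\<close> q(3,4)])
  show ?thesis
  proof (rule weak_limit_by_approximation[where 'c = "nat \<Rightarrow> real" and f = f and B = B and \<eta> = q
        and Y = "\<lambda>n. truncated_path z X (t n)" and A = "\<lambda>m n \<omega>. grid_disc m (truncated_path z X (t n) \<omega>)"
        and A' = "\<lambda>m \<omega>. grid_disc m (q \<omega>)"])
    show "prob_space P" by (rule prob_space_axioms)
    show "prob_space N" using ext by (simp add: extremal_process_def)
    show "(\<lambda>\<omega>. grid_disc m (truncated_path z X (t n) \<omega>)) \<in> P \<rightarrow>\<^sub>M borel_of j1_topology" for m n
      by (rule measurable_grid_disc[OF t(1)])
    show "(\<lambda>\<omega>. grid_disc m (q \<omega>)) \<in> N \<rightarrow>\<^sub>M borel_of j1_topology" for m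
      unfolding grid_disc_def by (intro measurable_grid_path q(4)) (auto simp: less_imp_le)
    show "limitin j1_topology (\<lambda>m. grid_disc m (q \<omega>)) (q \<omega>) sequentially" if "\<omega> \<in> space N" for \<omega>
      unfolding grid_disc_def by (rule grid_paths_converge) (use q(1,2)[OF that] in \<open>auto simp: skorohod_space_def\<close>)
    show "\<exists>(Q :: (nat \<Rightarrow> real) measure) G G'. prob_space Q \<and> (\<forall>n. G n \<in> Q \<rightarrow>\<^sub>M borel_of j1_topology) \<and>
      G' \<in> Q \<rightarrow>\<^sub>M borel_of j1_topology \<and>
      (\<forall>n. distr Q (borel_of j1_topology) (G n) =
        distr P (borel_of j1_topology) (\<lambda>\<omega>. grid_disc m (truncated_path z X (t n) \<omega>))) \<and>
      distr Q (borel_of j1_topology) G' = distr N (borel_of j1_topology) (\<lambda>\<omega>. grid_disc m (q \<omega>)) \<and>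
      (\<forall>\<omega>\<in>space Q. limitin j1_topology (\<lambda>n. G n \<omega>) (G' \<omega>) sequentially)" for m
      unfolding distr_grid_disc[OF S5 t(1)] extremal
    proof (rule sum_path_coupling)
      have \<tau>: "0 < t n * mesh m" for n using t(1) by simp
      show "real_distribution (distr P borel (\<lambda>\<omega>. - (t n * mesh m) * ln (X (t n * mesh m) \<omega>)))" for n
      proof (rule real_distribution_distr)
        have [measurable]: "X (t n * mesh m) \<in> borel_measurable P" using measurable_X \<tau>[of n] by simp
        show "(\<lambda>\<omega>. - (t n * mesh m) * ln (X (t n * mesh m) \<omega>)) \<in> borel_measurable P" by measurable
      qed
      show "real_distribution (exponential_law \<gamma>)" by (rule exponential_law(1)[OF \<open>0 < \<gamma>\<close>])
      have "(\<lambda>n. t n * mesh m) \<longlonglongrightarrow> 0" using tendsto_mult_right[OF t(2), of "mesh m"] by simp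
      then show "weak_conv_m (\<lambda>n. distr P borel (\<lambda>\<omega>. - (t n * mesh m) * ln (X (t n * mesh m) \<omega>))) (exponential_law \<gamma>)"
        by (rule weak_conv_log[OF S5 \<tau>])
    qed (rule t)+
    show "\<forall>\<^sub>F m in sequentially. \<forall>\<^sub>F n in sequentially. \<exists>Z\<in>events. prob Z \<le> e \<and>
        (\<forall>\<omega>\<in>space P - Z. truncated_path z X (t n) \<omega> \<in> j1_nhd d (grid_disc m (truncated_path z X (t n) \<omega>)))"
      if "0 < d" "0 < e" for d e
      using truncated_path_close[OF S5 z that]
      by eventually_elim (rule eventually_compose_filterlim[OF _ tright])
  qed (rule f(1) B qm measurable_truncated_path[OF t(1)]; assumption?)+
qed

lemma measurable_regular_paths:
  assumes q: "\<And>\<omega>. \<omega> \<in> space N \<Longrightarrow> q \<omega> \<in> skorohod_space" "\<And>\<omega>. \<omega> \<in> space N \<Longrightarrow> antimono_on {0..} (q \<omega>)"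
    "\<And>s. 0 \<le> s \<Longrightarrow> (\<lambda>\<omega>. q \<omega> s) \<in> borel_measurable N"
  shows "q \<in> N \<rightarrow>\<^sub>M borel_of j1_topology"
proof (rule measurable_limit_j1)
  show "(\<lambda>\<omega>. grid_disc m (q \<omega>)) \<in> N \<rightarrow>\<^sub>M borel_of j1_topology" for m
    unfolding grid_disc_def by (intro measurable_grid_path q(3)) (auto simp: less_imp_le)
  show "limitin j1_topology (\<lambda>m. grid_disc m (q \<omega>)) (q \<omega>) sequentially" if "\<omega> \<in> space N" for \<omega>
    unfolding grid_disc_def by (rule grid_paths_converge) (use q(1,2)[OF that] in \<open>auto simp: skorohod_space_def\<close>)
qed

theorem theorem2:
  fixes P :: "'w measure" and X :: "real \<Rightarrow> 'w \<Rightarrow> real" and \<nu> :: "real measure" and z :: real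
  assumes X: "pure_jump_subordinator P X \<nu>"
    and S: "cond_S1 P X \<or> cond_S2 \<nu> \<or>
      (\<exists>\<gamma>>0. cond_S3_S4 P X \<gamma> \<or> cond_S5 \<nu> \<gamma> \<or> cond_S6 P X \<gamma> \<or> cond_S7 \<nu> \<gamma>)"
    and z: "0 < z"
  shows "(\<exists>!\<gamma>. 0 < \<gamma> \<and> scaled_neg_log_converges P X (exponential_law \<gamma>)) \<and>
    (\<forall>\<gamma>>0. scaled_neg_log_converges P X (exponential_law \<gamma>) \<longrightarrow>
      (\<forall>(N :: 'v measure) \<eta>. extremal_process \<gamma> N \<eta> \<longrightarrow>
        converges_in_distribution j1_topology (at_right 0)
          P (truncated_path z X) N (truncated_extremal_path z \<eta>)))"
proof (intro conjI allI impI)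
  interpret subordinator P X \<nu>
    using X by (simp add: subordinator_def subordinator_axioms_def pure_jump_subordinator_def levy_process_def)
  obtain \<gamma>0 where \<gamma>0: "0 < \<gamma>0" "cond_S5 \<nu> \<gamma>0" using small_time_condition_imp_S5[OF S] by blast
  show "\<exists>!\<gamma>. 0 < \<gamma> \<and> scaled_neg_log_converges P X (exponential_law \<gamma>)"
  proof (intro ex1I[of _ \<gamma>0] conjI)
    show "scaled_neg_log_converges P X (exponential_law \<gamma>0)"
      by (rule S5_imp_scaled_neg_log_converges[OF \<gamma>0(2,1)])
    \<comment> \<open>Every admissible parameter is a limit of \<open>\<phi> s / ln s\<close>, and
      that limit is unique.\<close>
    fix \<gamma> assume "0 < \<gamma> \<and> scaled_neg_log_converges P X (exponential_law \<gamma>)"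
    then have "cond_S5 \<nu> \<gamma>" using S4_imp_S5 by blast
    then show "\<gamma> = \<gamma>0"
      using \<gamma>0(2) unfolding cond_S5_def by (intro tendsto_unique[OF trivial_limit_at_top_linorder])
  qed (rule \<gamma>0)
  fix \<gamma> :: real and N :: "'v measure" and \<eta>
  assume \<gamma>: "0 < \<gamma>" and conv: "scaled_neg_log_converges P X (exponential_law \<gamma>)" and ext: "extremal_process \<gamma> N \<eta>"
  have S5: "cond_S5 \<nu> \<gamma>" by (rule S4_imp_S5[OF \<gamma> conv])
  \<comment> \<open>The null set on which \<open>X'\<close> differs from \<open>X\<close> is common
    to all times, so the truncated paths agree almost surely as functions, which is the freedom that
    \<open>has_law\<close> allows.\<close>
  obtain X' where reg: "regular_subordinator P X' \<nu>" and ae: "AE \<omega> in P. \<forall>t\<ge>0. X' t \<omega> = X t \<omega>"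
    using regular_version by blast
  interpret R: regular_subordinator P X' \<nu> by (rule reg)
  obtain q where "(\<forall>\<omega>\<in>space N. q \<omega> \<in> skorohod_space \<and> antimono_on {0..} (q \<omega>)) \<and>
    (AE \<omega> in N. truncated_extremal_path z \<eta> \<omega> = q \<omega>) \<and> (\<forall>s\<ge>0. (\<lambda>\<omega>. q \<omega> s) \<in> borel_measurable N)"
    using extremal_process_regular_version[OF ext \<gamma> z] by (elim exE)
  then have q: "\<And>\<omega>. \<omega> \<in> space N \<Longrightarrow> q \<omega> \<in> skorohod_space" "\<And>\<omega>. \<omega> \<in> space N \<Longrightarrow> antimono_on {0..} (q \<omega>)"
    "AE \<omega> in N. truncated_extremal_path z \<eta> \<omega> = q \<omega>" "\<And>s. 0 \<le> s \<Longrightarrow> (\<lambda>\<omega>. q \<omega> s) \<in> borel_measurable N"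
    by simp_all
  have qm: "q \<in> N \<rightarrow>\<^sub>M borel_of j1_topology" by (rule measurable_regular_paths[OF q(1,2,4)])
  let ?D = "borel_of j1_topology"
  show "converges_in_distribution j1_topology (at_right 0) P (truncated_path z X) N (truncated_extremal_path z \<eta>)"
    unfolding converges_in_distribution_def
  proof (intro exI conjI)
    show "\<forall>\<^sub>F t in at_right 0. has_law P j1_topology (truncated_path z X t) (distr P ?D (truncated_path z X' t))"
      using eventually_at_right_less[of "0::real"]
    proof eventually_elim
      case (elim t)
      have "AE \<omega> in P. truncated_path z X t \<omega> = truncated_path z X' t \<omega>"
        using ae
      proof eventually_elim
        case (elim \<omega>)
        show ?case unfolding truncated_path_def
          by (intro restrict_ext) (use elim \<open>0 < t\<close> in simp)
      qed
      then show ?case using R.measurable_truncated_path[OF elim, of z] unfolding has_law_def by blast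
    qed
    show "has_law N j1_topology (truncated_extremal_path z \<eta>) (distr N ?D q)"
      using q(3) qm unfolding has_law_def by blast
    show "weakly_converges j1_topology (at_right 0) (\<lambda>t. distr P ?D (truncated_path z X' t)) (distr N ?D q)"
      unfolding weakly_converges_def
    proof (intro allI impI)
      fix f :: "(real \<Rightarrow> real) \<Rightarrow> real"
      assume f: "continuous_map j1_topology euclideanreal f \<and> bounded (f ` topspace j1_topology)"
      then have fm: "f \<in> borel_measurable ?D" by (intro continuous_map_borel_measurable) simp
      have "((\<lambda>t. LINT \<omega>|P. f (truncated_path z X' t \<omega>)) \<longlongrightarrow> (LINT \<omega>|N. f (q \<omega>))) (at_right 0)"
        unfolding tendsto_at_iff_sequentially
      proof (intro allI impI)
        fix t :: "nat \<Rightarrow> real" assume t: "\<forall>i. t i \<in> {0<..} - {0}" "t \<longlonglongrightarrow> 0"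
        have "(\<lambda>n. LINT \<omega>|P. f (truncated_path z X' (t n) \<omega>)) \<longlonglongrightarrow> (LINT \<omega>|N. f (q \<omega>))"
          by (rule R.truncated_path_weak_limit[OF S5 \<gamma> z ext q qm]) (use f t in simp_all)
        then show "((\<lambda>t. LINT \<omega>|P. f (truncated_path z X' t \<omega>)) \<circ> t) \<longlonglongrightarrow> (LINT \<omega>|N. f (q \<omega>))"
          by (simp add: comp_def)
      qed
      moreover have "\<forall>\<^sub>F t in at_right 0. (LINT \<omega>|P. f (truncated_path z X' t \<omega>)) = integral\<^sup>L (distr P ?D (truncated_path z X' t)) f"
        using eventually_at_right_less[of "0::real"]
        by eventually_elim (rule integral_distr[OF R.measurable_truncated_path fm, symmetric])
      ultimately have "((\<lambda>t. integral\<^sup>L (distr P ?D (truncated_path z X' t)) f) \<longlongrightarrow> (LINT \<omega>|N. f (q \<omega>))) (at_right 0)"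
        by (rule Lim_transform_eventually)
      then show "((\<lambda>t. integral\<^sup>L (distr P ?D (truncated_path z X' t)) f) \<longlongrightarrow> integral\<^sup>L (distr N ?D q) f) (at_right 0)"
        by (simp add: integral_distr[OF qm fm])
    qed
  qed
qed

end
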